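(* Let $f$ be a non-constant Dirichlet series with a meromorphic extension of finite order to $\mathbb{C}$ (as in the context). Let $W(f)$ be its Newton-Cramer distribution, let $P_f(s)=c_0+c_1s+\dots+c_{g-1}s^{g-1}$ be its discrepancy polynomial, and let $b_{\mathbf{k}}$ ($\mathbf{k}\in\Lambda$) be the coefficients of $-\log f$. Then, as distributions on $\mathbb{R}$, $$W(f)=\sum_{k=0}^{g-1}c_k\,\delta_0^{(k)}+\sum_{\mathbf{k}\in\Lambda}\langle\boldsymbol{\lambda},\mathbf{k}\rangle\,b_{\mathbf{k}}\,\delta_{\langle\boldsymbol{\lambda},\mathbf{k}\rangle}.$$
   Context: Dirichlet series: $f(s)=1+\sum_{n\ge1}a_ne^{-\lambda_ns}$, non-constant, with $a_n\in\mathbb{C}$, $0<\lambda_1<\lambda_2<\cdots$, where $(\lambda_n)$ is finite or $\lambda_n\to+\infty$, and $\sum_n|a_n|e^{-\lambda_n\bar\sigma}<\infty$ for some $\bar\sigma\in\mathbb{R}$. It is assumed that $f$ extends to a meromorphic function of finite order on $\mathbb{C}$. Divisor: $\rho$ runs over zeros and poles of $f$, with multiplicity $n_\rho\in\mathbb{Z}$ (positive for zeros, negative for poles; $n_\rho=0$ otherwise). The convergence exponent $d$ is the least integer $d\ge0$ with $\sum_{\rho\ne0}|n_\rho||\rho|^{-d}<\infty$ (one has $d\ge1$ here). $\sigma_1=\sup_\rho\Re\rho<+\infty$. Newton-Cramer distribution: with $\mathbf{1}_{\mathbb{R}_+}$ the indicator of $[0,\infty)$, $$K_d(t)=\Big(n_{\sigma_1}\frac{t^d}{d!}+\sum_{\rho\ne\sigma_1}\frac{n_\rho}{(\rho-\sigma_1)^d}e^{(\rho-\sigma_1)t}\Big)\mathbf{1}_{\mathbb{R}_+},\qquad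 W(f)=e^{\sigma_1t}\frac{D^d}{Dt^d}\big((K_d(t)-K_d(0))\mathbf{1}_{\mathbb{R}_+}\big),$$ where $D/Dt$ is the distributional derivative on $\mathbb{R}$. Discrepancy: $G(s)=\frac{n_{\sigma_1}}{s-\sigma_1}+\sum_{\rho\ne\sigma_1}n_\rho\frac{(s-\sigma_1)^{d-1}}{(\rho-\sigma_1)^{d-1}}\frac1{s-\rho}$, and $P_f=G-f'/f$. It is a polynomial of degree at most $g-1$, where $g=\max(\deg Q_f,d-1)$ is the genus, $Q_f$ being the polynomial in the Hadamard factorization $f(s)=s^{n_0}e^{Q_f(s)}\prod_{\rho\ne0}E_{d-1}(s/\rho)^{n_\rho}$, $E_m(z)=(1-z)e^{z+z^2/2+\dots+z^m/m}$. Coefficients: $\Lambda$ is the set of non-zero sequences $\mathbf{k}=(k_n)_{n\ge1}$ of non-negative integers with finitely many non-zero entries, $\|\mathbf{k}\|=\sum k_n$, $\langle\boldsymbol{\lambda},\mathbf{k}\rangle=\sum\lambda_nk_n$, and $b_{\mathbf{k}}=\frac{(-1)^{\|\mathbf{k}\|}}{\|\mathbf{k}\|}\frac{\|\mathbf{k}\|!}{\prod_jk_j!}\prod_ja_j^{k_j}$, so that $-\log f(s)=\sum_{\mathbf{k}\in\Lambda}b_{\mathbf{k}}e^{-\langle\boldsymbol{\lambda},\mathbf{k}\rangle s}$ for $\Re s$ large. $\delta_a$ is the Dirac mass at $a$, $\delta_0^{(k)}$ the $k$-th derivative of $\delta_0$. *)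

theory Defs
  imports
    "HOL-Complex_Analysis.Complex_Analysis"
    "HOL-Computational_Algebra.Polynomial"
begin

definition vderiv :: "(real \<Rightarrow> complex) \<Rightarrow> real \<Rightarrow> complex" where
  "vderiv \<phi> = (\<lambda>t. vector_derivative \<phi> (at t))"

definition test_function :: "(real \<Rightarrow> complex) \<Rightarrow> bool" where
  "test_function \<phi> \<longleftrightarrow>
     (\<forall>n t. ((vderiv ^^ n) \<phi>) differentiable (at t)) \<and> compact (closure {t. \<phi> t \<noteq> 0})"

text \<open>Only the values of a distribution at test functions are meaningful; two distributions
  are equal iff they agree on every \<phi> with \<^term>\<open>test_function \<phi>\<close>.\<close>

type_synonym distr = "(real \<Rightarrow> complex) \<Rightarrow> complex"

definition distr_of_fun :: "(real \<Rightarrow> complex) \<Rightarrow> distr" where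
  "distr_of_fun h = (\<lambda>\<phi>. LINT t|lborel. h t * \<phi> t)"

definition distr_deriv :: "distr \<Rightarrow> distr" where
  "distr_deriv T = (\<lambda>\<phi>. - T (vderiv \<phi>))"

definition distr_mult :: "(real \<Rightarrow> complex) \<Rightarrow> distr \<Rightarrow> distr" where
  "distr_mult u T = (\<lambda>\<phi>. T (\<lambda>t. u t * \<phi> t))"

definition dirac :: "real \<Rightarrow> distr" where
  "dirac x = (\<lambda>\<phi>. \<phi> x)"

definition entire_finite_order :: "(complex \<Rightarrow> complex) \<Rightarrow> bool" where
  "entire_finite_order g \<longleftrightarrow>
     g holomorphic_on UNIV \<and>
     (\<exists>\<alpha>::real. \<forall>\<^sub>F z in at_infinity. norm (g z) \<le> exp (norm z powr \<alpha>))"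

text \<open>Convention: a meromorphic function has finite order iff it is a quotient of two entire
  functions of finite order.\<close>

definition meromorphic_finite_order :: "(complex \<Rightarrow> complex) \<Rightarrow> bool" where
  "meromorphic_finite_order F \<longleftrightarrow>
     (\<exists>g h. entire_finite_order g \<and> entire_finite_order h \<and> (\<exists>z. h z \<noteq> 0) \<and>
            (\<forall>z. h z \<noteq> 0 \<longrightarrow> F z = g z / h z))"

text \<open>The multiplicity of \<rho> is \<^term>\<open>zorder F \<rho>\<close>: positive at zeros,
  negative at poles, and 0 at all other points when \<^term>\<open>F\<close> is meromorphic and not
  identically zero.\<close>

definition divisor_support :: "(complex \<Rightarrow> complex) \<Rightarrow> complex set" where
  "divisor_support F = {\<rho>. isolated_zero F \<rho> \<or> is_pole F \<rho>}"

definition conv_exponent :: "(complex \<Rightarrow> complex) \<Rightarrow> nat" where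
  "conv_exponent F =
     (LEAST d. (\<lambda>\<rho>. real_of_int \<bar>zorder F \<rho>\<bar> / norm \<rho> ^ d) summable_on (divisor_support F - {0}))"

definition sigma1 :: "(complex \<Rightarrow> complex) \<Rightarrow> real" where
  "sigma1 F = (SUP \<rho>\<in>divisor_support F. Re \<rho>)"

definition mult_sigma1 :: "(complex \<Rightarrow> complex) \<Rightarrow> int" where
  "mult_sigma1 F =
     (if of_real (sigma1 F) \<in> divisor_support F then zorder F (of_real (sigma1 F)) else 0)"

definition K_fun :: "(complex \<Rightarrow> complex) \<Rightarrow> real \<Rightarrow> complex" where
  "K_fun F t =
     (let d = conv_exponent F; \<sigma> = complex_of_real (sigma1 F) in
      (of_int (mult_sigma1 F) * of_real t ^ d / fact d
       + (\<Sum>\<^sub>\<infinity>\<rho>\<in>divisor_support F - {\<sigma>}.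
            of_int (zorder F \<rho>) / (\<rho> - \<sigma>) ^ d * exp ((\<rho> - \<sigma>) * of_real t)))
      * indicator {0..} t)"

definition newton_cramer :: "(complex \<Rightarrow> complex) \<Rightarrow> distr" where
  "newton_cramer F =
     distr_mult (\<lambda>t. of_real (exp (sigma1 F * t)))
       ((distr_deriv ^^ conv_exponent F)
          (distr_of_fun (\<lambda>t. (K_fun F t - K_fun F 0) * indicator {0..} t)))"

text \<open>The product over \<rho> is the unordered limit of the finite partial products.  The identity
  is required off the divisor only, where \<^term>\<open>F\<close> is finite and non-zero; this determines
  \<^term>\<open>Q\<close> up to an additive constant in \<open>2\<pi>i\<int>\<close>, so its degree is well defined.\<close>

definition is_hadamard_poly :: "(complex \<Rightarrow> complex) \<Rightarrow> complex poly \<Rightarrow> bool" where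
  "is_hadamard_poly F Q \<longleftrightarrow>
     (\<forall>s. s \<notin> divisor_support F \<longrightarrow>
        ((\<lambda>X. s powi zorder F 0 * exp (poly Q s) *
                (\<Prod>\<rho>\<in>X. weierstrass_factor (conv_exponent F - 1) (s / \<rho>) powi zorder F \<rho>))
           \<longlongrightarrow> F s) (finite_subsets_at_top (divisor_support F - {0})))"

definition hadamard_poly :: "(complex \<Rightarrow> complex) \<Rightarrow> complex poly" where
  "hadamard_poly F = (SOME Q. is_hadamard_poly F Q)"

definition genus :: "(complex \<Rightarrow> complex) \<Rightarrow> nat" where
  "genus F = max (degree (hadamard_poly F)) (conv_exponent F - 1)"

text \<open>If \<sigma>1 is not in the divisor, the first summand is 0 also at \<open>s = \<sigma>1\<close>, since \<open>0 / 0 = 0\<close>.\<close>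

definition G_fun :: "(complex \<Rightarrow> complex) \<Rightarrow> complex \<Rightarrow> complex" where
  "G_fun F s =
     (let d = conv_exponent F; \<sigma> = complex_of_real (sigma1 F) in
      of_int (mult_sigma1 F) / (s - \<sigma>)
      + (\<Sum>\<^sub>\<infinity>\<rho>\<in>divisor_support F - {\<sigma>}.
           of_int (zorder F \<rho>) * ((s - \<sigma>) ^ (d - 1) / (\<rho> - \<sigma>) ^ (d - 1)) * (1 / (s - \<rho>))))"

definition discrepancy_poly :: "(complex \<Rightarrow> complex) \<Rightarrow> complex poly" where
  "discrepancy_poly F =
     (THE P. \<forall>s. s \<notin> divisor_support F \<longrightarrow> poly P s = G_fun F s - deriv F s / F s)"

text \<open>The exponents and coefficients are indexed by a set \<^term>\<open>I\<close>, either
  \<open>{1..N}\<close> or \<open>{1..}\<close>.  Multi-indices are functions on \<^typ>\<open>nat\<close> vanishing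
  outside \<^term>\<open>I\<close>.\<close>

definition mindex_support :: "(nat \<Rightarrow> nat) \<Rightarrow> nat set" where
  "mindex_support k = {n. k n \<noteq> 0}"

definition mindices :: "nat set \<Rightarrow> (nat \<Rightarrow> nat) set" where
  "mindices I =
     {k. mindex_support k \<noteq> {} \<and> finite (mindex_support k) \<and> mindex_support k \<subseteq> I}"

definition mindex_norm :: "(nat \<Rightarrow> nat) \<Rightarrow> nat" where
  "mindex_norm k = (\<Sum>n\<in>mindex_support k. k n)"

definition mindex_freq :: "(nat \<Rightarrow> real) \<Rightarrow> (nat \<Rightarrow> nat) \<Rightarrow> real" where
  "mindex_freq l k = (\<Sum>n\<in>mindex_support k. l n * real (k n))"

definition log_coeff :: "(nat \<Rightarrow> complex) \<Rightarrow> (nat \<Rightarrow> nat) \<Rightarrow> complex" where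
  "log_coeff a k =
     (- 1) ^ mindex_norm k / of_nat (mindex_norm k)
     * (fact (mindex_norm k) / (\<Prod>j\<in>mindex_support k. fact (k j)))
     * (\<Prod>j\<in>mindex_support k. a j ^ k j)"

end

theory Submission
  imports Defs "HOL-Probability.Distributions"
begin

text \<open>
Both sides of the identity are linear functionals of the test function that are continuous for a
norm of the form \<open>sup |f^(j)(t)| e^(s t)\<close> over \<open>t \<ge> 0\<close> and \<open>j \<le> M\<close>. They therefore make sense on
all smooth functions that decay, with all derivatives, like \<open>e^(-s t)\<close> on the half-line, and the
exponentials \<open>e^(-(s + n) t)\<close> with \<open>n\<close> a natural number span a dense subspace: in the variable
\<open>x = e^(-t)\<close> this is the Weierstrass approximation theorem, applied to the highest derivative
and then integrated down from infinity (\<open>exp_sum_dense\<close>). Hence it suffices to compare both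
sides on \<open>e^(-s t)\<close> for real \<open>s\<close> far to the right (\<open>functional_determined_by_exp\<close>).

On the left, integrating the series for \<open>K_d\<close> termwise against \<open>e^(-(s - \<sigma>1) t)\<close> gives exactly
the series \<open>G(s)\<close> (\<open>newton_cramer_exp\<close>); the order of summation and integration may be exchanged
because the divisor lies to the left of \<open>\<sigma>1\<close> and the sum of \<open>|n_\<rho>| |\<rho> - \<sigma>1|^(-d)\<close> converges. On
the right, the derivatives of the Dirac mass give the discrepancy polynomial \<open>P_f(s)\<close> and the
masses at the frequencies give \<open>f'(s) / f(s)\<close> (\<open>arith_side_exp\<close>). The latter rests on the
recurrence of the multinomial coefficients under lowering one index, which turns the sum over
all multi-indices into a product of two simple sums (\<open>log_coeff_sum\<close>). The two values agree
because \<open>P_f = G - f'/f\<close>.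

That last equation has content: \<open>G - f'/f\<close> must be a polynomial, of degree below the genus, and
the genus refers to a Hadamard factorization, which has to be constructed. Write \<open>f = g / h\<close>
with entire \<open>g\<close>, \<open>h\<close> of finite order. Dividing \<open>g\<close> by the product over its zeros in a disc of
radius \<open>R\<close> leaves a function without zeros in this disc; comparing it with \<open>g\<close> on the circle of
radius \<open>4 R\<close> bounds at once the number of zeros and, by the Borel-Caratheodory argument, the
difference between \<open>g'/g\<close> and the sum of its principal parts in the disc, by a power of \<open>R\<close>
(\<open>entire_logderiv_bound\<close>). Consequently \<open>f'/f\<close> minus its Mittag-Leffler series is entire of
polynomial growth, so it is a polynomial by Liouville (\<open>logderiv_eq_poly\<close>). Integrating it gives
the Hadamard polynomial (\<open>hadamard_poly_exists\<close>), and moving the centre of the Mittag-Leffler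
series from \<open>0\<close> to \<open>\<sigma>1\<close> changes it only by a polynomial of degree at most \<open>d - 2\<close>
(\<open>kern_sum_recentre\<close>).

The powers \<open>d - 1\<close> in \<open>G\<close> and in the Hadamard product match the power \<open>d\<close> in \<open>K_d\<close> only because
\<open>d \<ge> 1\<close>. If \<open>d\<close> were \<open>0\<close>, the divisor would be finite and \<open>f'/f\<close> a rational function; but \<open>f'/f\<close>
decays exponentially along the positive real axis, so it would vanish (\<open>infinite_divisor\<close>).
\<close>

section \<open>Test functions and sums of exponentials\<close>

definition smooth :: "(real \<Rightarrow> complex) \<Rightarrow> bool" where
  "smooth f \<longleftrightarrow> (\<forall>n t. ((vderiv ^^ n) f) differentiable (at t))"

lemma vderiv_eqI:
  assumes "\<And>t. (f has_vector_derivative f' t) (at t)"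
  shows "vderiv f = f'"
  unfolding vderiv_def using assms by (auto intro!: ext vector_derivative_at)

lemma smooth_has_vderiv:
  assumes "smooth f"
  shows "((vderiv ^^ n) f has_vector_derivative (vderiv ^^ Suc n) f t) (at t)"
  using assms unfolding smooth_def by (simp add: vderiv_def vector_derivative_works[symmetric])

lemma smooth_continuous:
  assumes "smooth f"
  shows "continuous_on A ((vderiv ^^ n) f)"
  using smooth_has_vderiv[OF assms]
  by (meson continuous_at_imp_continuous_on has_vector_derivative_continuous)

text \<open>
A sequence of functions in which each is the derivative of its predecessor identifies all
iterated derivatives of its first member at once; smoothness of explicit functions is obtained
in the same way.
\<close>

lemma vderiv_chain:
  assumes "\<And>n t. (g n has_vector_derivative g (Suc n) t) (at t)"
  shows "(vderiv ^^ n) (g 0) = g n"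
  by (induction n) (simp_all add: vderiv_eqI[OF assms])

lemma smooth_chain:
  assumes "\<And>n t. (g n has_vector_derivative g (Suc n) t) (at t)"
  shows "smooth (g 0)"
  unfolding smooth_def vderiv_chain[where g = g, OF assms]
  using assms by (auto intro: differentiableI_vector)

lemma vderiv_vderiv_funpow: "(vderiv ^^ n) (vderiv f) = (vderiv ^^ Suc n) f"
  by (simp add: funpow_swap1)

lemma smooth_vderiv:
  assumes "smooth f"
  shows "smooth (vderiv f)"
  using assms unfolding smooth_def vderiv_vderiv_funpow by blast

lemma
  assumes "smooth f" "smooth g"
  shows smooth_lincomb: "smooth (\<lambda>t. a * f t + b * g t)"
    and vderiv_lincomb: "(vderiv ^^ n) (\<lambda>t. a * f t + b * g t) =
                           (\<lambda>t. a * (vderiv ^^ n) f t + b * (vderiv ^^ n) g t)"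
proof -
  let ?h = "\<lambda>n t. a * (vderiv ^^ n) f t + b * (vderiv ^^ n) g t"
  have *: "(?h n has_vector_derivative ?h (Suc n) t) (at t)" for n t
    by (intro derivative_intros smooth_has_vderiv assms)
  show "smooth (\<lambda>t. a * f t + b * g t)"
    using smooth_chain[of ?h, OF *] by simp
  show "(vderiv ^^ n) (\<lambda>t. a * f t + b * g t) = ?h n"
    using vderiv_chain[of ?h, OF *] by simp
qed

lemma
  shows smooth_exp: "smooth (\<lambda>t. exp (z * of_real t))"
    and vderiv_exp: "(vderiv ^^ n) (\<lambda>t. exp (z * of_real t)) = (\<lambda>t. z ^ n * exp (z * of_real t))"
proof -
  let ?h = "\<lambda>n t. z ^ n * exp (z * complex_of_real t)"
  have *: "(?h n has_vector_derivative ?h (Suc n) t) (at t)" for n t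
    unfolding has_vector_derivative_def has_field_derivative_def[symmetric]
    by (auto intro!: derivative_eq_intros has_vector_derivative_real_field simp flip:
        has_vector_derivative_def)
  show "smooth (\<lambda>t. exp (z * of_real t))"
    using smooth_chain[of ?h, OF *] by simp
  show "(vderiv ^^ n) (\<lambda>t. exp (z * of_real t)) = ?h n"
    using vderiv_chain[of ?h, OF *] by simp
qed

lemma exp_mult_deriv:
  assumes "smooth f"
  shows "vderiv (\<lambda>t. of_real (exp (\<sigma> * t)) * f t) =
         (\<lambda>t. of_real (exp (\<sigma> * t)) * (1 * vderiv f t + of_real \<sigma> * f t))"
proof (rule vderiv_eqI)
  fix t
  have 1: "((\<lambda>t. complex_of_real (exp (\<sigma> * t))) has_vector_derivative of_real (\<sigma> * exp (\<sigma> * t)))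
      (at t)"
    by (intro has_vector_derivative_of_real) (auto intro!: derivative_eq_intros)
  have 2: "(f has_vector_derivative vderiv f t) (at t)"
    using smooth_has_vderiv[OF assms, of 0 t] by simp
  show "((\<lambda>t. of_real (exp (\<sigma> * t)) * f t) has_vector_derivative
     complex_of_real (exp (\<sigma> * t)) * (1 * vderiv f t + of_real \<sigma> * f t)) (at t)"
    by (rule derivative_eq_intros 1 2)+ (simp add: algebra_simps)
qed

lemma smooth_exp_mult:
  assumes "smooth f"
  shows "smooth (\<lambda>t. of_real (exp (\<sigma> * t)) * f t)"
proof -
  have "((vderiv ^^ n) (\<lambda>t. of_real (exp (\<sigma> * t)) * f t)) differentiable (at t)" for n t
    using assms
  proof (induction n arbitrary: f)
    case 0
    have "(f has_vector_derivative vderiv f t) (at t)"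
      using smooth_has_vderiv[OF 0, of 0 t] by simp
    hence "f differentiable (at t)" by (rule differentiableI_vector)
    moreover have "(\<lambda>t. complex_of_real (exp (\<sigma> * t))) differentiable (at t)"
      by (intro differentiableI_vector[OF has_vector_derivative_of_real])
          (auto intro!: derivative_eq_intros)
    ultimately show ?case by simp
  next
    case (Suc n)
    have "smooth (\<lambda>t. 1 * vderiv f t + of_real \<sigma> * f t)"
      by (intro smooth_lincomb smooth_vderiv Suc.prems)
    from Suc.IH[OF this] show ?case
      by (simp add: exp_mult_deriv[OF Suc.prems] flip: vderiv_vderiv_funpow del: funpow.simps)
  qed
  thus ?thesis unfolding smooth_def by blast
qed

text \<open>
Multiplication by \<open>e^(\<sigma> t)\<close> conjugates differentiation to \<open>D + \<sigma>\<close>, and \<open>(D + \<sigma>)^n\<close> has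
coefficients of total size \<open>(1 + |\<sigma>|)^n\<close>. Stating the Leibniz rule as a bound keeps the
induction free of binomial sums.
\<close>

lemma exp_mult_bound:
  assumes "smooth f" "0 \<le> t" "\<And>j. j \<le> n \<Longrightarrow> norm ((vderiv ^^ j) f t) \<le> C"
  shows "norm ((vderiv ^^ n) (\<lambda>t. of_real (exp (\<sigma> * t)) * f t) t) \<le>
      (1 + \<bar>\<sigma>\<bar>) ^ n * C * exp (\<sigma> * t)"
  using assms
proof (induction n arbitrary: f C)
  case 0
  thus ?case using 0(3)[of 0] by (simp add: norm_mult mult.commute)
next
  case (Suc n)
  let ?g = "\<lambda>t. 1 * vderiv f t + of_real \<sigma> * f t"
  have sm: "smooth ?g"
    by (intro smooth_lincomb smooth_vderiv Suc.prems)
  have "norm ((vderiv ^^ n) (\<lambda>t. of_real (exp (\<sigma> * t)) * ?g t) t)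
        \<le> (1 + \<bar>\<sigma>\<bar>) ^ n * ((1 + \<bar>\<sigma>\<bar>) * C) * exp (\<sigma> * t)"
  proof (rule Suc.IH[OF sm Suc.prems(2)])
    fix j assume j: "j \<le> n"
    have "norm ((vderiv ^^ j) ?g t) \<le> norm ((vderiv ^^ Suc j) f t) + \<bar>\<sigma>\<bar> * norm
        ((vderiv ^^ j) f t)"
      unfolding vderiv_lincomb[OF smooth_vderiv[OF Suc.prems(1)] Suc.prems(1)]
          vderiv_vderiv_funpow
      by (rule order_trans[OF norm_triangle_ineq]) (simp add: norm_mult)
    also have "\<dots> \<le> C + \<bar>\<sigma>\<bar> * C"
      using j by (intro add_mono mult_left_mono Suc.prems) auto
    finally show "norm ((vderiv ^^ j) ?g t) \<le> (1 + \<bar>\<sigma>\<bar>) * C" by (simp add: algebra_simps)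
  qed
  moreover have "(vderiv ^^ Suc n) (\<lambda>t. of_real (exp (\<sigma> * t)) * f t) =
      (vderiv ^^ n) (\<lambda>t. of_real (exp (\<sigma> * t)) * ?g t)"
    unfolding vderiv_vderiv_funpow[symmetric] exp_mult_deriv[OF Suc.prems(1)] ..
  ultimately show ?case by (simp only: power_Suc mult_ac)
qed

lemma vderiv_eventually_zero:
  assumes "open U" "\<And>t. t \<in> U \<Longrightarrow> f t = 0"
  shows "t \<in> U \<Longrightarrow> (vderiv ^^ n) f t = 0"
proof (induction n arbitrary: t)
  case (Suc n)
  have "((vderiv ^^ n) f has_vector_derivative 0) (at t)"
    by (rule has_vector_derivative_transform_within_open[OF has_vector_derivative_const[of 0]
        assms(1)])
       (use Suc in auto)
  hence "vderiv ((vderiv ^^ n) f) t = 0"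
    unfolding vderiv_def by (rule vector_derivative_at)
  thus ?case by simp
qed (use assms in auto)

lemma test_function_smooth: "test_function \<phi> \<Longrightarrow> smooth \<phi>"
  by (simp add: test_function_def smooth_def)

lemma test_function_support:
  assumes "test_function \<phi>"
  obtains T where "T > 0" "\<And>n t. t > T \<Longrightarrow> (vderiv ^^ n) \<phi> t = 0"
proof -
  have "bounded (closure {t. \<phi> t \<noteq> 0})"
    using assms by (simp add: test_function_def compact_imp_bounded)
  hence "bounded {t. \<phi> t \<noteq> 0}"
    using bounded_subset closure_subset by blast
  then obtain T where T: "T > 0" "\<And>t. \<phi> t \<noteq> 0 \<Longrightarrow> \<bar>t\<bar> \<le> T"
    by (force simp: bounded_pos)
  have "(vderiv ^^ n) \<phi> t = 0" if "t > T" for n t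
    by (rule vderiv_eventually_zero[of "{T<..}"]) (use T that in force)+
  thus ?thesis using T that by blast
qed

text \<open>
Integrating the bound on the derivative from \<open>t\<close> to infinity divides it by \<open>s \<ge> 1\<close>, so the same
exponential bound is inherited by the function itself.
\<close>

lemma norm_le_exp_of_vderiv:
  fixes f :: "real \<Rightarrow> complex"
  assumes "\<And>t. t \<ge> 0 \<Longrightarrow> (f has_vector_derivative f' t) (at t)"
    and bd: "\<And>t. t \<ge> 0 \<Longrightarrow> norm (f' t) \<le> e * exp (- s * t)"
    and lim: "(f \<longlongrightarrow> 0) at_top" and "s \<ge> 1" "t \<ge> 0"
  shows "norm (f t) \<le> e * exp (- s * t)"
proof -
  have e: "e \<ge> 0" using order_trans[OF norm_ge_zero bd[of 0]] by simp
  let ?g = "\<lambda>t. - (e * exp (- s * t) / s)"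
  have gd: "(?g has_vector_derivative e * exp (- s * x)) (at x)" for x
    unfolding has_real_derivative_iff_has_vector_derivative[symmetric]
    using \<open>s \<ge> 1\<close> by (auto intro!: derivative_eq_intros simp: field_simps)
  have *: "norm (f x - f t) \<le> e * exp (- s * t)" if "x > t" for x
  proof -
    have "norm (f x - f t) \<le> ?g x - ?g t"
    proof (rule differentiable_bound_general[OF \<open>x > t\<close>])
      show "continuous_on {t..x} f"
        by (intro continuous_at_imp_continuous_on ballI
            has_vector_derivative_continuous[OF assms(1)])
           (use \<open>t \<ge> 0\<close> in auto)
      show "continuous_on {t..x} ?g"
        by (intro continuous_intros) (use \<open>s \<ge> 1\<close> in auto)
      show "(f has_vector_derivative f' y) (at y)" "norm (f' y) \<le> e * exp (- s * y)"
          if "t < y" "y < x" for y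
        using assms(1) bd \<open>t \<ge> 0\<close> that by auto
    qed (rule gd)
    also have "\<dots> \<le> e * exp (- s * t) / s"
      using e \<open>s \<ge> 1\<close> by simp
    also have "\<dots> \<le> e * exp (- s * t) / 1"
      using e \<open>s \<ge> 1\<close> by (intro divide_left_mono) auto
    finally show ?thesis by simp
  qed
  have "((\<lambda>x. norm (f x - f t)) \<longlongrightarrow> norm (0 - f t)) at_top"
    by (intro tendsto_intros lim)
  hence "norm (0 - f t) \<le> e * exp (- s * t)"
    by (rule tendsto_upperbound[OF _ eventually_mono[OF eventually_gt_at_top[of t] *]]) auto
  thus ?thesis by simp
qed

lemma complex_polynomial_approx:
  fixes f :: "real \<Rightarrow> complex"
  assumes "continuous_on {0..1} f" "e > 0"
  obtains N c where "\<And>x. x \<in> {0..1} \<Longrightarrow> norm (f x - (\<Sum>n\<le>N. c n * of_real x ^ n)) \<le> e"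
proof -
  have *: "\<exists>a n. \<forall>x\<in>{0..1}. \<bar>h x - (\<Sum>i\<le>n. a i * x ^ i)\<bar> < e / 2"
    if h: "continuous_on {0..1} h" for h :: "real \<Rightarrow> real"
  proof -
    have e: "0 < e / 2" using assms(2) by simp
    obtain g where "real_polynomial_function g" "\<And>x. x \<in> {0..1} \<Longrightarrow> \<bar>h x - g x\<bar> < e / 2"
      by (rule Stone_Weierstrass_real_polynomial_function[of "{0..1::real}", OF _ h e]) auto
    thus ?thesis unfolding real_polynomial_function_iff_sum by fastforce
  qed
  obtain a1 n1 where 1: "\<And>x. x \<in> {0..1} \<Longrightarrow> \<bar>Re (f x) - (\<Sum>i\<le>n1. a1 i * x ^ i)\<bar> < e / 2"
    using *[OF continuous_on_Re[OF assms(1)]] by blast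
  obtain a2 n2 where 2: "\<And>x. x \<in> {0..1} \<Longrightarrow> \<bar>Im (f x) - (\<Sum>i\<le>n2. a2 i * x ^ i)\<bar> < e / 2"
    using *[OF continuous_on_Im[OF assms(1)]] by blast
  define c where "c n = Complex (if n \<le> n1 then a1 n else 0) (if n \<le> n2 then a2 n else 0)" for n
  define N where "N = max n1 n2"
  have "norm (f x - (\<Sum>n\<le>N. c n * of_real x ^ n)) \<le> e" if x: "x \<in> {0..1}" for x
  proof -
    have r: "Re (\<Sum>n\<le>N. c n * of_real x ^ n) = (\<Sum>i\<le>n1. a1 i * x ^ i)"
      unfolding c_def Re_sum
      by (rule sum.mono_neutral_cong_right) (auto simp: N_def simp flip: of_real_power)
    have i: "Im (\<Sum>n\<le>N. c n * of_real x ^ n) = (\<Sum>i\<le>n2. a2 i * x ^ i)"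
      unfolding c_def Im_sum
      by (rule sum.mono_neutral_cong_right) (auto simp: N_def simp flip: of_real_power)
    have "norm (f x - (\<Sum>n\<le>N. c n * of_real x ^ n)) \<le>
          \<bar>Re (f x) - (\<Sum>i\<le>n1. a1 i * x ^ i)\<bar> + \<bar>Im (f x) - (\<Sum>i\<le>n2. a2 i * x ^ i)\<bar>"
      using cmod_le[of "f x - (\<Sum>n\<le>N. c n * of_real x ^ n)"] by (simp only: minus_complex.sel r i)
    thus ?thesis using 1[OF x] 2[OF x] by linarith
  qed
  thus ?thesis using that by blast
qed

text \<open>
In the variable \<open>x = e^(-t)\<close> the function \<open>e^(s t) \<phi>^(M)(t)\<close> is continuous on \<open>[0, 1]\<close>, being
zero near \<open>x = 0\<close>, and a polynomial approximation to it is an approximation of \<open>\<phi>^(M)\<close> by a sum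
of exponentials with error \<open>e^(-s t)\<close> times a small constant. Antiderivatives of exponentials
that vanish at infinity are again exponentials, so \<open>norm_le_exp_of_vderiv\<close> carries the
approximation down to all lower derivatives.
\<close>

lemma exp_sum_dense:
  assumes "test_function \<phi>" "s \<ge> 1" "e > 0"
  obtains N c where
    "\<And>j t. j \<le> M \<Longrightarrow> t \<ge> 0 \<Longrightarrow>
       norm ((vderiv ^^ j) \<phi> t - (vderiv ^^ j)
           (\<lambda>t. \<Sum>n\<le>N. c n * exp (- of_real (s + real n) * of_real t)) t)
         \<le> e * exp (- s * t)"
proof -
  obtain T where T: "T > 0" "\<And>n t. t > T \<Longrightarrow> (vderiv ^^ n) \<phi> t = 0"
    using test_function_support[OF assms(1)] by blast
  have sm: "smooth \<phi>" using assms(1) by (rule test_function_smooth)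
  \<comment> \<open>the weighted top derivative in the variable \<open>x = e^(-t)\<close>\<close>
  define h where "h x = (if x \<le> 0 then 0 else (vderiv ^^ M) \<phi> (- ln x) * of_real
      (exp (s * (- ln x))))" for x
  have h0: "h x = 0" if "x < exp (- T)" for x
  proof (cases "x \<le> 0")
    case False
    hence "ln x < - T" using that by (metis exp_less_cancel_iff exp_ln not_le)
    thus ?thesis using T by (simp add: h_def)
  qed (auto simp: h_def)
  have "continuous (at x) h" for x
  proof (cases "x > 0")
    case True
    have c: "continuous_on {0<..} (\<lambda>x. (vderiv ^^ M) \<phi> (- ln x) * of_real (exp (s * (- ln x))))"
      by (intro continuous_intros continuous_on_compose2[OF smooth_continuous[OF sm, of UNIV M]])
          auto
    have "continuous_on {0<..} h"
      by (rule continuous_on_eq[OF c]) (auto simp: h_def)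
    thus ?thesis using True by (simp add: continuous_on_eq_continuous_at)
  next
    case False
    have "continuous_on {..<exp (- T)} h"
      by (rule continuous_on_eq[of _ "\<lambda>_. 0"]) (auto simp: h0)
    moreover have "x < exp (- T)" using False
        by (meson exp_gt_zero less_le_trans not_le less_trans linorder_not_less
        order_le_less_trans)
    ultimately show ?thesis by (simp add: continuous_on_eq_continuous_at)
  qed
  hence "continuous_on {0..1} h" by (intro continuous_at_imp_continuous_on) auto
  from complex_polynomial_approx[OF this \<open>e > 0\<close>] obtain N c where
    c: "\<And>x. x \<in> {0..1} \<Longrightarrow> norm (h x - (\<Sum>n\<le>N. c n * of_real x ^ n)) \<le> e" by blast
  define z where "z n = - complex_of_real (s + real n)" for n
  have z0: "z n \<noteq> 0" for n
    using assms(2) unfolding z_def neg_equal_0_iff_equal of_real_eq_0_iff by linarith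
  \<comment> \<open>dividing by \<open>z_n^M\<close> integrates \<open>exp (z_n t)\<close> \<open>M\<close> times from infinity\<close>
  define b where "b n = c n / z n ^ M" for n
  define q where "q = (\<lambda>j t. \<Sum>n\<le>N. b n * (z n ^ j * exp (z n * complex_of_real t)))"
  have qd: "(q j has_vector_derivative q (Suc j) t) (at t)" for j t
  proof -
    have "((\<lambda>t. z n ^ j * exp (z n * complex_of_real t)) has_vector_derivative z n ^ Suc j * exp
        (z n * complex_of_real t)) (at t)" for n
      using smooth_has_vderiv[OF smooth_exp[of "z n"], of j] unfolding vderiv_exp .
    thus ?thesis unfolding q_def by (intro derivative_intros)
  qed
  have q: "(vderiv ^^ j) (q 0) = q j" for j by (rule vderiv_chain[where g = q, OF qd])
  have top: "norm ((vderiv ^^ M) \<phi> t - q M t) \<le> e * exp (- s * t)" if "t \<ge> 0" for t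
  proof -
    have x: "exp (- t) \<in> {0..1}" using that by auto
    have "q M t = (\<Sum>n\<le>N. c n * of_real (exp (- t)) ^ n) * of_real (exp (- s * t))"
      unfolding q_def b_def sum_distrib_right
    proof (intro sum.cong refl)
      fix n
      have "exp (z n * complex_of_real t) = of_real (exp (- t)) ^ n * of_real (exp (- s * t))"
      proof -
        have "z n * complex_of_real t = of_nat n * of_real (- t) + of_real (- s * t)"
          by (simp add: z_def algebra_simps)
        thus ?thesis by (simp only: exp_add exp_of_nat_mult exp_of_real)
      qed
      thus "c n / z n ^ M * (z n ^ M * exp (z n * complex_of_real t)) =
         c n * complex_of_real (exp (- t)) ^ n * complex_of_real (exp (- s * t))" using z0[of n]
             by simp
    qed
    moreover have "(vderiv ^^ M) \<phi> t = h (exp (- t)) * of_real (exp (- s * t))"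
      by (simp add: h_def flip: of_real_mult exp_add)
    ultimately have "(vderiv ^^ M) \<phi> t - q M t =
        (h (exp (- t)) - (\<Sum>n\<le>N. c n * of_real (exp (- t)) ^ n)) * of_real (exp (- s * t))"
      by (simp add: algebra_simps)
    thus ?thesis using c[OF x] by (simp add: norm_mult)
  qed
  have lim: "((\<lambda>t. (vderiv ^^ j) \<phi> t - q j t) \<longlongrightarrow> 0) at_top" for j
  proof -
    have "((\<lambda>t. exp (z n * complex_of_real t)) \<longlongrightarrow> 0) at_top" for n
    proof -
      have "((\<lambda>t. exp (- ((s + real n) * t))) \<longlongrightarrow> 0) at_top"
      proof -
        have "filterlim (\<lambda>t. (s + real n) * t) at_top at_top"
          using assms(2) by (intro filterlim_tendsto_pos_mult_at_top[OF tendsto_const _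
              filterlim_ident]) auto
        thus ?thesis by (intro filterlim_compose[OF exp_at_bot])
            (simp add: filterlim_uminus_at_top flip: filterlim_uminus_at_bot)
      qed
      moreover have "(\<lambda>t. exp (- ((s + real n) * t))) =
          (\<lambda>t. norm (exp (z n * complex_of_real t)))"
      proof -
        have "Re (z n * complex_of_real t) = - ((s + real n) * t)" for t
          by (simp add: z_def algebra_simps)
        thus ?thesis by simp
      qed
      ultimately show ?thesis by (simp only: tendsto_norm_zero_iff)
    qed
    hence "(q j \<longlongrightarrow> 0) at_top" unfolding q_def
      by (intro tendsto_null_sum tendsto_mult_right_zero)
    moreover have "((vderiv ^^ j) \<phi> \<longlongrightarrow> 0) at_top"
      by (rule tendsto_eventually) (use T in
          \<open>auto intro: eventually_mono[OF eventually_gt_at_top[of T]]\<close>)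
    ultimately show ?thesis using tendsto_diff by fastforce
  qed
  have main: "norm ((vderiv ^^ (M - i)) \<phi> t - q (M - i) t) \<le> e * exp (- s * t)" if "i \<le> M" "t \<ge> 0"
      for i t
    using that
  proof (induction i arbitrary: t)
    case 0
    thus ?case using top by simp
  next
    case (Suc i)
    hence eq: "M - i = Suc (M - Suc i)" by simp
    show ?case
      by (rule norm_le_exp_of_vderiv[where f' = "\<lambda>t. (vderiv ^^ (M - i)) \<phi> t - q (M - i) t"])
         (use Suc lim assms(2) in \<open>auto simp: eq simp del: funpow.simps
            intro!: has_vector_derivative_diff smooth_has_vderiv[OF sm] qd\<close>)
  qed
  have "(\<lambda>t. \<Sum>n\<le>N. b n * exp (- of_real (s + real n) * of_real t)) = q 0"
    by (simp add: q_def z_def)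
  hence "(vderiv ^^ j) (\<lambda>t. \<Sum>n\<le>N. b n * exp (- of_real (s + real n) * of_real t)) = q j" for j
    by (simp only: q)
  moreover have "norm ((vderiv ^^ j) \<phi> t - q j t) \<le> e * exp (- s * t)" if "j \<le> M" "t \<ge> 0" for j t
    using main[of "M - j" t] that by simp
  ultimately show ?thesis using that[where c = b and N = N] by presburger
qed

text \<open>
The common domain of both sides of the identity: only the half-line \<open>t \<ge> 0\<close> matters to them, and
it contains the test functions as well as the exponentials.
\<close>

definition rapid :: "real \<Rightarrow> (real \<Rightarrow> complex) \<Rightarrow> bool" where
  "rapid s f \<longleftrightarrow> smooth f \<and> (\<forall>j. \<exists>K. \<forall>t\<ge>0. norm ((vderiv ^^ j) f t) \<le> K * exp (- s * t))"

lemma rapid_lincomb: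
  assumes "rapid s f" "rapid s g"
  shows "rapid s (\<lambda>t. a * f t + b * g t)"
  unfolding rapid_def
proof (intro conjI allI)
  have sm: "smooth f" "smooth g" using assms by (auto simp: rapid_def)
  show "smooth (\<lambda>t. a * f t + b * g t)" by (intro smooth_lincomb sm)
  fix j
  obtain K L where K: "\<And>t. t \<ge> 0 \<Longrightarrow> norm ((vderiv ^^ j) f t) \<le> K * exp (- s * t)"
    and L: "\<And>t. t \<ge> 0 \<Longrightarrow> norm ((vderiv ^^ j) g t) \<le> L * exp (- s * t)"
    using assms unfolding rapid_def by meson
  have "norm ((vderiv ^^ j) (\<lambda>t. a * f t + b * g t) t) \<le>
      (norm a * K + norm b * L) * exp (- s * t)"
    if "t \<ge> 0" for t
  proof -
    have "norm ((vderiv ^^ j) (\<lambda>t. a * f t + b * g t) t)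
       \<le> norm a * norm ((vderiv ^^ j) f t) + norm b * norm ((vderiv ^^ j) g t)"
      unfolding vderiv_lincomb[OF sm] using norm_triangle_ineq by (simp flip: norm_mult)
    also have "\<dots> \<le> norm a * (K * exp (- s * t)) + norm b * (L * exp (- s * t))"
      by (intro add_mono mult_left_mono K L that) auto
    finally show ?thesis by (simp add: algebra_simps)
  qed
  thus "\<exists>K. \<forall>t\<ge>0. norm ((vderiv ^^ j) (\<lambda>t. a * f t + b * g t) t) \<le> K * exp (- s * t)" by blast
qed

lemma rapid_exp:
  assumes "s \<le> u"
  shows "rapid s (\<lambda>t. exp (- of_real u * of_real t))"
  unfolding rapid_def
proof (intro conjI allI)
  show "smooth (\<lambda>t. exp (- complex_of_real u * complex_of_real t))" by (rule smooth_exp)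
  fix j
  have "norm ((vderiv ^^ j) (\<lambda>t. exp (- complex_of_real u * complex_of_real t)) t)
         \<le> \<bar>u\<bar> ^ j * exp (- s * t)" if "t \<ge> 0" for t
    unfolding vderiv_exp using assms that by
        (simp add: norm_mult norm_power mult_left_mono mult_right_mono)
  thus "\<exists>K. \<forall>t\<ge>0. norm ((vderiv ^^ j) (\<lambda>t. exp (- complex_of_real u * complex_of_real t)) t) \<le>
      K * exp (- s * t)"
    by blast
qed

lemma rapid_test_function:
  assumes "test_function \<phi>"
  shows "rapid s \<phi>"
  unfolding rapid_def
proof (intro conjI allI)
  show sm: "smooth \<phi>" using assms by (rule test_function_smooth)
  fix j
  obtain T where T: "T > 0" "\<And>n t. t > T \<Longrightarrow> (vderiv ^^ n) \<phi> t = 0"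
    using test_function_support[OF assms(1)] by blast
  have "compact ((\<lambda>t. (vderiv ^^ j) \<phi> t * of_real (exp (s * t))) ` {0..T})"
    by (intro compact_continuous_image continuous_intros smooth_continuous[OF sm]) auto
  then obtain K where K: "K > 0" "\<And>t. t \<in> {0..T} \<Longrightarrow>
      norm ((vderiv ^^ j) \<phi> t * of_real (exp (s * t))) \<le> K"
    by (auto dest!: compact_imp_bounded simp: bounded_pos)
  have "norm ((vderiv ^^ j) \<phi> t) \<le> K * exp (- s * t)" if "t \<ge> 0" for t
  proof (cases "t \<le> T")
    case True
    thus ?thesis using K(2)[of t] that by (simp add: norm_mult exp_minus field_simps)
  qed (use T K in auto)
  thus "\<exists>K. \<forall>t\<ge>0. norm ((vderiv ^^ j) \<phi> t) \<le> K * exp (- s * t)" by blast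
qed

text \<open>
The Laplace transform determines a distribution: by density of the exponentials, a continuous
functional that annihilates them annihilates the test functions.
\<close>

lemma functional_determined_by_exp:
  fixes A :: distr
  assumes lin: "\<And>f g a b. rapid s f \<Longrightarrow> rapid s g \<Longrightarrow> A (\<lambda>t. a * f t + b * g t) = a * A f + b * A g"
    and bound: "\<And>f e. rapid s f \<Longrightarrow> (\<And>j t. j \<le> M \<Longrightarrow> t \<ge> 0 \<Longrightarrow> norm ((vderiv ^^ j) f t) \<le>
        e * exp (- s * t)) \<Longrightarrow>
                  norm (A f) \<le> C * e"
    and ann: "\<And>n. A (\<lambda>t. exp (- of_real (s + real n) * of_real t)) = 0"
    and "s \<ge> 1" "test_function \<phi>"
  shows "A \<phi> = 0"
proof -
  define E where "E n t = exp (- complex_of_real (s + real n) * of_real t)" for n t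
  have E: "rapid s (E n)" and AE: "A (E n) = 0" for n
    using rapid_exp[of s "s + real n"] ann[of n] by (simp_all add: E_def[abs_def])
  have rap: "rapid s \<phi>" using assms by (intro rapid_test_function)
  have sum: "rapid s (\<lambda>t. \<Sum>n\<le>N. c n * E n t) \<and> A (\<lambda>t. \<Sum>n\<le>N. c n * E n t) = 0" for N c
  proof (induction N)
    case 0
    have eq: "(\<lambda>t. \<Sum>n\<le>0. c n * E n t) = (\<lambda>t. c 0 * E 0 t + 0 * E 0 t)"
      by simp
    show ?case unfolding eq lin[OF E E] AE by (intro conjI rapid_lincomb E) simp
  next
    case (Suc N)
    have eq: "(\<lambda>t. \<Sum>n\<le>Suc N. c n * E n t) = (\<lambda>t. 1 * (\<Sum>n\<le>N. c n * E n t) + c (Suc N) * E (Suc N)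
        t)"
      by simp
    show ?case unfolding eq lin[OF conjunct1[OF Suc] E] AE conjunct2[OF Suc]
      by (intro conjI rapid_lincomb E conjunct1[OF Suc]) simp
  qed
  have "norm (A \<phi>) \<le> C * e" if "e > 0" for e
  proof -
    obtain N c where *: "\<And>j t. j \<le> M \<Longrightarrow> t \<ge> 0 \<Longrightarrow>
       norm ((vderiv ^^ j) \<phi> t - (vderiv ^^ j) (\<lambda>t. \<Sum>n\<le>N. c n * E n t) t) \<le> e * exp (- s * t)"
    proof (rule exp_sum_dense[OF assms(5,4) \<open>e > 0\<close>, of M, folded E_def])
      fix N c
      assume "\<And>j t. j \<le> M \<Longrightarrow> t \<ge> 0 \<Longrightarrow>
       norm ((vderiv ^^ j) \<phi> t - (vderiv ^^ j) (\<lambda>t. \<Sum>n\<le>N. c n * E n t) t) \<le> e * exp (- s * t)"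
      thus thesis by (rule that)
    qed
    let ?q = "\<lambda>t. \<Sum>n\<le>N. c n * E n t"
    let ?f = "\<lambda>t. 1 * \<phi> t + (- 1) * ?q t"
    have q: "rapid s ?q" "A ?q = 0" using sum[of c N] by blast+
    have "norm (A ?f) \<le> C * e"
    proof (rule bound[OF rapid_lincomb[OF rap q(1)]])
      fix j t assume "j \<le> M" "t \<ge> (0::real)"
      with * show "norm ((vderiv ^^ j) ?f t) \<le> e * exp (- s * t)"
        using rap q(1) by (subst vderiv_lincomb) (simp_all add: rapid_def)
    qed
    thus ?thesis unfolding lin[OF rap q(1), of 1 "-1"] q(2) by simp
  qed
  hence le: "norm (A \<phi>) \<le> C * e" if "e > 0" for e using that by blast
  have "((\<lambda>e. C * e) \<longlongrightarrow> C * 0) (at_right 0)" by (intro tendsto_intros)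
  hence "norm (A \<phi>) \<le> C * 0"
    by (rule tendsto_lowerbound[OF _ eventually_mono[OF eventually_at_right_less[of 0] le]]) auto
  thus ?thesis by simp
qed

section \<open>Multi-indices and the logarithmic derivative of a Dirichlet series\<close>

text \<open>
The contribution of the multi-index \<open>k\<close> to the expansion of \<open>(x_1 + x_2 + ...)^|k|\<close>.
\<close>

definition multinomial_term :: "(nat \<Rightarrow> 'a::real_normed_field) \<Rightarrow> (nat \<Rightarrow> nat) \<Rightarrow> 'a" where
  "multinomial_term x k = fact (mindex_norm k) / (\<Prod>j\<in>mindex_support k. fact (k j)) *
      (\<Prod>j\<in>mindex_support k. x j ^ k j)"

text \<open>
Unlike \<open>\<Lambda>\<close>, this set contains the zero multi-index. Lowering an entry of an element of \<open>\<Lambda>\<close> leads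
to this larger set.
\<close>

definition mindices0 :: "nat set \<Rightarrow> (nat \<Rightarrow> nat) set" where
  "mindices0 I = {k. finite (mindex_support k) \<and> mindex_support k \<subseteq> I}"

definition incr :: "nat \<Rightarrow> (nat \<Rightarrow> nat) \<Rightarrow> nat \<Rightarrow> nat" where
  "incr n k = k(n := Suc (k n))"

definition decr :: "nat \<Rightarrow> (nat \<Rightarrow> nat) \<Rightarrow> nat \<Rightarrow> nat" where
  "decr n k = k(n := k n - 1)"

lemma mindex_support_incr [simp]: "mindex_support (incr n k) = insert n (mindex_support k)"
  by (auto simp: mindex_support_def incr_def)

lemma decr_incr [simp]: "decr n (incr n k) = k"
  by (simp add: decr_def incr_def)

lemma incr_decr [simp]: "n \<in> mindex_support k \<Longrightarrow> incr n (decr n k) = k"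
  by (auto simp add: decr_def incr_def mindex_support_def)

lemma mindex_support_decr: "mindex_support (decr n k) \<subseteq> mindex_support k"
  by (auto simp: mindex_support_def decr_def)

lemma mindex_norm_incr:
  assumes "finite (mindex_support k)"
  shows "mindex_norm (incr n k) = Suc (mindex_norm k)"
proof -
  let ?J = "insert n (mindex_support k)"
  have "mindex_norm k = (\<Sum>j\<in>?J. k j)"
    unfolding mindex_norm_def by (rule sum.mono_neutral_left)
        (use assms in \<open>auto simp: mindex_support_def\<close>)
  also have "\<dots> = k n + (\<Sum>j\<in>?J - {n}. k j)"
    using assms by (subst sum.remove[of _ n]) auto
  finally have 1: "mindex_norm k = k n + (\<Sum>j\<in>?J - {n}. k j)" .
  have "mindex_norm (incr n k) = (\<Sum>j\<in>?J. incr n k j)" by (simp add: mindex_norm_def)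
  also have "\<dots> = incr n k n + (\<Sum>j\<in>?J - {n}. incr n k j)"
    using assms by (subst sum.remove[of _ n]) auto
  also have "\<dots> = Suc (k n) + (\<Sum>j\<in>?J - {n}. k j)"
    by (intro arg_cong2[of _ _ _ _ "(+)"] sum.cong) (auto simp: incr_def)
  finally show ?thesis using 1 by simp
qed

text \<open>
Raising one index multiplies the multinomial coefficient by \<open>|k| / k_n\<close> (for the raised
multi-index) and the monomial by \<open>x_n\<close>.
\<close>

lemma multinomial_term_incr:
  assumes "finite (mindex_support k)"
  shows "of_nat (incr n k n) * multinomial_term x (incr n k) =
         of_nat (mindex_norm (incr n k)) * (x n * multinomial_term x k)"
proof -
  let ?J = "insert n (mindex_support k)"
  have f: "(\<Prod>j\<in>?J. fact (incr n k j)) = (of_nat (Suc (k n)) :: 'a) *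
      (\<Prod>j\<in>mindex_support k. fact (k j))"
  proof -
    have "(\<Prod>j\<in>?J. fact (incr n k j)) = fact (incr n k n) * (\<Prod>j\<in>?J-{n}. fact (incr n k j) :: 'a)"
      using assms by (subst prod.remove[of _ n]) auto
    also have "(\<Prod>j\<in>?J-{n}. fact (incr n k j) :: 'a) = (\<Prod>j\<in>?J-{n}. fact (k j))"
      by (intro prod.cong) (auto simp: incr_def)
    also have "fact (incr n k n) = (of_nat (Suc (k n)) * fact (k n) :: 'a)"
      by (simp add: incr_def)
    also have "\<dots> * (\<Prod>j\<in>?J-{n}. fact (k j)) = of_nat (Suc (k n)) * (\<Prod>j\<in>?J. fact (k j))"
      using assms by (subst (2) prod.remove[of _ n]) (auto simp: mult_ac)
    also have "(\<Prod>j\<in>?J. fact (k j) :: 'a) = (\<Prod>j\<in>mindex_support k. fact (k j))"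
      using assms by (intro prod.mono_neutral_right) (auto simp: mindex_support_def)
    finally show ?thesis .
  qed
  have p: "(\<Prod>j\<in>?J. x j ^ incr n k j) = x n * (\<Prod>j\<in>mindex_support k. x j ^ k j)"
  proof -
    have "(\<Prod>j\<in>?J. x j ^ incr n k j) = x n ^ incr n k n * (\<Prod>j\<in>?J-{n}. x j ^ incr n k j)"
      using assms by (subst prod.remove[of _ n]) auto
    also have "(\<Prod>j\<in>?J-{n}. x j ^ incr n k j) = (\<Prod>j\<in>?J-{n}. x j ^ k j)"
      by (intro prod.cong) (auto simp: incr_def)
    also have "x n ^ incr n k n = x n * x n ^ k n"
      by (simp add: incr_def)
    also have "\<dots> * (\<Prod>j\<in>?J-{n}. x j ^ k j) = x n * (\<Prod>j\<in>?J. x j ^ k j)"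
      using assms by (subst (2) prod.remove[of _ n]) (auto simp: mult_ac)
    also have "(\<Prod>j\<in>?J. x j ^ k j) = (\<Prod>j\<in>mindex_support k. x j ^ k j)"
      using assms by (intro prod.mono_neutral_right) (auto simp: mindex_support_def)
    finally show ?thesis .
  qed
  have nz: "(\<Prod>j\<in>mindex_support k. fact (k j) :: 'a) \<noteq> 0"
      by (cases "finite (mindex_support k)") simp_all
  have s: "(of_nat (Suc (k n)) :: 'a) \<noteq> 0" by (simp only: of_nat_eq_0_iff)
  have i: "incr n k n = Suc (k n)" by (simp add: incr_def)
  show ?thesis
    unfolding multinomial_term_def mindex_support_incr f p mindex_norm_incr[OF assms] i fact_Suc
  proof -
    define P where "P = (\<Prod>j\<in>mindex_support k. fact (k j) :: 'a)"
    define Q where "Q = (\<Prod>j\<in>mindex_support k. x j ^ k j)"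
    define m where "m = (of_nat (Suc (k n)) :: 'a)"
    define N where "N = (of_nat (Suc (mindex_norm k)) :: 'a)"
    show "m * (N * fact (mindex_norm k) / (m * P) * (x n * Q)) =
        N * (x n * (fact (mindex_norm k) / P * Q))"
    proof -
      have "m \<noteq> 0" using s unfolding m_def .
      thus ?thesis by (simp add: divide_simps)
    qed
  qed
qed

lemma multinomial_term_decr:
  assumes "finite (mindex_support k)" "n \<in> mindex_support k"
  shows "of_nat (k n) * multinomial_term x k =
      of_nat (mindex_norm k) * (x n * multinomial_term x (decr n k))"
  using multinomial_term_incr[of "decr n k" n x] assms
      finite_subset[OF mindex_support_decr assms(1)] by simp

text \<open>
Sum \<open>multinomial_term_decr\<close> over the support and use that the entries of \<open>k\<close> add up to \<open>|k|\<close>.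
This is \<open>(x_1 + x_2 + ...)^(N + 1) = (x_1 + x_2 + ...) (x_1 + x_2 + ...)^N\<close>, read off
coefficient by coefficient.
\<close>

lemma multinomial_term_recurrence:
  assumes "finite (mindex_support k)" "mindex_support k \<noteq> {}"
  shows "multinomial_term x k = (\<Sum>n\<in>mindex_support k. x n * multinomial_term x (decr n k))"
proof -
  have nz: "mindex_norm k \<noteq> 0" using assms by (auto simp: mindex_norm_def mindex_support_def)
  have "of_nat (mindex_norm k) * multinomial_term x k =
      (\<Sum>n\<in>mindex_support k. of_nat (k n) * multinomial_term x k)"
    by (simp add: mindex_norm_def sum_distrib_right)
  also have "\<dots> = of_nat (mindex_norm k) * (\<Sum>n\<in>mindex_support k. x n * multinomial_term x
      (decr n k))"
    using assms by (simp add: multinomial_term_decr sum_distrib_left)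
  finally show ?thesis using nz by simp
qed

lemma norm_multinomial_term: "norm (multinomial_term x k) = multinomial_term (\<lambda>n. norm (x n)) k"
  by (simp add: multinomial_term_def norm_mult norm_divide prod_norm[symmetric] norm_power)

lemma multinomial_term_nonneg: "(\<And>n. x n \<ge> 0) \<Longrightarrow> multinomial_term x k \<ge> (0::real)"
  by (auto simp: multinomial_term_def intro!: mult_nonneg_nonneg divide_nonneg_nonneg prod_nonneg)

lemma multinomial_term_uminus:
  assumes "finite (mindex_support k)"
  shows "multinomial_term (\<lambda>n. - x n) k = (- 1) ^ mindex_norm k * multinomial_term x k"
proof -
  have "(\<Prod>j\<in>mindex_support k. (- x j) ^ k j) = (\<Prod>j\<in>mindex_support k. (- 1) ^ k j * x j ^ k j)"
    by (intro prod.cong refl) (rule power_minus)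
  also have "\<dots> = (- 1) ^ mindex_norm k * (\<Prod>j\<in>mindex_support k. x j ^ k j)"
    by (simp add: prod.distrib mindex_norm_def power_sum)
  finally show ?thesis by (simp add: multinomial_term_def)
qed

lemma mindices0_eq: "mindices0 I = insert (\<lambda>_. 0) (mindices I)"
  by (auto simp: mindices0_def mindices_def mindex_support_def)

lemma multinomial_term_zero [simp]: "multinomial_term x (\<lambda>_. 0) = 1"
  by (simp add: multinomial_term_def mindex_support_def mindex_norm_def)

text \<open>
Factorizes the sums over \<open>\<Lambda>\<close> below: marking an element of the support of a non-zero multi-index
and lowering the index there leaves an index and an arbitrary multi-index, independent of each
other.
\<close>

lemma bij_incr:
  "bij_betw (\<lambda>(k, n). (n, decr n k)) (Sigma (mindices I) mindex_support) (I \<times> mindices0 I)"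
proof (rule bij_betw_byWitness[where f' = "\<lambda>(n, k). (incr n k, n)"])
  show "(\<lambda>(k, n). (n, decr n k)) ` (Sigma (mindices I) mindex_support) \<subseteq> I \<times> mindices0 I"
  proof safe
    fix k n assume k: "k \<in> mindices I" and n: "n \<in> mindex_support k"
    thus "n \<in> I" by (auto simp: mindices_def)
    show "decr n k \<in> mindices0 I"
      using k mindex_support_decr[of n k] by
          (auto simp: mindices_def mindices0_def intro: finite_subset)
  qed
  show "(\<lambda>(n, k). (incr n k, n)) ` (I \<times> mindices0 I) \<subseteq> Sigma (mindices I) mindex_support"
    by (auto simp: mindices_def mindices0_def)
qed auto

text \<open>
Induction on the largest degree that occurs: the recurrence bounds the part of positive degree
by \<open>r\<close> times a sum of smaller degree.
\<close>

lemma sum_multinomial_term_le: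
  fixes x :: "nat \<Rightarrow> real"
  assumes nn: "\<And>n. x n \<ge> 0" and le: "\<And>J. finite J \<Longrightarrow> J \<subseteq> I \<Longrightarrow> sum x J \<le> r"
  assumes "finite A" "A \<subseteq> mindices0 I" "\<And>k. k \<in> A \<Longrightarrow> mindex_norm k \<le> m"
  shows "(\<Sum>k\<in>A. multinomial_term x k) \<le> (\<Sum>i\<le>m. r ^ i)"
  using assms(3-)
proof (induction m arbitrary: A)
  case 0
  have "A \<subseteq> {\<lambda>_. 0}"
  proof
    fix k assume k: "k \<in> A"
    hence "mindex_norm k = 0" "finite (mindex_support k)" using 0 by (auto simp: mindices0_def)
    hence "mindex_support k = {}" by (auto simp: mindex_norm_def mindex_support_def)
    thus "k \<in> {\<lambda>_. 0}" by (auto simp: mindex_support_def)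
  qed
  hence "(\<Sum>k\<in>A. multinomial_term x k) \<le> (\<Sum>k\<in>{\<lambda>_. 0}. multinomial_term x k)"
    by (intro sum_mono2) (auto simp: multinomial_term_nonneg nn)
  thus ?case by simp
next
  case (Suc m)
  have r: "r \<ge> 0" using le[of "{}"] by simp
  define A' where "A' = A - {\<lambda>_. 0}"
  have A': "A' \<subseteq> mindices I" "finite A'" using Suc.prems by (auto simp: A'_def mindices0_eq)
  define S where "S = Sigma A' mindex_support"
  have finS: "finite S" unfolding S_def using A'
      by (intro finite_SigmaI) (auto simp: mindices_def)
  define J where "J = fst ` (\<lambda>(k, n). (n, decr n k)) ` S"
  define B where "B = snd ` (\<lambda>(k, n). (n, decr n k)) ` S"
  have sub: "(\<lambda>(k, n). (n, decr n k)) ` S \<subseteq> I \<times> mindices0 I"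
    unfolding bij_betw_imp_surj_on[OF bij_incr[of I], symmetric]
    by (intro image_mono) (use A' in \<open>auto simp: S_def\<close>)
  have inj: "inj_on (\<lambda>(k, n). (n, decr n k)) S"
    using bij_betw_imp_inj_on[OF bij_incr[of I]]
        by (rule inj_on_subset) (use A' in \<open>auto simp: S_def\<close>)
  have "(\<Sum>k\<in>A'. multinomial_term x k) = (\<Sum>k\<in>A'. \<Sum>n\<in>mindex_support k. x n * multinomial_term x
      (decr n k))"
    by (intro sum.cong refl multinomial_term_recurrence) (use A' in \<open>auto simp: mindices_def\<close>)
  also have "\<dots> = (\<Sum>(k, n)\<in>S. x n * multinomial_term x (decr n k))"
    unfolding S_def by (rule sum.Sigma) (use A' in \<open>auto simp: mindices_def\<close>)
  also have "\<dots> = (\<Sum>(n, k)\<in>(\<lambda>(k, n). (n, decr n k)) ` S. x n * multinomial_term x k)"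
    by (subst sum.reindex[OF inj]) (simp add: case_prod_unfold)
  also have "\<dots> \<le> (\<Sum>(n, k)\<in>J \<times> B. x n * multinomial_term x k)"
  proof (rule sum_mono2)
    show "finite (J \<times> B)" using finS by (simp add: J_def B_def)
    show "(\<lambda>(k, n). (n, decr n k)) ` S \<subseteq> J \<times> B" unfolding J_def B_def by (rule subset_fst_snd)
    show "0 \<le> (case p of (n, k) \<Rightarrow> x n * multinomial_term x k)" for p
      by (cases p) (simp add: nn multinomial_term_nonneg)
  qed
  also have "\<dots> = sum x J * (\<Sum>k\<in>B. multinomial_term x k)"
    by (simp add: sum_product sum.cartesian_product)
  also have "\<dots> \<le> r * (\<Sum>i\<le>m. r ^ i)"
  proof (rule mult_mono)
    show "sum x J \<le> r" by (rule le) (use finS sub in \<open>auto simp: J_def\<close>)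
    show "(\<Sum>k\<in>B. multinomial_term x k) \<le> (\<Sum>i\<le>m. r ^ i)"
    proof (rule Suc.IH)
      show "finite B" using finS by (simp add: B_def)
      show "B \<subseteq> mindices0 I" using sub by (auto simp: B_def)
      fix k assume "k \<in> B"
      then obtain k' n where k': "k' \<in> A'" "n \<in> mindex_support k'" "k = decr n k'"
        by (auto simp: B_def S_def)
      have "finite (mindex_support k)"
        using k' A' finite_subset[OF mindex_support_decr[of n k']] by (auto simp: mindices_def)
      hence "mindex_norm k' = Suc (mindex_norm k)"
        using mindex_norm_incr[of k n] k' by simp
      thus "mindex_norm k \<le> m" using Suc.prems(3)[of k'] k' by (auto simp: A'_def)
    qed
  qed (auto simp: r nn sum_nonneg multinomial_term_nonneg)
  finally have *: "(\<Sum>k\<in>A'. multinomial_term x k) \<le> r * (\<Sum>i\<le>m. r ^ i)" .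
  have "(\<Sum>k\<in>A. multinomial_term x k) \<le> (\<Sum>k\<in>insert (\<lambda>_. 0) A'. multinomial_term x k)"
    by (rule sum_mono2) (use A' nn in \<open>auto simp: A'_def multinomial_term_nonneg\<close>)
  also have "\<dots> = 1 + (\<Sum>k\<in>A'. multinomial_term x k)"
    using A' by (subst sum.insert) (auto simp: A'_def)
  also have "\<dots> \<le> 1 + r * (\<Sum>i\<le>m. r ^ i)" using * by simp
  also have "\<dots> = (\<Sum>i\<le>Suc m. r ^ i)"
    by (subst sum.atMost_Suc_shift) (simp add: sum_distrib_left)
  finally show ?case .
qed

lemma multinomial_term_abs_summable:
  fixes x :: "nat \<Rightarrow> complex"
  assumes "(\<lambda>n. norm (x n)) summable_on I" "(\<Sum>\<^sub>\<infinity>n\<in>I. norm (x n)) < 1"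
  shows "(\<lambda>k. norm (multinomial_term x k)) summable_on mindices0 I"
proof (rule nonneg_bdd_above_summable_on)
  define r where "r = (\<Sum>\<^sub>\<infinity>n\<in>I. norm (x n))"
  have r: "0 \<le> r" "r < 1" using assms by (auto simp: r_def infsum_nonneg)
  have "(\<Sum>k\<in>A. norm (multinomial_term x k)) \<le> 1 / (1 - r)" if "A \<subseteq> mindices0 I" "finite A" for A
  proof -
    have "(\<Sum>k\<in>A. norm (multinomial_term x k)) \<le> (\<Sum>i\<le>Max (mindex_norm ` A). r ^ i)"
      unfolding norm_multinomial_term
    proof (rule sum_multinomial_term_le[where I = I])
      show "sum (\<lambda>n. norm (x n)) J \<le> r" if "finite J" "J \<subseteq> I" for J
        unfolding r_def by (rule finite_sum_le_infsum) (use that assms in auto)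
    qed (use that in auto)
    also have "\<dots> \<le> (\<Sum>i. r ^ i)"
      by (rule sum_le_suminf) (use r in \<open>auto intro!: summable_geometric\<close>)
    also have "\<dots> = 1 / (1 - r)" using r by (subst suminf_geometric) auto
    finally show ?thesis .
  qed
  thus "bdd_above (sum (\<lambda>k. norm (multinomial_term x k)) ` {F. F \<subseteq> mindices0 I \<and> finite F})"
    by (intro bdd_aboveI2[where M = "1 / (1 - r)"]) auto
qed auto

lemma has_sum_product_complex:
  fixes f :: "'a \<Rightarrow> complex" and g :: "'b \<Rightarrow> complex"
  assumes "(\<lambda>x. norm (f x)) summable_on A" "(\<lambda>x. norm (g x)) summable_on B"
  shows "((\<lambda>(x, y). f x * g y) has_sum infsum f A * infsum g B) (A \<times> B)"
proof -
  have f: "(f has_sum infsum f A) A" and g: "(g has_sum infsum g B) B"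
    using assms abs_summable_summable by (auto intro!: has_sum_infsum)
  have "(\<lambda>p. norm (case p of (x, y) \<Rightarrow> f x * g y)) summable_on (A \<times> B)"
  proof (rule summable_on_SigmaI)
    show "((\<lambda>y. norm (case (x, y) of (x, y) \<Rightarrow> f x * g y)) has_sum
        norm (f x) * infsum (\<lambda>y. norm (g y)) B) B" for x
      using has_sum_cmult_right[OF has_sum_infsum[OF assms(2)], of "norm (f x)"]
          by (simp add: norm_mult)
    show "(\<lambda>x. norm (f x) * infsum (\<lambda>y. norm (g y)) B) summable_on A"
      by (rule summable_on_cmult_left[OF assms(1)])
  qed auto
  hence s: "(\<lambda>p. case p of (x, y) \<Rightarrow> f x * g y) summable_on (A \<times> B)"
    by (rule abs_summable_summable)
  show ?thesis
  proof (rule has_sum_SigmaI)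
    show "((\<lambda>y. case (x, y) of (x, y) \<Rightarrow> f x * g y) has_sum (f x * infsum g B)) B" for x
      using has_sum_cmult_right[OF g, of "f x"] by simp
    show "((\<lambda>x. f x * infsum g B) has_sum infsum f A * infsum g B) A"
      using has_sum_cmult_left[OF f] by simp
  qed (rule s)
qed

text \<open>
The bijection \<open>bij_incr\<close> makes the double sum a product. The weights \<open>c = 1\<close> give the geometric
series below, and \<open>c = \<lambda>\<close> the logarithmic derivative.
\<close>

lemma mindex_sum_weighted:
  fixes x c :: "nat \<Rightarrow> complex"
  assumes "(\<lambda>n. norm (x n)) summable_on I" "(\<Sum>\<^sub>\<infinity>n\<in>I. norm (x n)) < 1"
    and "(\<lambda>n. norm (c n * x n)) summable_on I"
  shows "((\<lambda>k. \<Sum>n\<in>mindex_support k. c n * (x n * multinomial_term x (decr n k)))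
            has_sum (\<Sum>\<^sub>\<infinity>n\<in>I. c n * x n) * (\<Sum>\<^sub>\<infinity>k\<in>mindices0 I. multinomial_term x k)) (mindices I)"
proof -
  have "((\<lambda>(n, k). (c n * x n) * multinomial_term x k) has_sum
           (\<Sum>\<^sub>\<infinity>n\<in>I. c n * x n) * (\<Sum>\<^sub>\<infinity>k\<in>mindices0 I. multinomial_term x k)) (I \<times> mindices0 I)"
    by (intro has_sum_product_complex multinomial_term_abs_summable assms)
  hence "((\<lambda>(k, n). c n * (x n * multinomial_term x (decr n k))) has_sum
           (\<Sum>\<^sub>\<infinity>n\<in>I. c n * x n) * (\<Sum>\<^sub>\<infinity>k\<in>mindices0 I. multinomial_term x k))
               (Sigma (mindices I) mindex_support)"
    by (subst (asm) has_sum_reindex_bij_betw[OF bij_incr, symmetric])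
        (simp add: case_prod_unfold mult_ac)
  thus ?thesis
    by (rule has_sum_SigmaD) (auto intro!: has_sum_finite simp: mindices_def)
qed

text \<open>
By the recurrence the sum \<open>S\<close> satisfies \<open>S = 1 + (x_1 + x_2 + ...) S\<close>.
\<close>

lemma mindex_geometric:
  fixes x :: "nat \<Rightarrow> complex"
  assumes "(\<lambda>n. norm (x n)) summable_on I" "(\<Sum>\<^sub>\<infinity>n\<in>I. norm (x n)) < 1"
  shows "(\<Sum>\<^sub>\<infinity>k\<in>mindices0 I. multinomial_term x k) = 1 / (1 - (\<Sum>\<^sub>\<infinity>n\<in>I. x n))"
proof -
  define S where "S = (\<Sum>\<^sub>\<infinity>k\<in>mindices0 I. multinomial_term x k)"
  define u where "u = (\<Sum>\<^sub>\<infinity>n\<in>I. x n)"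
  have "norm u \<le> (\<Sum>\<^sub>\<infinity>n\<in>I. norm (x n))" unfolding u_def by (rule norm_infsum_bound[OF assms(1)])
  hence u: "1 - u \<noteq> 0" using assms(2) by auto
  have "((\<lambda>k. \<Sum>n\<in>mindex_support k. 1 * (x n * multinomial_term x (decr n k))) has_sum
      (\<Sum>\<^sub>\<infinity>n\<in>I. 1 * x n) * S) (mindices I)"
    unfolding S_def by (rule mindex_sum_weighted) (use assms in auto)
  also have "?this \<longleftrightarrow> (multinomial_term x has_sum u * S) (mindices I)"
    unfolding u_def by (simp, intro has_sum_cong multinomial_term_recurrence[symmetric])
        (auto simp: mindices_def)
  finally have "(multinomial_term x has_sum (multinomial_term x (\<lambda>_. 0) + u * S)) (mindices0 I)"
    unfolding mindices0_eq by (intro has_sum_insert) (auto simp: mindices_def mindex_support_def)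
  from infsumI[OF this] have "S = 1 + u * S"
      by (simp only: S_def[symmetric] multinomial_term_zero)
  hence "S * (1 - u) = 1" by (simp add: algebra_simps)
  thus ?thesis using u unfolding S_def[symmetric] u_def[symmetric] by (simp add: field_simps)
qed

text \<open>
Since \<open>\<langle>\<lambda>, k\<rangle>\<close> is the sum of the \<open>\<lambda>_n k_n\<close> and \<open>k_n / |k|\<close> times the multinomial term lowers the
index \<open>n\<close>, the weight \<open>\<langle>\<lambda>, k\<rangle>\<close> cancels the denominator \<open>|k|\<close> of the logarithm, and what remains
is the weighted sum above at \<open>-x\<close>. The right-hand side is \<open>f'(s) / f(s)\<close>.
\<close>

lemma log_coeff_sum:
  fixes a :: "nat \<Rightarrow> complex" and l :: "nat \<Rightarrow> real" and s :: real
  defines "x \<equiv> (\<lambda>n. a n * exp (- of_real (l n) * of_real s))"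
  assumes "(\<lambda>n. norm (x n)) summable_on I" "(\<Sum>\<^sub>\<infinity>n\<in>I. norm (x n)) < 1"
    and "(\<lambda>n. norm (of_real (l n) * x n)) summable_on I"
  shows "((\<lambda>k. of_real (mindex_freq l k) * log_coeff a k * exp
      (- of_real s * of_real (mindex_freq l k)))
            has_sum - (\<Sum>\<^sub>\<infinity>n\<in>I. of_real (l n) * x n) / (1 + (\<Sum>\<^sub>\<infinity>n\<in>I. x n))) (mindices I)"
proof -
  let ?y = "\<lambda>n. - x n"
  have "((\<lambda>k. \<Sum>n\<in>mindex_support k. of_real (l n) * (?y n * multinomial_term ?y (decr n k)))
     has_sum (\<Sum>\<^sub>\<infinity>n\<in>I. of_real (l n) * ?y n) * (\<Sum>\<^sub>\<infinity>k\<in>mindices0 I. multinomial_term ?y k))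
         (mindices I)"
    by (rule mindex_sum_weighted) (use assms(2-) in auto)
  also have "(\<Sum>\<^sub>\<infinity>k\<in>mindices0 I. multinomial_term ?y k) = 1 / (1 + (\<Sum>\<^sub>\<infinity>n\<in>I. x n))"
    by (subst mindex_geometric) (use assms(2-) in \<open>auto simp: infsum_uminus\<close>)
  also have "(\<Sum>\<^sub>\<infinity>n\<in>I. of_real (l n) * ?y n) = - (\<Sum>\<^sub>\<infinity>n\<in>I. of_real (l n) * x n)"
    by (simp add: infsum_uminus)
  finally have *: "((\<lambda>k. \<Sum>n\<in>mindex_support k. of_real (l n) *
      (?y n * multinomial_term ?y (decr n k)))
     has_sum - (\<Sum>\<^sub>\<infinity>n\<in>I. of_real (l n) * x n) / (1 + (\<Sum>\<^sub>\<infinity>n\<in>I. x n))) (mindices I)" by simp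
  have "(\<Sum>n\<in>mindex_support k. of_real (l n) * (?y n * multinomial_term ?y (decr n k))) =
        of_real (mindex_freq l k) * log_coeff a k * exp (- of_real s * of_real (mindex_freq l k))"
    if k: "k \<in> mindices I" for k
  proof -
    have fin: "finite (mindex_support k)" and ne: "mindex_support k \<noteq> {}" using k
        by (auto simp: mindices_def)
    have "mindex_norm k \<noteq> 0" using fin ne by (auto simp: mindex_norm_def mindex_support_def)
    hence nz: "of_nat (mindex_norm k) \<noteq> (0::complex)"
        by (simp only: of_nat_eq_0_iff not_False_eq_True)
    have "?y n * multinomial_term ?y (decr n k) =
        of_nat (k n) * multinomial_term ?y k / of_nat (mindex_norm k)"
      if "n \<in> mindex_support k" for n
      using multinomial_term_decr[OF fin that, of ?y] nz by (simp add: field_simps)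
    hence "(\<Sum>n\<in>mindex_support k. of_real (l n) * (?y n * multinomial_term ?y (decr n k))) =
           (\<Sum>n\<in>mindex_support k. of_real (l n) * of_nat (k n) *
               (multinomial_term ?y k / of_nat (mindex_norm k)))"
      by (intro sum.cong) auto
    also have "\<dots> = of_real (mindex_freq l k) * (multinomial_term ?y k / of_nat (mindex_norm k))"
      by (simp add: mindex_freq_def sum_distrib_right sum_divide_distrib)
    finally have 1: "(\<Sum>n\<in>mindex_support k. of_real (l n) *
        (?y n * multinomial_term ?y (decr n k))) =
        of_real (mindex_freq l k) * (multinomial_term ?y k / of_nat (mindex_norm k))" .
    have 2: "multinomial_term ?y k = (- 1) ^ mindex_norm k * multinomial_term x k"
      by (rule multinomial_term_uminus[OF fin])
    have 3: "(\<Prod>j\<in>mindex_support k. x j ^ k j) =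
               (\<Prod>j\<in>mindex_support k. a j ^ k j) * exp (- of_real s * of_real (mindex_freq l k))"
    proof -
      have "x j ^ k j = a j ^ k j * exp (of_nat (k j) * (- of_real (l j) * of_real s))" for j
        unfolding x_def power_mult_distrib exp_of_nat_mult ..
      hence "(\<Prod>j\<in>mindex_support k. x j ^ k j) = (\<Prod>j\<in>mindex_support k. a j ^ k j) *
          exp (\<Sum>j\<in>mindex_support k. of_nat (k j) * (- of_real (l j) * of_real s))"
        by (simp only: prod.distrib exp_sum[OF fin])
      also have "(\<Sum>j\<in>mindex_support k. of_nat (k j) * (- of_real (l j) * complex_of_real s)) =
          - of_real s * complex_of_real (mindex_freq l k)"
        by (simp add: mindex_freq_def sum_distrib_left sum_negf mult_ac)
      finally show ?thesis .
    qed
    have 4: "multinomial_term x k = fact (mindex_norm k) / (\<Prod>j\<in>mindex_support k. fact (k j)) *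
        ((\<Prod>j\<in>mindex_support k. a j ^ k j) * exp (- of_real s * of_real (mindex_freq l k)))"
      by (simp only: multinomial_term_def 3)
    show ?thesis by (simp only: 1 2 4 log_coeff_def) (simp only: divide_inverse mult_ac)
  qed
  from has_sum_cong[THEN iffD1, OF this *] show ?thesis .
qed

section \<open>Divisors and zero-free factors\<close>

text \<open>
Logarithmic derivatives are handled in the form \<open>f' = f u\<close>, in which \<open>u\<close> adds up under products
and which makes sense also at zeros of \<open>f\<close>.
\<close>

lemma logderiv_mult:
  fixes f g :: "complex \<Rightarrow> complex"
  assumes "(f has_field_derivative f z * u) (at z)" "(g has_field_derivative g z * v) (at z)"
  shows "((\<lambda>w. f w * g w) has_field_derivative f z * g z * (u + v)) (at z)"
  using DERIV_mult[OF assms] by (simp add: algebra_simps)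

lemma logderiv_powi:
  fixes f :: "complex \<Rightarrow> complex"
  assumes "(f has_field_derivative f z * u) (at z)" "f z \<noteq> 0"
  shows "((\<lambda>w. f w powi n) has_field_derivative f z powi n * (of_int n * u)) (at z)"
proof -
  have "((\<lambda>w. f w powi n) has_field_derivative of_int n * f z powi (n - 1) * (f z * u)) (at z)"
    by (rule derivative_eq_intros assms refl)+ (use assms in auto)
  thus ?thesis using assms(2) by (simp add: power_int_diff field_simps)
qed

lemma logderiv_prod:
  fixes f :: "'a \<Rightarrow> complex \<Rightarrow> complex"
  assumes "\<And>x. x \<in> X \<Longrightarrow> (f x has_field_derivative f x z * u x) (at z)"
  shows "((\<lambda>w. \<Prod>x\<in>X. f x w) has_field_derivative (\<Prod>x\<in>X. f x z) * (\<Sum>x\<in>X. u x)) (at z)"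
  using assms
proof (induction X rule: infinite_finite_induct)
  case (insert x X)
  thus ?case using logderiv_mult[of "f x" z "u x" "\<lambda>w. \<Prod>x\<in>X. f x w" "\<Sum>x\<in>X. u x"]
    by simp
qed auto

lemma holomorphic_log_on_ball:
  assumes "r holomorphic_on ball c R" "\<And>z. z \<in> ball c R \<Longrightarrow> r z \<noteq> 0" "R > 0"
  obtains L where "L holomorphic_on ball c R" "\<And>z. z \<in> ball c R \<Longrightarrow> r z = r c * exp (L z)" "L c = 0"
    "\<And>z. z \<in> ball c R \<Longrightarrow> (L has_field_derivative deriv r z / r z) (at z)"
proof -
  obtain g where g: "g holomorphic_on ball c R" "\<And>x. x \<in> ball c R \<Longrightarrow> exp (g x) = r x"
    using holomorphic_logarithm_exists[OF convex_ball open_ball assms(1,2), of c] assms(3) by auto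
  define L where "L z = g z - g c" for z
  have hol: "L holomorphic_on ball c R" unfolding L_def by (intro holomorphic_intros g)
  have c: "c \<in> ball c R" using assms(3) by simp
  have eq: "r z = r c * exp (L z)" if "z \<in> ball c R" for z
    using g(2)[OF that] g(2)[OF c] assms(2)[OF c] by (simp add: L_def exp_diff field_simps)
  have "(L has_field_derivative deriv r z / r z) (at z)" if z: "z \<in> ball c R" for z
  proof -
    have Ld: "(L has_field_derivative deriv L z) (at z)"
      using holomorphic_derivI[OF hol open_ball z] .
    have "((\<lambda>z. r c * exp (L z)) has_field_derivative r c * (exp (L z) * deriv L z)) (at z)"
      using DERIV_cmult[OF DERIV_chain2[OF DERIV_exp Ld], of "r c"] by simp
    hence "(r has_field_derivative r c * (exp (L z) * deriv L z)) (at z)"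
      by (rule has_field_derivative_transform_within_open[OF _ open_ball z]) (simp add: eq)
    hence "deriv r z = r z * deriv L z"
      using eq[OF z] by (simp add: DERIV_imp_deriv)
    thus ?thesis using Ld assms(2)[OF z] by simp
  qed
  with hol eq show ?thesis using that by (simp add: L_def)
qed

text \<open>
The logarithm \<open>L\<close> of \<open>r / r(c)\<close> has real part at most \<open>A\<close>, and \<open>L / (2 B - L)\<close> with \<open>B = A + 1\<close>
maps the disc into the unit disc and \<open>c\<close> to \<open>0\<close>. The Schwarz lemma bounds \<open>L\<close> by \<open>6 B\<close> on the
disc of radius \<open>3 R / 4\<close>, and the Cauchy inequality on circles of radius \<open>R / 4\<close> bounds its
derivative \<open>r'/r\<close>.
\<close>

lemma Borel_Caratheodory_logderiv:
  assumes hol: "r holomorphic_on ball c R" and nz: "\<And>z. z \<in> ball c R \<Longrightarrow> r z \<noteq> 0" and "R > 0"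
    and bd: "\<And>z. z \<in> ball c R \<Longrightarrow> norm (r z) \<le> exp A * norm (r c)" and z: "dist c z \<le> R / 2"
  shows "norm (deriv r z / r z) \<le> 24 * (A + 1) / R"
proof -
  obtain L where L: "L holomorphic_on ball c R" "\<And>z. z \<in> ball c R \<Longrightarrow> r z = r c * exp (L z)" "L c =
      0"
    "\<And>z. z \<in> ball c R \<Longrightarrow> (L has_field_derivative deriv r z / r z) (at z)"
    using holomorphic_log_on_ball[OF hol nz \<open>R > 0\<close>] by blast
  define B where "B = A + 1"
  have c: "c \<in> ball c R" using \<open>R > 0\<close> by simp
  have Re: "Re (L w) \<le> A" if "w \<in> ball c R" for w
    using bd[OF that] L(2)[OF that] nz[OF c] by (simp add: norm_mult)
  have "A \<ge> 0" using Re[OF c] L(3) by simp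
  hence B: "B > 0" "B \<ge> 1" by (auto simp: B_def)
  have lt: "norm (L w) < norm (2 * B - L w)" if "w \<in> ball c R" for w
  proof -
    have 1: "Re (L w) < B" using Re[OF that] by (simp add: B_def)
    have "(norm (2 * B - L w))\<^sup>2 - (norm (L w))\<^sup>2 = 4 * B * (B - Re (L w))"
      unfolding cmod_power2 by (simp add: power2_eq_square algebra_simps)
    also have "\<dots> > 0" using 1 B by simp
    finally show ?thesis by (simp add: power2_less_imp_less)
  qed
  define \<phi> where "\<phi> \<zeta> = L (c + of_real R * \<zeta>) / (2 * B - L (c + of_real R * \<zeta>))" for \<zeta>
  have inb: "c + of_real R * \<zeta> \<in> ball c R" if "norm \<zeta> < 1" for \<zeta>
    using that \<open>R > 0\<close> by (simp add: dist_norm norm_mult)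
  have nz2: "2 * B - L w \<noteq> 0" if "w \<in> ball c R" for w
    using lt[OF that] by auto
  have hol\<phi>: "\<phi> holomorphic_on ball 0 1"
    unfolding \<phi>_def
  proof (intro holomorphic_intros)
    show "(\<lambda>\<zeta>. L (c + of_real R * \<zeta>)) holomorphic_on ball 0 1"
      by (rule holomorphic_on_compose_gen[OF _ L(1), unfolded o_def])
         (use inb in \<open>auto intro!: holomorphic_intros\<close>)
    thus "(\<lambda>\<zeta>. L (c + of_real R * \<zeta>)) holomorphic_on ball 0 1" .
  qed (use inb nz2 in auto)
  have Lb: "norm (L w) \<le> 6 * B" if w: "dist c w \<le> 3 / 4 * R" for w
  proof -
    define \<zeta> where "\<zeta> = (w - c) / of_real R"
    have w': "w = c + of_real R * \<zeta>" using \<open>R > 0\<close> by (simp add: \<zeta>_def)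
    have \<zeta>: "norm \<zeta> \<le> 3 / 4"
      using w \<open>R > 0\<close> by (simp add: \<zeta>_def norm_divide field_simps dist_norm norm_minus_commute)
    have "norm (\<phi> \<zeta>) \<le> norm \<zeta>"
    proof (rule Schwarz_Lemma(1)[OF hol\<phi>])
      show "\<phi> 0 = 0" by (simp add: \<phi>_def L)
      show "norm (\<phi> z) < 1" if "norm z < 1" for z
        using lt[OF inb[OF that]] nz2[OF inb[OF that]]
            by (simp add: \<phi>_def norm_divide divide_simps)
    qed (use \<zeta> in auto)
    hence "norm (L w / (2 * B - L w)) \<le> 3 / 4"
      using \<zeta> by (simp add: \<phi>_def w')
    moreover have wb: "w \<in> ball c R" using w \<open>R > 0\<close> by simp
    ultimately have "norm (L w) \<le> 3 / 4 * norm (2 * B - L w)"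
      using nz2[OF wb] by (simp add: norm_divide divide_simps)
    also have "\<dots> \<le> 3 / 4 * (2 * B + norm (L w))"
      using norm_triangle_ineq4[of "complex_of_real (2 * B)" "L w"] B by simp
    finally show ?thesis by simp
  qed
  have sub: "cball z (R / 4) \<subseteq> {w. dist c w \<le> 3 / 4 * R}"
  proof
    fix w assume "w \<in> cball z (R / 4)"
    hence "dist z w \<le> R / 4" by simp
    thus "w \<in> {w. dist c w \<le> 3 / 4 * R}" using z dist_triangle[of c w z] by simp
  qed
  have "{w. dist c w \<le> 3 / 4 * R} \<subseteq> ball c R" using \<open>R > 0\<close> by auto
  hence sub2: "cball z (R / 4) \<subseteq> ball c R" using sub by blast
  have "norm ((deriv ^^ 1) L z) \<le> fact 1 * (6 * B) / (R / 4) ^ 1"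
  proof (rule Cauchy_inequality)
    show "L holomorphic_on ball z (R / 4)"
      by (rule holomorphic_on_subset[OF L(1)]) (use sub2 in auto)
    show "continuous_on (cball z (R / 4)) L"
      by (rule continuous_on_subset[OF holomorphic_on_imp_continuous_on[OF L(1)] sub2])
    show "norm (L x) \<le> 6 * B" if "norm (z - x) = R / 4" for x
      using Lb[of x] sub that by (auto simp: dist_norm)
  qed (use \<open>R > 0\<close> in auto)
  moreover have "z \<in> ball c R" using z \<open>R > 0\<close> by simp
  ultimately show ?thesis using L(4)[of z] by (simp add: DERIV_imp_deriv B_def)
qed

lemma nonconst_eventually_nonzero:
  assumes "F nicely_meromorphic_on UNIV" "\<exists>z. F z \<noteq> 0"
  shows "eventually (\<lambda>w. F w \<noteq> 0) (at z)"
  using nicely_meromorphic_imp_constant_or_avoid[OF assms(1), of 0] assms(2)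
  by (auto simp: eventually_cosparse_open_eq)

lemma nicely_mero_at:
  assumes "F nicely_meromorphic_on UNIV"
  shows "F meromorphic_on {z}"
  using assms by (meson meromorphic_on_subset nicely_meromorphic_on_def subset_UNIV)

lemma
  assumes F: "F nicely_meromorphic_on UNIV" "\<exists>z. F z \<noteq> 0" and z: "z \<notin> divisor_support F"
  shows off_divisor_analytic: "F analytic_on {z}" and off_divisor_nonzero: "F z \<noteq> 0"
    and off_divisor_zorder: "zorder F z = 0"
proof -
  have np: "\<not> is_pole F z" and ni: "\<not> isolated_zero F z" using z
      by (auto simp: divisor_support_def)
  show "F analytic_on {z}"
    by (rule nicely_meromorphic_on_imp_analytic_at[OF F(1) _ np]) simp
  show "F z \<noteq> 0"
    using zero_or_pole[OF F(1) _ _ nonconst_eventually_nonzero[OF F], of z] np ni by auto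
  show "zorder F z = 0"
    by (intro not_pole_not_isolated_zero_imp_zorder_eq_0 nicely_mero_at F np ni
          eventually_frequently nonconst_eventually_nonzero) auto
qed

lemma on_divisor_zorder:
  assumes F: "F nicely_meromorphic_on UNIV" "\<exists>z. F z \<noteq> 0" and z: "z \<in> divisor_support F"
  shows "zorder F z \<noteq> 0"
proof -
  have iso: "isolated_singularity_at F z" using nicely_mero_at[OF F(1), of z]
      by (simp add: meromorphic_at_iff)
  from z consider "isolated_zero F z" | "is_pole F z" by (auto simp: divisor_support_def)
  thus ?thesis
  proof cases
    case 1
    thus ?thesis using zorder_isolated_zero_pos'[OF 1 iso] by simp
  next
    case 2
    thus ?thesis using isolated_pole_imp_neg_zorder[OF iso 2] by simp
  qed
qed

lemma divisor_eventually_not: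
  assumes F: "F nicely_meromorphic_on UNIV"
  shows "eventually (\<lambda>w. w \<notin> divisor_support F) (at z)"
proof -
  have "F meromorphic_on UNIV" using F by (simp add: nicely_meromorphic_on_def)
  hence "eventually (\<lambda>z. \<not> is_pole F z) (cosparse UNIV)"
      "eventually (\<lambda>z. \<not> isolated_zero F z) (cosparse UNIV)"
    by (rule meromorphic_on_imp_not_pole_cosparse, rule meromorphic_on_imp_not_zero_cosparse)
  hence "eventually (\<lambda>z. z \<notin> divisor_support F) (cosparse UNIV)"
    by eventually_elim (auto simp: divisor_support_def)
  thus ?thesis by (auto simp: eventually_cosparse_open_eq)
qed

lemma divisor_not_islimpt:
  assumes F: "F nicely_meromorphic_on UNIV"
  shows "\<not> z islimpt divisor_support F"
  using divisor_eventually_not[OF F, of z] by (simp add: islimpt_iff_eventually)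

lemma divisor_finite_Int_bounded:
  assumes F: "F nicely_meromorphic_on UNIV" and "bounded B"
  shows "finite (divisor_support F \<inter> B)"
proof -
  have "finite (closure B \<inter> divisor_support F)"
    using assms by (intro finite_not_islimpt_in_compact divisor_not_islimpt)
        (auto simp: compact_closure)
  thus ?thesis by (rule finite_subset[rotated]) (use closure_subset in auto)
qed

lemma divisor_closed:
  assumes F: "F nicely_meromorphic_on UNIV"
  shows "closed (divisor_support F)"
  using divisor_not_islimpt[OF F] by (simp add: closed_limpt)

text \<open>
Divide by \<open>(s - \<rho>)^(n_\<rho>)\<close> for all \<open>\<rho> \<in> X\<close> and remove the singularities. The quotient has order
\<open>0\<close> at every point of \<open>X\<close> and off the divisor, hence neither a zero nor a pole there.
\<close>

lemma factor_divisor: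
  assumes F: "F nicely_meromorphic_on UNIV" "\<exists>z. F z \<noteq> 0" and X: "finite X"
  obtains H where
    "\<And>s. s \<in> X \<or> s \<notin> divisor_support F \<Longrightarrow> H analytic_on {s} \<and> H s \<noteq> 0"
    "\<And>s. F analytic_on {s} \<Longrightarrow> H analytic_on {s}"
    "\<And>s. s \<notin> divisor_support F \<Longrightarrow> F s = H s * (\<Prod>\<rho>\<in>X. (s - \<rho>) powi zorder F \<rho>)"
    "\<And>s. F analytic_on {s} \<Longrightarrow> s \<notin> X \<Longrightarrow> F s = H s * (\<Prod>\<rho>\<in>X. (s - \<rho>) powi zorder F \<rho>)"
proof -
  define p where "p s = (\<Prod>\<rho>\<in>X. (s - \<rho>) powi (- zorder F \<rho>))" for s
  define f where "f s = F s * p s" for s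
  define H where "H = remove_sings f"
  have pm: "p meromorphic_on {s}" for s
    unfolding p_def by (intro meromorphic_intros)
  have fm: "f meromorphic_on {s}" for s
    unfolding f_def by (intro meromorphic_intros pm nicely_mero_at F)
  have pnz: "eventually (\<lambda>w. p w \<noteq> 0) (at z)" for z
  proof -
    have "eventually (\<lambda>w. w \<notin> X) (at z)"
      using islimpt_finite[OF X, of z] by (simp add: islimpt_iff_eventually)
    thus ?thesis by eventually_elim (use X in \<open>auto simp: p_def\<close>)
  qed
  have fnz: "eventually (\<lambda>w. f w \<noteq> 0) (at z)" for z
    using pnz nonconst_eventually_nonzero[OF F] by eventually_elim (auto simp: f_def)
  have pa: "p analytic_on {s}" if "\<And>\<rho>. \<rho> \<in> X \<Longrightarrow> s = \<rho> \<Longrightarrow> zorder F \<rho> = 0" for s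
  proof -
    have "(\<lambda>s. (s - \<rho>) powi (- zorder F \<rho>)) analytic_on {s}" if "\<rho> \<in> X" for \<rho>
    proof (cases "s = \<rho>")
      case True
      thus ?thesis using \<open>\<And>\<rho>. \<rho> \<in> X \<Longrightarrow> s = \<rho> \<Longrightarrow> zorder F \<rho> = 0\<close>[OF that] by simp
    qed (auto intro!: analytic_intros)
    thus ?thesis unfolding p_def by (intro analytic_on_prod)
  qed
  have zf: "zorder f s = zorder F s + (if s \<in> X then - zorder F s else 0)" for s
  proof -
    have "zorder f s = zorder F s + zorder p s"
      unfolding f_def by (intro zorder_mult nicely_mero_at F pm eventually_frequently pnz
          nonconst_eventually_nonzero) auto
    also have "zorder p s = (\<Sum>\<rho>\<in>X. zorder (\<lambda>s. (s - \<rho>) powi (- zorder F \<rho>)) s)"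
      unfolding p_def using pnz[of s] by (intro zorder_prod meromorphic_intros) (simp add: p_def)
    also have "\<dots> = (\<Sum>\<rho>\<in>X. if \<rho> = s then - zorder F s else 0)"
    proof (rule sum.cong[OF refl])
      fix \<rho> assume "\<rho> \<in> X"
      have *: "zorder (\<lambda>s. (s - \<rho>) powi (- zorder F \<rho>)) s = (- zorder F \<rho>) * zorder (\<lambda>s. s - \<rho>) s"
        by (rule zorder_power_int) (auto intro!: meromorphic_intros eventually_frequently simp:
            eventually_neq_at_within)
      show "zorder (\<lambda>s. (s - \<rho>) powi (- zorder F \<rho>)) s = (if \<rho> = s then - zorder F s else 0)"
      proof (cases "\<rho> = s")
        case True
        have "zorder (\<lambda>w. w - s) s = 1"
          by (rule zorder_eqI[of UNIV _ "\<lambda>_. 1"]) (auto intro!: holomorphic_intros)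
        thus ?thesis using True * by simp
      next
        case False
        have "zorder (\<lambda>w. w - \<rho>) s = 0"
          by (rule zorder_eqI[of UNIV _ "\<lambda>w. w - \<rho>"])
              (use False in \<open>auto intro!: holomorphic_intros\<close>)
        thus ?thesis using False * by simp
      qed
    qed
    also have "\<dots> = (if s \<in> X then - zorder F s else 0)" using X by simp
    finally show ?thesis .
  qed
  have Hn: "H nicely_meromorphic_on UNIV"
    unfolding H_def using fm by (intro remove_sings_nicely_meromorphic)
        (subst meromorphic_on_meromorphic_at, auto)
  have iso: "isolated_singularity_at f s" for s using fm[of s] by (simp add: meromorphic_at_iff)
  have 1: "H analytic_on {s} \<and> H s \<noteq> 0" if "s \<in> X \<or> s \<notin> divisor_support F" for s
  proof -
    have "zorder f s = 0" using that off_divisor_zorder[OF F] by (auto simp: zf)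
    hence zH: "zorder H s = 0" unfolding H_def using iso by simp
    have ev: "eventually (\<lambda>w. H w = f w) (at s)"
      unfolding H_def by (rule eventually_remove_sings_eq_at[OF iso])
    have "eventually (\<lambda>w. H w \<noteq> 0) (at s)"
      using ev fnz[of s] by eventually_elim auto
    hence "\<exists>z. H z \<noteq> 0" using eventually_happens'[OF at_neq_bot] by blast
    note H = Hn this
    have "s \<notin> divisor_support H" using on_divisor_zorder[OF H] zH by blast
    thus ?thesis using off_divisor_analytic[OF H] off_divisor_nonzero[OF H] by blast
  qed
  have 2: "H s = f s \<and> H analytic_on {s}" if "F analytic_on {s}" "s \<in> X \<Longrightarrow> zorder F s = 0" for s
  proof -
    have fa: "f analytic_on {s}" unfolding f_def
        by (intro analytic_intros that pa) (use that in auto)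
    thus ?thesis by (simp add: H_def remove_sings_analytic_on)
  qed
  have 3: "H analytic_on {s}" if "F analytic_on {s}" for s
    using 1[of s] 2[OF that] by blast
  have 4: "F s = H s * (\<Prod>\<rho>\<in>X. (s - \<rho>) powi zorder F \<rho>)"
    if s: "F analytic_on {s}" "s \<in> X \<Longrightarrow> zorder F s = 0" for s
  proof -
    have "H s = f s" using 2[OF s] by blast
    moreover have "p s * (\<Prod>\<rho>\<in>X. (s - \<rho>) powi zorder F \<rho>) = 1"
    proof -
      have "(s - \<rho>) powi (- zorder F \<rho>) * (s - \<rho>) powi zorder F \<rho> = 1" if "\<rho> \<in> X" for \<rho>
        using s(2) that by (cases "s = \<rho>") (auto simp: power_int_minus)
      thus ?thesis by (simp add: p_def flip: prod.distrib)
    qed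
    ultimately show ?thesis by (simp add: f_def mult.assoc)
  qed
  show ?thesis
    by (rule that[of H]) (use 1 3 4 off_divisor_analytic[OF F] off_divisor_zorder[OF F] in auto)
qed

lemma logderiv_factor:
  assumes F: "F nicely_meromorphic_on UNIV" "\<exists>z. F z \<noteq> 0" and s: "s \<notin> divisor_support F"
    and eq: "\<And>s. s \<notin> divisor_support F \<Longrightarrow> F s = H s * (\<Prod>\<rho>\<in>X. (s - \<rho>) powi zorder F \<rho>)"
    and H: "H analytic_on {s}"
  shows "deriv F s / F s = deriv H s / H s + (\<Sum>\<rho>\<in>X. of_int (zorder F \<rho>) / (s - \<rho>))"
proof -
  have Hs: "H s \<noteq> 0" using eq[OF s] off_divisor_nonzero[OF F s] by auto
  have Hd: "(H has_field_derivative H s * (deriv H s / H s)) (at s)"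
    using analytic_derivI[OF H] Hs by simp
  have P: "((\<lambda>w. (w - \<rho>) powi zorder F \<rho>) has_field_derivative (s - \<rho>) powi zorder F \<rho> *
      (of_int (zorder F \<rho>) / (s - \<rho>))) (at s)" for \<rho>
  proof (cases "s = \<rho>")
    case True
    thus ?thesis using off_divisor_zorder[OF F s] by simp
  next
    case False
    have "((\<lambda>w. w - \<rho>) has_field_derivative (s - \<rho>) * (1 / (s - \<rho>))) (at s)"
      using False by (auto intro!: derivative_eq_intros)
    from logderiv_powi[OF this] False show ?thesis by simp
  qed
  have "((\<lambda>w. H w * (\<Prod>\<rho>\<in>X. (w - \<rho>) powi zorder F \<rho>)) has_field_derivative
      H s * (\<Prod>\<rho>\<in>X. (s - \<rho>) powi zorder F \<rho>) *
          (deriv H s / H s + (\<Sum>\<rho>\<in>X. of_int (zorder F \<rho>) / (s - \<rho>)))) (at s)"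
    by (intro logderiv_mult logderiv_prod Hd P)
  hence "(F has_field_derivative F s * (deriv H s / H s + (\<Sum>\<rho>\<in>X. of_int (zorder F \<rho>) / (s - \<rho>))))
      (at s)"
    unfolding eq[OF s, symmetric]
    by (rule has_field_derivative_transform_within_open[where S = "- divisor_support F"])
       (use s divisor_closed[OF F(1)] eq in auto)
  thus ?thesis using off_divisor_nonzero[OF F s] by (simp add: DERIV_imp_deriv)
qed

section \<open>Growth of logarithmic derivatives in finite order\<close>

text \<open>
Discs around an arbitrary centre, and integral exponents, cost only a constant factor in the
exponent.
\<close>

lemma finite_order_growth:
  assumes "entire_finite_order g"
  obtains C K where "C \<ge> 0" "\<And>R z. R \<ge> 1 \<Longrightarrow> dist c z \<le> 4 * R \<Longrightarrow> norm (g z) \<le> exp (C * R ^ K)"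
proof -
  from assms obtain \<alpha> :: real where hol: "g holomorphic_on UNIV" and
    ev: "\<forall>\<^sub>F z in at_infinity. norm (g z) \<le> exp (norm z powr \<alpha>)"
    by (auto simp: entire_finite_order_def)
  from ev obtain B0 where B0: "\<And>z. norm z \<ge> B0 \<Longrightarrow> norm (g z) \<le> exp (norm z powr \<alpha>)"
    by (auto simp: eventually_at_infinity)
  define B where "B = max B0 1"
  have "compact (g ` cball 0 B)"
    by (intro compact_continuous_image holomorphic_on_imp_continuous_on
        holomorphic_on_subset[OF hol]) auto
  then obtain M0 where "\<forall>x\<in>g ` cball 0 B. norm x \<le> M0"
    using compact_imp_bounded bounded_iff by blast
  hence M0: "norm (g z) \<le> M0" if "norm z \<le> B" for z using that by auto
  define M where "M = max M0 1"
  define K where "K = nat \<lceil>\<alpha>\<rceil>"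
  \<comment> \<open>\<open>|z| \<le> 4 R + |c| \<le> b R\<close> as soon as \<open>R \<ge> 1\<close>\<close>
  define b where "b = 4 + norm c"
  define C where "C = ln M + b ^ K"
  have C: "C \<ge> 0" by (simp add: C_def M_def b_def)
  have "norm (g z) \<le> exp (C * R ^ K)" if R: "R \<ge> 1" and z: "dist c z \<le> 4 * R" for R z
  proof (cases "norm z \<le> B")
    case True
    have "norm (g z) \<le> exp (ln M)" using M0[OF True] by (simp add: M_def)
    also have "ln M \<le> C * 1" by (simp add: C_def b_def)
    also have "\<dots> \<le> C * R ^ K" using C R by (intro mult_left_mono) auto
    finally show ?thesis by simp
  next
    case False
    have "norm z \<le> dist c z + norm c" using norm_triangle_sub[of z c]
        by (simp add: dist_norm norm_minus_commute)
    also have "\<dots> \<le> 4 * R + norm c * R" using z R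
        by (intro add_mono) (auto simp: mult_le_cancel_left1)
    finally have zb: "norm z \<le> b * R" by (simp add: b_def algebra_simps)
    have "norm z \<ge> 1" "norm z \<ge> B0" using False by (auto simp: B_def)
    have "norm (g z) \<le> exp (norm z powr \<alpha>)" by (rule B0) fact
    also have "norm z powr \<alpha> \<le> norm z powr (real K)"
      using \<open>norm z \<ge> 1\<close> by (intro powr_mono) (auto simp: K_def real_nat_ceiling_ge)
    also have "\<dots> = norm z ^ K" using \<open>norm z \<ge> 1\<close> by (subst powr_realpow) auto
    also have "\<dots> \<le> (b * R) ^ K" by (intro power_mono zb) auto
    also have "\<dots> = b ^ K * R ^ K" by (simp add: power_mult_distrib)
    also have "\<dots> \<le> C * R ^ K" using R by (intro mult_right_mono) (auto simp: C_def M_def)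
    finally show ?thesis by simp
  qed
  with C show ?thesis using that by blast
qed

lemma entire_nicely_meromorphic:
  assumes "g holomorphic_on UNIV"
  shows "g nicely_meromorphic_on UNIV" "g analytic_on {z}"
  using assms by (auto intro!: analytic_on_imp_nicely_meromorphic_on exI[of _ UNIV] simp:
      analytic_on_holomorphic)

lemma entire_divisor_zero:
  assumes "g holomorphic_on UNIV" "\<rho> \<in> divisor_support g"
  shows "g \<rho> = 0" "zorder g \<rho> > 0"
proof -
  have "\<not> is_pole g \<rho>"
    using assms(1) by (intro not_is_pole_holomorphic[of UNIV]) auto
  hence "isolated_zero g \<rho>" using assms(2) by (auto simp: divisor_support_def)
  thus "g \<rho> = 0" "zorder g \<rho> > 0"
    using zero_isolated_zero_analytic zorder_isolated_zero_pos
        entire_nicely_meromorphic(2)[OF assms(1)] by blast+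
qed

text \<open>
Let \<open>H\<close> be \<open>g\<close> divided by \<open>P\<close>, the product over the zeros in the disc of radius \<open>R\<close>. On the
circle of radius \<open>4 R\<close> each linear factor is at least \<open>3 \<ge> e\<close> times as large as at the centre
\<open>c\<close>, so the maximum principle gives \<open>|H| \<le> e^(A - N) |H(c)|\<close>, where \<open>N\<close> is the number of zeros
and \<open>A\<close> is a constant plus a multiple of \<open>R^K\<close>. At the centre this says \<open>N \<le> A\<close>; on the disc of
radius \<open>R\<close>, where \<open>H\<close> has no zeros, it is the hypothesis of the Borel-Caratheodory estimate.
\<close>

lemma entire_logderiv_bound:
  assumes fo: "entire_finite_order g" and gc: "g c \<noteq> 0"
  obtains C K where "C \<ge> 0"
    "\<And>R. R \<ge> 1 \<Longrightarrow> (\<Sum>\<rho>\<in>divisor_support g \<inter> ball c R. real_of_int (zorder g \<rho>)) \<le> C * R ^ K"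
    "\<And>R z. R \<ge> 1 \<Longrightarrow> z \<notin> divisor_support g \<Longrightarrow> dist c z \<le> R / 2 \<Longrightarrow>
       norm (deriv g z / g z - (\<Sum>\<rho>\<in>divisor_support g \<inter> ball c R. of_int (zorder g \<rho>) / (z - \<rho>))) \<le>
           C * R ^ K"
proof -
  have hol: "g holomorphic_on UNIV" using fo by (simp add: entire_finite_order_def)
  note nm = entire_nicely_meromorphic(1)[OF hol]
  have ex: "\<exists>z. g z \<noteq> 0" using gc by blast
  obtain C0 K where C0: "C0 \<ge> 0" and
    M: "\<And>R z. R \<ge> 1 \<Longrightarrow> dist c z \<le> 4 * R \<Longrightarrow> norm (g z) \<le> exp (C0 * R ^ K)"
    using finite_order_growth[OF fo, of c] by blast
  define C where "C = 24 * (C0 + \<bar>ln (norm (g c))\<bar> + 1)"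
  have C: "C \<ge> 0" using C0 by (simp add: C_def)
  have cnd: "c \<notin> divisor_support g" using entire_divisor_zero[OF hol] gc by blast
  have main: "(\<Sum>\<rho>\<in>X. real_of_int (zorder g \<rho>)) \<le> C * R ^ K \<and>
      (\<forall>z. z \<notin> divisor_support g \<longrightarrow> dist c z \<le> R / 2 \<longrightarrow>
         norm (deriv g z / g z - (\<Sum>\<rho>\<in>X. of_int (zorder g \<rho>) / (z - \<rho>))) \<le> C * R ^ K)"
    if R: "R \<ge> 1" and X_def: "X = divisor_support g \<inter> ball c R" for R X
  proof -
    have finX: "finite X" unfolding X_def by (intro divisor_finite_Int_bounded nm) auto
    obtain H where H:
      "\<And>s. s \<in> X \<or> s \<notin> divisor_support g \<Longrightarrow> H analytic_on {s} \<and> H s \<noteq> 0"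
      "\<And>s. g analytic_on {s} \<Longrightarrow> H analytic_on {s}"
      "\<And>s. s \<notin> divisor_support g \<Longrightarrow> g s = H s * (\<Prod>\<rho>\<in>X. (s - \<rho>) powi zorder g \<rho>)"
      "\<And>s. g analytic_on {s} \<Longrightarrow> s \<notin> X \<Longrightarrow> g s = H s * (\<Prod>\<rho>\<in>X. (s - \<rho>) powi zorder g \<rho>)"
      using factor_divisor[OF nm ex finX] by blast
    have Ha: "H analytic_on UNIV"
      using H(2) entire_nicely_meromorphic(2)[OF hol] by (subst analytic_on_analytic_at) auto
    hence Hh: "H holomorphic_on A" for A by (meson analytic_imp_holomorphic holomorphic_on_subset
        subset_UNIV)
    have Hnz: "H z \<noteq> 0" if "z \<in> ball c R" for z using H(1)[of z] that by (auto simp: X_def)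
    define N where "N = (\<Sum>\<rho>\<in>X. real_of_int (zorder g \<rho>))"
    have npos: "zorder g \<rho> > 0" if "\<rho> \<in> X" for \<rho> using entire_divisor_zero[OF hol] that
        by (auto simp: X_def)
    have N: "N \<ge> 0" unfolding N_def by (intro sum_nonneg) (use npos in force)
    define P where "P z = (\<Prod>\<rho>\<in>X. (z - \<rho>) powi zorder g \<rho>)" for z
    have gcP: "g c = H c * P c" unfolding P_def by (rule H(3)[OF cnd])
    hence Pc: "P c \<noteq> 0" and Hc: "H c \<noteq> 0" using gc by auto
    define A where "A = C0 * R ^ K - ln (norm (g c))"
    have sphere: "norm (H z) \<le> exp (A - N) * norm (H c)" if z: "dist c z = 4 * R" for z
    proof -
      have "z \<notin> X" using z R by (auto simp: X_def)
      hence "norm (H z) * norm (P z) = norm (g z)"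
        using H(4)[OF entire_nicely_meromorphic(2)[OF hol]] by (simp add: P_def norm_mult)
      moreover have "norm (g z) \<le> exp (C0 * R ^ K)" by (rule M) (use R z in auto)
      moreover have "exp N * norm (P c) \<le> norm (P z)"
      proof -
        have "exp (real_of_int (zorder g \<rho>)) * norm (c - \<rho>) powi zorder g \<rho> \<le>
            norm (z - \<rho>) powi zorder g \<rho>"
          if "\<rho> \<in> X" for \<rho>
        proof -
          have "exp 1 * norm (c - \<rho>) \<le> 3 * R"
            using that R by (intro mult_mono exp_le) (auto simp: X_def dist_norm)
          also have "3 * R \<le> norm (z - \<rho>)"
            using dist_triangle[of c z \<rho>] that z
                by (auto simp: X_def dist_norm norm_minus_commute)
          finally have "(exp 1 * norm (c - \<rho>)) powi zorder g \<rho> \<le> norm (z - \<rho>) powi zorder g \<rho>"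
            by (intro power_int_mono) (use npos[OF that] in auto)
          thus ?thesis by (simp add: power_int_mult_distrib exp_power_int)
        qed
        hence "(\<Prod>\<rho>\<in>X. exp (real_of_int (zorder g \<rho>)) * norm (c - \<rho>) powi zorder g \<rho>) \<le>
              (\<Prod>\<rho>\<in>X. norm (z - \<rho>) powi zorder g \<rho>)"
          by (intro prod_mono) (auto intro!: mult_nonneg_nonneg)
        thus ?thesis
          using finX by (simp add: P_def N_def exp_sum prod.distrib prod_norm[symmetric]
              norm_power_int)
      qed
      ultimately have "norm (H z) * (exp N * norm (P c)) \<le> exp (C0 * R ^ K)"
        using mult_left_mono[of "exp N * norm (P c)" "norm (P z)" "norm (H z)"] by simp
      moreover have "exp (A - N) * norm (H c) = exp (C0 * R ^ K) / (exp N * norm (P c))"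
      proof -
        have "exp (A - N) = exp (C0 * R ^ K) / norm (g c) / exp N"
          using gc by (simp add: A_def exp_diff)
        also have "norm (g c) = norm (H c) * norm (P c)" by (simp add: gcP norm_mult)
        finally show ?thesis using Hc Pc by (simp add: field_simps)
      qed
      ultimately show ?thesis using Pc by (simp add: pos_le_divide_eq)
    qed
    have inside: "norm (H z) \<le> exp (A - N) * norm (H c)" if "z \<in> ball c (4 * R)" for z
      by (rule maximum_modulus_frontier[of H "ball c (4 * R)"])
         (use R sphere that in \<open>auto intro!: Hh holomorphic_on_imp_continuous_on\<close>)
    have "1 \<le> exp (A - N)" using inside[of c] R Hc by simp
    hence NA: "N \<le> A" by simp
    have RK: "R ^ K \<ge> 1" using R by simp
    have "A + 1 \<le> C0 * R ^ K + (\<bar>ln (norm (g c))\<bar> + 1) * 1" by (simp add: A_def)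
    also have "\<dots> \<le> C0 * R ^ K + (\<bar>ln (norm (g c))\<bar> + 1) * R ^ K"
      by (intro add_left_mono mult_left_mono RK) auto
    finally have A24: "24 * (A + 1) \<le> C * R ^ K" by (simp add: C_def algebra_simps)
    have "N \<le> 24 * (A + 1)" using NA N by simp
    hence "N \<le> C * R ^ K" using A24 by (rule order_trans)
    moreover have "norm (deriv g z / g z - (\<Sum>\<rho>\<in>X. of_int (zorder g \<rho>) / (z - \<rho>))) \<le> C * R ^ K"
      if z: "z \<notin> divisor_support g" "dist c z \<le> R / 2" for z
    proof -
      have "norm (deriv H z / H z) \<le> 24 * (A + 1) / R"
      proof (rule Borel_Caratheodory_logderiv[where c = c])
        show "norm (H w) \<le> exp A * norm (H c)" if "w \<in> ball c R" for w
        proof -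
          have "norm (H w) \<le> exp (A - N) * norm (H c)" by (rule inside) (use that R in auto)
          also have "\<dots> \<le> exp A * norm (H c)" using N by (intro mult_right_mono) auto
          finally show ?thesis .
        qed
      qed (use R Hnz z Hh in auto)
      also have "\<dots> \<le> 24 * (A + 1) / 1" using R NA N by (intro divide_left_mono) auto
      also have "\<dots> \<le> C * R ^ K" using A24 by simp
      also have "deriv H z / H z = deriv g z / g z - (\<Sum>\<rho>\<in>X. of_int (zorder g \<rho>) / (z - \<rho>))"
        using logderiv_factor[OF nm ex z(1) H(3)] H(1)[of z] z(1) by simp
      finally show ?thesis .
    qed
    ultimately show ?thesis by (simp add: N_def)
  qed
  show ?thesis by (rule that[OF C]) (use main in blast)+
qed

text \<open>
The divisor is discrete, so bounds and identities of continuous functions need only be checked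
off the divisor.
\<close>

lemma norm_le_off_divisor:
  assumes F: "F nicely_meromorphic_on UNIV" and "isCont f z" "open U" "z \<in> U"
    and "\<And>w. w \<in> U \<Longrightarrow> w \<notin> divisor_support F \<Longrightarrow> norm (f w) \<le> B"
  shows "norm (f z) \<le> B"
proof (rule tendsto_upperbound)
  show "((\<lambda>w. norm (f w)) \<longlongrightarrow> norm (f z)) (at z)"
    using assms(2) by (intro tendsto_norm) (simp add: isCont_def)
  have "eventually (\<lambda>w. w \<in> U) (at z)" using assms by (intro eventually_at_in_open') auto
  thus "eventually (\<lambda>w. norm (f w) \<le> B) (at z)"
    using divisor_eventually_not[OF F, of z] by eventually_elim (use assms in auto)
qed auto

text \<open>
Subtract the estimates for numerator and denominator, about a centre where neither vanishes.
Common zeros cancel in the principal parts because orders subtract.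
\<close>

lemma finite_order_logderiv_bound:
  assumes F: "F nicely_meromorphic_on UNIV" "\<exists>z. F z \<noteq> 0" and fo: "meromorphic_finite_order F"
  obtains c C K where "C \<ge> 0" "c \<notin> divisor_support F"
    "\<And>R. R \<ge> 1 \<Longrightarrow> (\<Sum>\<rho>\<in>divisor_support F \<inter> ball c R. real_of_int \<bar>zorder F \<rho>\<bar>) \<le> C * R ^ K"
    "\<And>R z. R \<ge> 1 \<Longrightarrow> z \<notin> divisor_support F \<Longrightarrow> dist c z < R / 2 \<Longrightarrow>
       norm (deriv F z / F z - (\<Sum>\<rho>\<in>divisor_support F \<inter> ball c R. of_int (zorder F \<rho>) / (z - \<rho>))) \<le>
           C * R ^ K"
proof -
  from fo obtain g h where g: "entire_finite_order g" and h: "entire_finite_order h"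
    and exh: "\<exists>z. h z \<noteq> 0" and eq: "\<And>z. h z \<noteq> 0 \<Longrightarrow> F z = g z / h z"
    by (auto simp: meromorphic_finite_order_def)
  have hol: "g holomorphic_on UNIV" "h holomorphic_on UNIV" using g h
      by (auto simp: entire_finite_order_def)
  note nm = entire_nicely_meromorphic(1)[OF hol(1)] entire_nicely_meromorphic(1)[OF hol(2)]
  note hnz = nonconst_eventually_nonzero[OF nm(2) exh]
  have "eventually (\<lambda>z. F z \<noteq> 0 \<and> h z \<noteq> 0) (at 0)"
    using nonconst_eventually_nonzero[OF F] hnz by (intro eventually_conj) auto
  then obtain c0 where c0: "F c0 \<noteq> 0" "h c0 \<noteq> 0" using eventually_happens'[OF at_neq_bot] by blast
  have exg: "\<exists>z. g z \<noteq> 0" using eq[OF c0(2)] c0 by auto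
  note gnz = nonconst_eventually_nonzero[OF nm(1) exg]
  have "eventually (\<lambda>z. g z \<noteq> 0 \<and> h z \<noteq> 0 \<and> z \<notin> divisor_support F) (at 0)"
    using gnz hnz divisor_eventually_not[OF F(1)] by (intro eventually_conj) auto
  then obtain c where c: "g c \<noteq> 0" "h c \<noteq> 0" "c \<notin> divisor_support F"
    using eventually_happens'[OF at_neq_bot] by blast
  have zo: "zorder F z = zorder g z - zorder h z" for z
  proof -
    have "zorder F z = zorder (\<lambda>z. g z / h z) z"
      by (intro zorder_cong refl eventually_mono[OF hnz]) (use eq in auto)
    also have "\<dots> = zorder g z - zorder h z"
      by (intro zorder_divide nicely_mero_at nm eventually_frequently gnz hnz) auto
    finally show ?thesis .
  qed
  obtain C1 K1 where 1: "C1 \<ge> 0"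
    "\<And>R. R \<ge> 1 \<Longrightarrow> (\<Sum>\<rho>\<in>divisor_support g \<inter> ball c R. real_of_int (zorder g \<rho>)) \<le> C1 * R ^ K1"
    "\<And>R z. R \<ge> 1 \<Longrightarrow> z \<notin> divisor_support g \<Longrightarrow> dist c z \<le> R / 2 \<Longrightarrow>
       norm (deriv g z / g z - (\<Sum>\<rho>\<in>divisor_support g \<inter> ball c R. of_int (zorder g \<rho>) / (z - \<rho>))) \<le>
           C1 * R ^ K1"
    using entire_logderiv_bound[OF g c(1)] by blast
  obtain C2 K2 where 2: "C2 \<ge> 0"
    "\<And>R. R \<ge> 1 \<Longrightarrow> (\<Sum>\<rho>\<in>divisor_support h \<inter> ball c R. real_of_int (zorder h \<rho>)) \<le> C2 * R ^ K2"
    "\<And>R z. R \<ge> 1 \<Longrightarrow> z \<notin> divisor_support h \<Longrightarrow> dist c z \<le> R / 2 \<Longrightarrow>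
       norm (deriv h z / h z - (\<Sum>\<rho>\<in>divisor_support h \<inter> ball c R. of_int (zorder h \<rho>) / (z - \<rho>))) \<le>
           C2 * R ^ K2"
    using entire_logderiv_bound[OF h c(2)] by blast
  define C where "C = C1 + C2"
  define K where "K = max K1 K2"
  have CK: "C1 * R ^ K1 + C2 * R ^ K2 \<le> C * R ^ K" if "R \<ge> 1" for R
    unfolding C_def K_def distrib_right using 1(1) 2(1) that
    by (intro add_mono mult_left_mono power_increasing) auto
  define Z where "Z R = (divisor_support g \<union> divisor_support h) \<inter> ball c R" for R
  have finZ: "finite (Z R)" for R
    unfolding Z_def Int_Un_distrib2 by (intro finite_UnI divisor_finite_Int_bounded nm) auto
  have z0: "zorder g \<rho> = 0" if "\<rho> \<notin> divisor_support g" for \<rho>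
      using off_divisor_zorder[OF nm(1) exg that] .
  have z0': "zorder h \<rho> = 0" if "\<rho> \<notin> divisor_support h" for \<rho>
      using off_divisor_zorder[OF nm(2) exh that] .
  have z0'': "zorder F \<rho> = 0" if "\<rho> \<notin> divisor_support F" for \<rho>
      using off_divisor_zorder[OF F that] .
  have DZ: "divisor_support F \<inter> ball c R \<subseteq> Z R" for R
  proof
    fix \<rho> assume "\<rho> \<in> divisor_support F \<inter> ball c R"
    thus "\<rho> \<in> Z R" using zo[of \<rho>] z0[of \<rho>] z0'[of \<rho>] on_divisor_zorder[OF F, of \<rho>]
      by (cases "\<rho> \<in> divisor_support g"; cases "\<rho> \<in> divisor_support h") (auto simp: Z_def)
  qed
  have sg: "(\<Sum>\<rho>\<in>divisor_support g \<inter> ball c R. f (zorder g \<rho>) \<rho>) = (\<Sum>\<rho>\<in>Z R. f (zorder g \<rho>) \<rho>)"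
    if "\<And>\<rho>. f 0 \<rho> = 0" for f :: "int \<Rightarrow> complex \<Rightarrow> 'b::comm_monoid_add" and R
    by (rule sum.mono_neutral_left[OF finZ]) (use z0 that in \<open>fastforce simp: Z_def\<close>)+
  have sh: "(\<Sum>\<rho>\<in>divisor_support h \<inter> ball c R. f (zorder h \<rho>) \<rho>) = (\<Sum>\<rho>\<in>Z R. f (zorder h \<rho>) \<rho>)"
    if "\<And>\<rho>. f 0 \<rho> = 0" for f :: "int \<Rightarrow> complex \<Rightarrow> 'b::comm_monoid_add" and R
    by (rule sum.mono_neutral_left[OF finZ]) (use z0' that in \<open>fastforce simp: Z_def\<close>)+
  have sF: "(\<Sum>\<rho>\<in>divisor_support F \<inter> ball c R. f (zorder F \<rho>) \<rho>) = (\<Sum>\<rho>\<in>Z R. f (zorder F \<rho>) \<rho>)"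
    if "\<And>\<rho>. f 0 \<rho> = 0" for f :: "int \<Rightarrow> complex \<Rightarrow> 'b::comm_monoid_add" and R
    by (rule sum.mono_neutral_left[OF finZ DZ]) (use z0'' that in \<open>fastforce simp: Z_def\<close>)
  have np: "zorder g \<rho> \<ge> 0" "zorder h \<rho> \<ge> 0" for \<rho>
    using z0[of \<rho>] entire_divisor_zero(2)[OF hol(1), of \<rho>] z0'[of \<rho>]
        entire_divisor_zero(2)[OF hol(2), of \<rho>]
    by linarith+
  show ?thesis
  proof (rule that[of C c K])
    show "C \<ge> 0" using 1 2 by (simp add: C_def)
    show "c \<notin> divisor_support F" by (rule c)
    fix R :: real assume R: "R \<ge> 1"
    have "(\<Sum>\<rho>\<in>divisor_support F \<inter> ball c R. real_of_int \<bar>zorder F \<rho>\<bar>) =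
          (\<Sum>\<rho>\<in>Z R. real_of_int \<bar>zorder F \<rho>\<bar>)"
      by (rule sF[of "\<lambda>n _. real_of_int \<bar>n\<bar>"]) simp
    also have "\<dots> \<le> (\<Sum>\<rho>\<in>Z R. real_of_int (zorder g \<rho>) + real_of_int (zorder h \<rho>))"
    proof (rule sum_mono)
      fix \<rho>
      have "\<bar>zorder F \<rho>\<bar> \<le> zorder g \<rho> + zorder h \<rho>" using np[of \<rho>] unfolding zo by linarith
      thus "real_of_int \<bar>zorder F \<rho>\<bar> \<le> real_of_int (zorder g \<rho>) + real_of_int (zorder h \<rho>)"
        unfolding of_int_add[symmetric] of_int_le_iff .
    qed
    also have "\<dots> = (\<Sum>\<rho>\<in>divisor_support g \<inter> ball c R. real_of_int (zorder g \<rho>)) +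
        (\<Sum>\<rho>\<in>divisor_support h \<inter> ball c R. real_of_int (zorder h \<rho>))"
      using sg[of "\<lambda>n _. real_of_int n" R] sh[of "\<lambda>n _. real_of_int n" R]
          by (simp add: sum.distrib)
    also have "\<dots> \<le> C * R ^ K" using 1(2)[OF R] 2(2)[OF R] CK[OF R] by linarith
    finally show "(\<Sum>\<rho>\<in>divisor_support F \<inter> ball c R. real_of_int \<bar>zorder F \<rho>\<bar>) \<le> C * R ^ K" .
    fix z assume z: "z \<notin> divisor_support F" "dist c z < R / 2"
    define S where "S w = (\<Sum>\<rho>\<in>divisor_support F \<inter> ball c R. of_int (zorder F \<rho>) / (w - \<rho>))" for w
    have Fa: "F analytic_on {z}" "F z \<noteq> 0" using off_divisor_analytic[OF F z(1)]
        off_divisor_nonzero[OF F z(1)] by auto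
    show "norm (deriv F z / F z - (\<Sum>\<rho>\<in>divisor_support F \<inter> ball c R. of_int (zorder F \<rho>) /
        (z - \<rho>))) \<le> C * R ^ K"
      unfolding S_def[symmetric]
    proof (rule tendsto_upperbound)
      have "isCont (\<lambda>w. deriv F w / F w - S w) z"
      proof -
        have "(\<lambda>w. deriv F w / F w - S w) analytic_on {z}"
          unfolding S_def by (intro analytic_intros analytic_deriv Fa) (use z Fa in auto)
        thus ?thesis by (rule analytic_at_imp_isCont)
      qed
      thus "((\<lambda>w. norm (deriv F w / F w - S w)) \<longlongrightarrow> norm (deriv F z / F z - S z)) (at z)"
        by (intro tendsto_norm) (simp add: isCont_def)
      have "eventually (\<lambda>w. w \<in> ball c (R / 2)) (at z)"
        using z by (intro eventually_at_in_open') auto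
      thus "eventually (\<lambda>w. norm (deriv F w / F w - S w) \<le> C * R ^ K) (at z)"
        using gnz hnz divisor_eventually_not[OF nm(1)] divisor_eventually_not[OF nm(2)]
      proof eventually_elim
        case (elim w)
        have "open {w. h w \<noteq> 0}"
          using open_vimage[of "- {0}" h] holomorphic_on_imp_continuous_on[OF hol(2)]
          by (auto simp: vimage_def)
        have gd: "(g has_field_derivative deriv g w) (at w)"
            "(h has_field_derivative deriv h w) (at w)"
          using holomorphic_derivI[OF hol(1)] holomorphic_derivI[OF hol(2)] by auto
        have "((\<lambda>w. g w / h w) has_field_derivative (deriv g w * h w - g w * deriv h w) /
            (h w * h w)) (at w)"
          by (intro DERIV_divide gd) fact
        hence "(F has_field_derivative (deriv g w * h w - g w * deriv h w) / (h w * h w)) (at w)"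
          by (rule has_field_derivative_transform_within_open[OF _ \<open>open {w. h w \<noteq> 0}\<close>])
             (use elim eq in auto)
        hence ld: "deriv F w / F w = deriv g w / g w - deriv h w / h w"
          using elim eq[of w] by (simp add: DERIV_imp_deriv field_simps)
        have S: "S w = (\<Sum>\<rho>\<in>divisor_support g \<inter> ball c R. of_int (zorder g \<rho>) / (w - \<rho>)) -
                   (\<Sum>\<rho>\<in>divisor_support h \<inter> ball c R. of_int (zorder h \<rho>) / (w - \<rho>))"
          using sg[of "\<lambda>n \<rho>. of_int n / (w - \<rho>)" R] sh[of "\<lambda>n \<rho>. of_int n / (w - \<rho>)" R]
            sF[of "\<lambda>n \<rho>. of_int n / (w - \<rho>)" R]
          by (simp add: S_def zo sum_subtractf diff_divide_distrib)
        have d: "dist c w \<le> R / 2" using elim by simp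
        have "norm (deriv F w / F w - S w) \<le>
           norm (deriv g w / g w - (\<Sum>\<rho>\<in>divisor_support g \<inter> ball c R. of_int (zorder g \<rho>) /
               (w - \<rho>))) +
           norm (deriv h w / h w - (\<Sum>\<rho>\<in>divisor_support h \<inter> ball c R. of_int (zorder h \<rho>) /
               (w - \<rho>)))"
          unfolding ld S by (rule order_trans[OF _ norm_triangle_ineq4]) (simp add: algebra_simps)
        also have "\<dots> \<le> C1 * R ^ K1 + C2 * R ^ K2"
          using elim by (intro add_mono 1 2 R d) auto
        finally show ?case using CK[OF R] by linarith
      qed
    qed auto
  qed
qed

text \<open>
Group the points by the integer part of their distance to \<open>c\<close>: the shell of radius \<open>i\<close>
contributes at most \<open>C i^K / i^(K + 2)\<close>.
\<close>

lemma polynomial_count_summable: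
  fixes n :: "complex \<Rightarrow> real"
  assumes fin: "\<And>R. finite (D \<inter> ball c R)" and nn: "\<And>\<rho>. n \<rho> \<ge> 0"
    and cnt: "\<And>R. R \<ge> 1 \<Longrightarrow> (\<Sum>\<rho>\<in>D \<inter> ball c R. n \<rho>) \<le> C * R ^ K"
  shows "(\<lambda>\<rho>. n \<rho> / (1 + dist c \<rho>) ^ (K + 2)) summable_on D"
proof (rule nonneg_bdd_above_summable_on)
  \<comment> \<open>the smallest natural radius whose open disc contains \<open>\<rho>\<close>\<close>
  define j where "j \<rho> = nat \<lfloor>dist c \<rho>\<rfloor> + 1" for \<rho>
  have j: "dist c \<rho> < real (j \<rho>)" "real (j \<rho>) \<le> 1 + dist c \<rho>" for \<rho>
    unfolding j_def by (simp_all add: of_nat_nat) linarith+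
  have C: "C \<ge> 0" using order_trans[OF sum_nonneg cnt[of 1]] nn by simp
  have sm: "summable (\<lambda>i. C / real i ^ 2)"
    using summable_mult[OF inverse_power_summable[of 2, where 'a = real], of C]
        by (simp add: field_simps)
  have "(\<Sum>\<rho>\<in>X. n \<rho> / (1 + dist c \<rho>) ^ (K + 2)) \<le> (\<Sum>i. C / real i ^ 2)" if X: "X \<subseteq> D" "finite X"
      for X
  proof -
    have "(\<Sum>\<rho>\<in>X. n \<rho> / (1 + dist c \<rho>) ^ (K + 2)) \<le> (\<Sum>\<rho>\<in>X. n \<rho> / real (j \<rho>) ^ (K + 2))"
      by (intro sum_mono divide_left_mono power_mono j)
          (auto simp: nn j_def intro!: mult_pos_pos zero_less_power add_pos_nonneg)
    also have "\<dots> = (\<Sum>i\<in>j ` X. \<Sum>\<rho>\<in>{\<rho>\<in>X. j \<rho> = i}. n \<rho> / real (j \<rho>) ^ (K + 2))"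
      by (rule sum.image_gen) fact
    also have "\<dots> \<le> (\<Sum>i\<in>j ` X. C / real i ^ 2)"
    proof (rule sum_mono)
      fix i assume "i \<in> j ` X"
      hence i: "i \<ge> 1" by (auto simp: j_def)
      have "(\<Sum>\<rho>\<in>{\<rho>\<in>X. j \<rho> = i}. n \<rho> / real (j \<rho>) ^ (K + 2)) =
          (\<Sum>\<rho>\<in>{\<rho>\<in>X. j \<rho> = i}. n \<rho>) / real i ^ (K + 2)"
        by (simp add: sum_divide_distrib)
      also have "(\<Sum>\<rho>\<in>{\<rho>\<in>X. j \<rho> = i}. n \<rho>) \<le> (\<Sum>\<rho>\<in>D \<inter> ball c i. n \<rho>)"
        by (rule sum_mono2) (use X j fin nn in \<open>auto simp del: of_nat_Suc\<close>)
      also have "\<dots> \<le> C * real i ^ K" by (rule cnt) (use i in simp)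
      also have "C * real i ^ K / real i ^ (K + 2) = C / real i ^ 2"
        using i by (simp add: power_add power2_eq_square field_simps)
      finally show "(\<Sum>\<rho>\<in>{\<rho>\<in>X. j \<rho> = i}. n \<rho> / real (j \<rho>) ^ (K + 2)) \<le> C / real i ^ 2"
        using i by (simp add: divide_right_mono)
    qed
    also have "\<dots> \<le> (\<Sum>i. C / real i ^ 2)"
      by (rule sum_le_suminf[OF sm]) (use X C in auto)
    finally show ?thesis .
  qed
  thus "bdd_above (sum (\<lambda>\<rho>. n \<rho> / (1 + dist c \<rho>) ^ (K + 2)) ` {F. F \<subseteq> D \<and> finite F})"
    by (intro bdd_aboveI2) auto
qed (auto simp: nn)

section \<open>Mittag-Leffler kernels and their recentring\<close>

text \<open>
For \<open>\<rho> \<noteq> c\<close>, the simple fraction \<open>1 / (s - \<rho>)\<close> minus its Taylor polynomial of degree below \<open>m\<close>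
at \<open>s = c\<close>, that is, a term of the Mittag-Leffler series centred at \<open>c\<close>. The point \<open>c\<close> itself
contributes the plain fraction.
\<close>

definition kern :: "complex \<Rightarrow> nat \<Rightarrow> complex \<Rightarrow> complex \<Rightarrow> complex" where
  "kern c m \<rho> s = (if \<rho> = c then 1 / (s - c) else ((s - c) / (\<rho> - c)) ^ m / (s - \<rho>))"

text \<open>
For \<open>m = d - 1\<close>, this is \<open>G\<close> when \<open>c = \<sigma>1\<close>, and the logarithmic derivative of the Hadamard
product without its exponential factor when \<open>c = 0\<close>.
\<close>

definition kern_sum :: "(complex \<Rightarrow> complex) \<Rightarrow> complex \<Rightarrow> nat \<Rightarrow> complex \<Rightarrow> complex" where
  "kern_sum F c m s = (\<Sum>\<^sub>\<infinity>\<rho>\<in>divisor_support F. of_int (zorder F \<rho>) * kern c m \<rho> s)"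

lemma kern_norm_le:
  assumes "\<rho> \<noteq> c" "2 * dist c s \<le> dist c \<rho>"
  shows "norm (kern c m \<rho> s) \<le> 2 * dist c s ^ m / dist c \<rho> ^ Suc m"
proof -
  have "dist c \<rho> \<le> 2 * norm (s - \<rho>)"
    using dist_triangle[of c \<rho> s] assms(2) by (simp add: dist_norm)
  moreover have "dist c \<rho> > 0" using assms by simp
  ultimately have "1 / norm (s - \<rho>) \<le> 2 / dist c \<rho>"
    by (simp add: divide_simps mult.commute)
  hence "(dist c s / dist c \<rho>) ^ m * (1 / norm (s - \<rho>)) \<le>
      (dist c s / dist c \<rho>) ^ m * (2 / dist c \<rho>)"
    by (intro mult_left_mono) auto
  thus ?thesis using assms
    by (simp add: kern_def norm_divide norm_power norm_mult dist_norm norm_minus_commute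
        power_divide mult_ac)
qed

lemma has_sum_minus:
  fixes f g :: "'a \<Rightarrow> complex"
  assumes "(f has_sum a) A" "(g has_sum b) A"
  shows "((\<lambda>x. f x - g x) has_sum (a - b)) A"
  using has_sum_add[OF assms(1) has_sum_cmult_right[OF assms(2), of "-1"]] by simp

lemma has_sum_sum_finite:
  fixes f :: "'i \<Rightarrow> 'a \<Rightarrow> complex"
  assumes "\<And>i. i \<in> J \<Longrightarrow> (f i has_sum a i) A"
  shows "((\<lambda>x. \<Sum>i\<in>J. f i x) has_sum (\<Sum>i\<in>J. a i)) A"
  using assms by (induction J rule: infinite_finite_induct) (auto intro: has_sum_add has_sum_0)

text \<open>
Stated by coefficients, so that the zero polynomial is included also for \<open>m = 0\<close>.
\<close>

definition deg_below :: "nat \<Rightarrow> complex poly \<Rightarrow> bool" where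
  "deg_below m P \<longleftrightarrow> (\<forall>i\<ge>m. coeff P i = 0)"

lemma deg_below_0 [simp]: "deg_below m 0" by (simp add: deg_below_def)
lemma deg_below_add: "deg_below m P \<Longrightarrow> deg_below m Q \<Longrightarrow> deg_below m (P + Q)"
    by (simp add: deg_below_def)
lemma deg_below_diff: "deg_below m P \<Longrightarrow> deg_below m Q \<Longrightarrow> deg_below m (P - Q)"
    by (simp add: deg_below_def)
lemma deg_below_smult: "deg_below m P \<Longrightarrow> deg_below m (smult a P)" by (simp add: deg_below_def)
lemma deg_below_sum: "(\<And>x. x \<in> X \<Longrightarrow> deg_below m (P x)) \<Longrightarrow> deg_below m (\<Sum>x\<in>X. P x)"
  by (induction X rule: infinite_finite_induct) (auto intro: deg_below_add)
lemma deg_below_degree: "degree P < m \<Longrightarrow> deg_below m P" by (auto simp: deg_below_def coeff_eq_0)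
lemma deg_below_mono: "deg_below m P \<Longrightarrow> m \<le> m' \<Longrightarrow> deg_below m' P" by (auto simp: deg_below_def)

lemma poly_deg_below: "deg_below m P \<Longrightarrow> poly P s = (\<Sum>k<m. coeff P k * s ^ k)"
proof -
  assume deg_below: "deg_below m P"
  have "poly P s = (\<Sum>k\<le>max (degree P) m. coeff P k * s ^ k)"
    unfolding poly_altdef by (rule sum.mono_neutral_left) (auto simp: coeff_eq_0)
  also have "\<dots> = (\<Sum>k<m. coeff P k * s ^ k)"
    by (rule sum.mono_neutral_right) (use deg_below in \<open>auto simp: deg_below_def\<close>)
  finally show ?thesis .
qed

text \<open>
With \<open>a = (s - c) / (\<rho> - c)\<close> one has \<open>a - 1 = (s - \<rho>) / (\<rho> - c)\<close>, so \<open>a^m - 1\<close> is divisible by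
\<open>s - \<rho>\<close>.
\<close>

lemma kern_eq:
  assumes "\<rho> \<noteq> c" "s \<noteq> \<rho>"
  shows "kern c m \<rho> s = 1 / (s - \<rho>) + (1 / (\<rho> - c)) * (\<Sum>i<m. ((s - c) / (\<rho> - c)) ^ i)"
proof -
  define a where "a = (s - c) / (\<rho> - c)"
  have a1: "a - 1 = (s - \<rho>) / (\<rho> - c)" using assms by (simp add: a_def field_simps)
  have "kern c m \<rho> s = (1 + (a ^ m - 1)) / (s - \<rho>)" using assms by (simp add: kern_def a_def)
  also have "\<dots> = 1 / (s - \<rho>) + (a ^ m - 1) / (s - \<rho>)" by (rule add_divide_distrib)
  also have "a ^ m - 1 = (a - 1) * (\<Sum>i<m. a ^ i)" by (rule power_diff_1_eq)
  also have "\<dots> / (s - \<rho>) = (1 / (\<rho> - c)) * (\<Sum>i<m. a ^ i)"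
    unfolding a1 using assms by simp
  finally show ?thesis unfolding a_def .
qed

lemma kern_minus_simple_fraction:
  "\<exists>P. deg_below m P \<and> (\<forall>s. s \<noteq> \<rho> \<longrightarrow> kern c m \<rho> s - 1 / (s - \<rho>) = poly P s)"
proof (cases "\<rho> = c")
  case True
  thus ?thesis by (intro exI[of _ 0]) (simp add: kern_def)
next
  case False
  define P where "P = smult (1 / (\<rho> - c)) (\<Sum>i<m. (smult (1 / (\<rho> - c)) [:- c, 1:]) ^ i)"
  have "deg_below m ((smult (1 / (\<rho> - c)) [:- c, 1:]) ^ i)" if "i < m" for i
  proof (rule deg_below_degree)
    have "degree ((smult (1 / (\<rho> - c)) [:- c, 1:]) ^ i) \<le>
        degree (smult (1 / (\<rho> - c)) [:- c, 1:]) * i"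
      by (rule degree_power_le)
    also have "\<dots> < m" using that False by simp
    finally show "degree ((smult (1 / (\<rho> - c)) [:- c, 1:]) ^ i) < m" .
  qed
  hence "deg_below m P" unfolding P_def by (intro deg_below_smult deg_below_sum) auto
  moreover have "kern c m \<rho> s - 1 / (s - \<rho>) = poly P s" if "s \<noteq> \<rho>" for s
  proof -
    have e: "poly (smult (1 / (\<rho> - c)) [:- c, 1:]) s = (s - c) / (\<rho> - c)"
      by (simp add: diff_divide_distrib)
    have "poly P s = (1 / (\<rho> - c)) * (\<Sum>i<m. ((s - c) / (\<rho> - c)) ^ i)"
      unfolding P_def poly_smult poly_sum poly_power e[unfolded poly_smult] ..
    thus ?thesis using kern_eq[OF False that] by simp
  qed
  ultimately show ?thesis by blast
qed

text \<open>
Outside a large disc the distances to the two centres differ by at most a factor \<open>2\<close>.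
\<close>

lemma recentre_summable:
  fixes n :: "complex \<Rightarrow> real"
  assumes fin: "\<And>B. bounded B \<Longrightarrow> finite (D \<inter> B)" and nn: "\<And>\<rho>. n \<rho> \<ge> 0"
    and sm: "(\<lambda>\<rho>. n \<rho> / dist c \<rho> ^ d) summable_on D - {c}"
  shows "(\<lambda>\<rho>. n \<rho> / dist c' \<rho> ^ d) summable_on D - {c'}"
proof -
  \<comment> \<open>beyond this radius \<open>dist c \<rho> \<le> 2 dist c' \<rho>\<close>\<close>
  define R where "R = dist c c' + 1"
  define B where "B = insert c (ball c' R)"
  have fB: "finite (D \<inter> B)" by (intro fin) (simp add: B_def)
  have "(\<lambda>\<rho>. n \<rho> / dist c' \<rho> ^ d) summable_on D - B"
  proof (rule summable_on_comparison_test)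
    show "(\<lambda>\<rho>. 2 ^ d * (n \<rho> / dist c \<rho> ^ d)) summable_on D - B"
      by (intro summable_on_cmult_right summable_on_subset_banach[OF sm]) (auto simp: B_def)
    fix \<rho> assume "\<rho> \<in> D - B"
    hence \<rho>: "\<rho> \<noteq> c" "dist c' \<rho> \<ge> R" by (auto simp: B_def)
    have "dist c \<rho> \<le> 2 * dist c' \<rho>" using dist_triangle[of c \<rho> c'] \<rho> by (simp add: R_def)
    hence "dist c \<rho> ^ d \<le> (2 * dist c' \<rho>) ^ d" by (intro power_mono) auto
    moreover have "dist c \<rho> > 0" using \<rho> by simp
    moreover have "dist c' \<rho> > 0" using \<rho> unfolding R_def
        by (meson add_nonneg_pos le_less_trans less_le_trans zero_le_dist zero_less_one)
    ultimately have "1 / dist c' \<rho> ^ d \<le> 2 ^ d / dist c \<rho> ^ d"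
      by (simp add: power_mult_distrib divide_simps mult.commute)
    from mult_left_mono[OF this nn[of \<rho>]]
    show "n \<rho> / dist c' \<rho> ^ d \<le> 2 ^ d * (n \<rho> / dist c \<rho> ^ d)" by (simp add: mult_ac)
  qed (simp add: nn)
  hence "(\<lambda>\<rho>. n \<rho> / dist c' \<rho> ^ d) summable_on (D - B) \<union> (D \<inter> B)"
    by (rule summable_on_union[OF _ summable_on_finite[OF fB]])
  thus ?thesis by (rule summable_on_subset_banach) auto
qed

locale divisor =
  fixes F :: "complex \<Rightarrow> complex"
  assumes mero: "F nicely_meromorphic_on UNIV" and ex: "\<exists>z. F z \<noteq> 0"
begin

abbreviation "D \<equiv> divisor_support F"
abbreviation "n \<rho> \<equiv> zorder F \<rho>"

lemma bounded_fin: "bounded B \<Longrightarrow> finite (D \<inter> B)" by (rule divisor_finite_Int_bounded[OF mero])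

definition weight_summable :: "complex \<Rightarrow> nat \<Rightarrow> bool" where
  "weight_summable c d \<longleftrightarrow> (\<lambda>\<rho>. real_of_int \<bar>n \<rho>\<bar> / dist c \<rho> ^ d) summable_on D - {c}"

lemma weight_summable_recentre: "weight_summable c d \<Longrightarrow> weight_summable c' d"
  unfolding weight_summable_def by (rule recentre_summable[OF bounded_fin]) auto

lemma kern_abs_summable_far:
  assumes w: "weight_summable c (Suc m)"
  shows "(\<lambda>\<rho>. 2 * r ^ m * (real_of_int \<bar>n \<rho>\<bar> / dist c \<rho> ^ Suc m)) summable_on
      (D - ball c (2 * r) - {c})"
  using w unfolding weight_summable_def
  by (intro summable_on_cmult_right) (rule summable_on_subset_banach, auto)

lemma kern_far_le:
  assumes "\<rho> \<notin> ball c (2 * r) \<or> dist c \<rho> \<ge> 2 * r" "\<rho> \<noteq> c" "dist c s \<le> r"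
  shows "norm (of_int (n \<rho>) * kern c m \<rho> s) \<le> 2 * r ^ m * (real_of_int \<bar>n \<rho>\<bar> / dist c \<rho> ^ Suc m)"
proof -
  have r: "2 * r \<le> dist c \<rho>" using assms by auto
  have "norm (kern c m \<rho> s) \<le> 2 * dist c s ^ m / dist c \<rho> ^ Suc m"
    by (rule kern_norm_le) (use assms r in auto)
  also have "\<dots> \<le> 2 * r ^ m / dist c \<rho> ^ Suc m"
    using assms by (intro divide_right_mono mult_left_mono power_mono) auto
  finally have "\<bar>real_of_int (n \<rho>)\<bar> * norm (kern c m \<rho> s) \<le>
      \<bar>real_of_int (n \<rho>)\<bar> * (2 * r ^ m / dist c \<rho> ^ Suc m)"
    by (rule mult_left_mono) auto
  thus ?thesis by (simp add: norm_mult mult_ac)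
qed

lemma kern_summable:
  assumes w: "weight_summable c (Suc m)"
  shows "(\<lambda>\<rho>. of_int (n \<rho>) * kern c m \<rho> s) summable_on D"
proof -
  define r where "r = dist c s"
  have 1: "(\<lambda>\<rho>. norm (of_int (n \<rho>) * kern c m \<rho> s)) summable_on (D - ball c (2 * r) - {c})"
    by (rule Infinite_Sum.abs_summable_on_comparison_test'[OF kern_abs_summable_far[OF w, of r]])
       (rule kern_far_le, auto simp: r_def)
  have "(\<lambda>\<rho>. of_int (n \<rho>) * kern c m \<rho> s) summable_on (D - ball c (2 * r) - {c}) \<union>
      (D \<inter> insert c (ball c (2 * r)))"
    by (intro summable_on_union abs_summable_summable[OF 1] summable_on_finite bounded_fin) auto
  thus ?thesis by (rule summable_on_subset_banach) auto
qed

text \<open>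
Apart from the at most two points \<open>\<rho> \<in> {c, c'}\<close>, which contribute polynomials by
\<open>kern_minus_simple_fraction\<close>, put \<open>a = (s - c') / (\<rho> - c')\<close> and \<open>b = (s - c) / (\<rho> - c)\<close>. Then
\<open>a - b = (c' - c) (s - \<rho>) / ((\<rho> - c') (\<rho> - c))\<close>, so \<open>(a^m - b^m) / (s - \<rho>)\<close> is a polynomial in
\<open>s\<close> of degree below \<open>m\<close>, whose coefficients are of total order \<open>m + 1\<close> in \<open>1 / \<rho>\<close> and hence
summable.
\<close>

lemma kern_sum_recentre:
  assumes w: "weight_summable c (Suc m)"
  obtains P where "deg_below m P" "\<And>s. s \<notin> D \<Longrightarrow> kern_sum F c' m s - kern_sum F c m s = poly P s"
proof -
  note w' = weight_summable_recentre[OF w, of c']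
  define X where "X = D \<inter> {c, c'}"
  define Y where "Y = D - {c, c'}"
  define u where "u i \<rho> = of_int (n \<rho>) / ((\<rho> - c') ^ Suc i * (\<rho> - c) ^ (m - i))" for i \<rho>
  have "\<exists>P. \<forall>\<rho>. deg_below m (P \<rho>) \<and> (\<forall>s. s \<noteq> \<rho> \<longrightarrow> kern c' m \<rho> s - kern c m \<rho> s = poly (P \<rho>) s)"
  proof (rule choice, rule allI)
    fix \<rho>
    obtain P1 P2 where P: "deg_below m P1" "\<And>s. s \<noteq> \<rho> \<Longrightarrow> kern c m \<rho> s - 1 / (s - \<rho>) = poly P1 s"
      "deg_below m P2" "\<And>s. s \<noteq> \<rho> \<Longrightarrow> kern c' m \<rho> s - 1 / (s - \<rho>) = poly P2 s"
      using kern_minus_simple_fraction[of m \<rho> c] kern_minus_simple_fraction[of m \<rho> c'] by blast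
    have "kern c' m \<rho> s - kern c m \<rho> s = poly (P2 - P1) s" if "s \<noteq> \<rho>" for s
      unfolding poly_diff P(2)[OF that, symmetric] P(4)[OF that, symmetric] by simp
    with deg_below_diff[OF P(3,1)]
    show "\<exists>P. deg_below m P \<and> (\<forall>s. s \<noteq> \<rho> \<longrightarrow> kern c' m \<rho> s - kern c m \<rho> s = poly P s)"
      by (intro exI[of _ "P2 - P1"]) simp
  qed
  then obtain P where P: "\<And>\<rho>. deg_below m (P \<rho>)" "\<And>\<rho> s. s \<noteq> \<rho> \<Longrightarrow> kern c' m \<rho> s - kern c m \<rho> s =
      poly (P \<rho>) s"
    by blast
  have us: "u i summable_on Y" if "i < m" for i
  proof (rule abs_summable_summable, rule Infinite_Sum.abs_summable_on_comparison_test')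
    show "(\<lambda>\<rho>. real_of_int \<bar>n \<rho>\<bar> / dist c' \<rho> ^ Suc m + real_of_int \<bar>n \<rho>\<bar> / dist c \<rho> ^ Suc m)
        summable_on Y"
      by (intro summable_on_add summable_on_subset_banach[OF w[unfolded weight_summable_def]]
            summable_on_subset_banach[OF w'[unfolded weight_summable_def]]) (auto simp: Y_def)
    fix \<rho> assume "\<rho> \<in> Y"
    hence ne: "\<rho> \<noteq> c" "\<rho> \<noteq> c'" by (auto simp: Y_def)
    define x y where "x = dist c' \<rho>" and "y = dist c \<rho>"
    have xy: "x > 0" "y > 0" using ne by (auto simp: x_def y_def)
    have "1 / (x ^ Suc i * y ^ (m - i)) \<le> 1 / x ^ Suc m + 1 / y ^ Suc m"
    proof (cases "x \<le> y")
      case True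
      have "x ^ Suc m = x ^ Suc i * x ^ (m - i)" using that by (simp flip: power_add)
      also have "\<dots> \<le> x ^ Suc i * y ^ (m - i)" using True xy
          by (intro mult_left_mono power_mono) auto
      finally have "1 / (x ^ Suc i * y ^ (m - i)) \<le> 1 / x ^ Suc m" using xy
          by (intro divide_left_mono) auto
      also have "\<dots> \<le> 1 / x ^ Suc m + 1 / y ^ Suc m" using xy by simp
      finally show ?thesis .
    next
      case False
      have "y ^ Suc m = y ^ Suc i * y ^ (m - i)" using that by (simp flip: power_add)
      also have "\<dots> \<le> x ^ Suc i * y ^ (m - i)" using False xy
          by (intro mult_right_mono power_mono) auto
      finally have "1 / (x ^ Suc i * y ^ (m - i)) \<le> 1 / y ^ Suc m" using xy
          by (intro divide_left_mono) auto
      also have "\<dots> \<le> 1 / x ^ Suc m + 1 / y ^ Suc m" using xy by simp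
      finally show ?thesis .
    qed
    from mult_left_mono[OF this, of "real_of_int \<bar>n \<rho>\<bar>"]
    show "norm (u i \<rho>) \<le> real_of_int \<bar>n \<rho>\<bar> / dist c' \<rho> ^ Suc m + real_of_int \<bar>n \<rho>\<bar> / dist c \<rho> ^
        Suc m"
      by (simp add: u_def x_def y_def norm_divide norm_mult norm_power dist_norm
          norm_minus_commute distrib_left)
  qed
  define Q where "Q = (\<Sum>\<rho>\<in>X. smult (of_int (n \<rho>)) (P \<rho>)) +
     (\<Sum>i<m. smult ((c' - c) * infsum (u i) Y) ([:- c', 1:] ^ i * [:- c, 1:] ^ (m - Suc i)))"
  have finX: "finite X" unfolding X_def by (rule bounded_fin) auto
  have "deg_below m ([:- c', 1:] ^ i * [:- c, 1:] ^ (m - Suc i))" if "i < m" for i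
  proof (rule deg_below_degree)
    have "degree ([:- c', 1:] ^ i * [:- c, 1:] ^ (m - Suc i)) \<le>
        degree ([:- c', 1:] ^ i) + degree ([:- c, 1:] ^ (m - Suc i))"
      by (rule degree_mult_le)
    also have "\<dots> \<le> i + (m - Suc i)"
      using degree_power_le[of "[:- c', 1:]" i] degree_power_le[of "[:- c, 1:]" "m - Suc i"]
          by simp
    also have "\<dots> < m" using that by simp
    finally show "degree ([:- c', 1:] ^ i * [:- c, 1:] ^ (m - Suc i)) < m" .
  qed
  hence "deg_below m Q" unfolding Q_def by (intro deg_below_add deg_below_sum deg_below_smult P)
      auto
  moreover have "kern_sum F c' m s - kern_sum F c m s = poly Q s" if s: "s \<notin> D" for s
  proof -
    let ?f = "\<lambda>\<rho>. of_int (n \<rho>) * kern c' m \<rho> s - of_int (n \<rho>) * kern c m \<rho> s"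
    have hs: "(?f has_sum (kern_sum F c' m s - kern_sum F c m s)) D"
      unfolding kern_sum_def by (intro has_sum_minus has_sum_infsum kern_summable w w')
    hence sm: "?f summable_on D" by (auto simp: summable_on_def)
    have "kern_sum F c' m s - kern_sum F c m s = infsum ?f D"
      using hs by (simp add: infsumI)
    also have "D = X \<union> Y" by (auto simp: X_def Y_def)
    also have "infsum ?f (X \<union> Y) = infsum ?f X + infsum ?f Y"
      by (rule infsum_Un_disjoint) (use finX in
          \<open>auto simp: X_def Y_def intro: summable_on_subset_banach[OF sm]\<close>)
    also have "infsum ?f X = (\<Sum>\<rho>\<in>X. of_int (n \<rho>) * poly (P \<rho>) s)"
      unfolding infsum_finite[OF finX]
      by (intro sum.cong refl, subst P(2)[symmetric]) (use s in \<open>auto simp: X_def algebra_simps\<close>)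
    also have "infsum ?f Y = infsum (\<lambda>\<rho>. \<Sum>i<m. ((c' - c) * (s - c') ^ i * (s - c) ^ (m - Suc i)) *
        u i \<rho>) Y"
    proof (rule infsum_cong)
      fix \<rho> assume "\<rho> \<in> Y"
      hence ne: "\<rho> \<noteq> c" "\<rho> \<noteq> c'" "s \<noteq> \<rho>" using s by (auto simp: Y_def)
      define a b where "a = (s - c') / (\<rho> - c')" and "b = (s - c) / (\<rho> - c)"
      have ab: "a - b = (c' - c) * (s - \<rho>) / ((\<rho> - c') * (\<rho> - c))"
        using ne by (simp add: a_def b_def divide_simps) (simp add: algebra_simps)
      have "?f \<rho> = of_int (n \<rho>) * ((a ^ m - b ^ m) / (s - \<rho>))"
        using ne by (simp add: kern_def a_def b_def diff_divide_distrib right_diff_distrib)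
      also have "a ^ m - b ^ m = (a - b) * (\<Sum>i<m. b ^ (m - Suc i) * a ^ i)"
        by (rule power_diff_sumr2)
      also have "of_int (n \<rho>) * ((a - b) * (\<Sum>i<m. b ^ (m - Suc i) * a ^ i) / (s - \<rho>)) =
          (\<Sum>i<m. of_int (n \<rho>) * ((c' - c) / ((\<rho> - c') * (\<rho> - c))) * (b ^ (m - Suc i) * a ^ i))"
        unfolding ab using ne by (simp add: sum_distrib_left sum_divide_distrib mult.assoc)
      also have "\<dots> = (\<Sum>i<m. ((c' - c) * (s - c') ^ i * (s - c) ^ (m - Suc i)) * u i \<rho>)"
      proof (intro sum.cong refl)
        fix i assume "i \<in> {..<m}"
        hence "m - i = Suc (m - Suc i)" by simp
        thus "of_int (n \<rho>) * ((c' - c) / ((\<rho> - c') * (\<rho> - c))) * (b ^ (m - Suc i) * a ^ i) =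
              ((c' - c) * (s - c') ^ i * (s - c) ^ (m - Suc i)) * u i \<rho>"
          using ne by (simp add: u_def a_def b_def power_divide mult_ac)
      qed
      finally show "?f \<rho> = (\<Sum>i<m. ((c' - c) * (s - c') ^ i * (s - c) ^ (m - Suc i)) * u i \<rho>)" .
    qed
    also have "\<dots> = (\<Sum>i<m. infsum (\<lambda>\<rho>. ((c' - c) * (s - c') ^ i * (s - c) ^ (m - Suc i)) * u i \<rho>)
        Y)"
      by (intro infsumI has_sum_sum_finite has_sum_infsum summable_on_cmult_right us) auto
    also have "\<dots> = (\<Sum>i<m. (c' - c) * infsum (u i) Y * ((s - c') ^ i * (s - c) ^ (m - Suc i)))"
      by (intro sum.cong refl, subst infsum_cmult_right) (auto intro: us)
    finally show ?thesis by (simp add: Q_def poly_sum poly_power)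
  qed
  ultimately show ?thesis using that by blast
qed

text \<open>
Local holomorphic extensions across the divisor agree with the removal of singularities, by
continuity.
\<close>

lemma entire_glue:
  assumes "\<And>R. R \<ge> 1 \<Longrightarrow> \<exists>E. E holomorphic_on ball c R \<and> (\<forall>s\<in>ball c R. s \<notin> D \<longrightarrow> E s = f s)"
  obtains g where "g holomorphic_on UNIV" "\<And>s. s \<notin> D \<Longrightarrow> g s = f s"
proof -
  have eq: "remove_sings f w = E w"
    if E: "E holomorphic_on ball c R" "\<forall>s\<in>ball c R. s \<notin> D \<longrightarrow> E s = f s" and w: "w \<in> ball c R"
        for E R w
  proof (rule remove_sings_eqI)
    have "isCont E w"
      using holomorphic_on_imp_continuous_on[OF E(1)] w
          by (simp add: continuous_on_eq_continuous_at)
    hence "E \<midarrow>w\<rightarrow> E w" by (simp add: isCont_def)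
    moreover have "eventually (\<lambda>s. s \<in> ball c R) (at w)" using w
        by (intro eventually_at_in_open') auto
    hence "eventually (\<lambda>s. E s = f s) (at w)"
      using divisor_eventually_not[OF mero, of w] by eventually_elim (use E in auto)
    ultimately show "f \<midarrow>w\<rightarrow> E w" by (rule Lim_transform_eventually)
  qed
  have "remove_sings f analytic_on {z} \<and> (z \<notin> D \<longrightarrow> remove_sings f z = f z)" for z
  proof -
    define R where "R = dist c z + 1"
    obtain E where E: "E holomorphic_on ball c R" "\<forall>s\<in>ball c R. s \<notin> D \<longrightarrow> E s = f s"
      using assms[of R] by (auto simp: R_def)
    have z: "z \<in> ball c R" by (simp add: R_def)
    have "remove_sings f holomorphic_on ball c R"
      by (rule holomorphic_transform[OF E(1)]) (simp add: eq[OF E])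
    thus ?thesis using z E eq[OF E z] by (auto simp: analytic_at intro!: exI[of _ "ball c R"])
  qed
  hence "remove_sings f holomorphic_on UNIV" "\<And>s. s \<notin> D \<Longrightarrow> remove_sings f s = f s"
    by (auto intro!: analytic_imp_holomorphic simp: analytic_on_analytic_at[of _ UNIV])
  thus ?thesis using that by blast
qed

end

section \<open>Logarithmic derivatives of meromorphic functions of finite order\<close>

context divisor begin

lemma kern_sum_split:
  assumes w: "weight_summable c (Suc m)" and X: "finite X" "X \<subseteq> D"
  shows "kern_sum F c m s = (\<Sum>\<rho>\<in>X. of_int (n \<rho>) * kern c m \<rho> s) +
      (\<Sum>\<^sub>\<infinity>\<rho>\<in>D - X. of_int (n \<rho>) * kern c m \<rho> s)"
proof -
  have sm: "(\<lambda>\<rho>. of_int (n \<rho>) * kern c m \<rho> s) summable_on D" by (rule kern_summable[OF w])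
  have "kern_sum F c m s = (\<Sum>\<^sub>\<infinity>\<rho>\<in>X \<union> (D - X). of_int (n \<rho>) * kern c m \<rho> s)"
    unfolding kern_sum_def using X by (intro arg_cong2[of _ _ _ _ infsum] refl) auto
  also have "\<dots> = (\<Sum>\<^sub>\<infinity>\<rho>\<in>X. of_int (n \<rho>) * kern c m \<rho> s) +
      (\<Sum>\<^sub>\<infinity>\<rho>\<in>D - X. of_int (n \<rho>) * kern c m \<rho> s)"
    by (rule infsum_Un_disjoint) (use X in \<open>auto intro: summable_on_subset_banach[OF sm]\<close>)
  finally show ?thesis using X by simp
qed

lemma kern_tail_norm_le:
  assumes w: "weight_summable c (Suc m)" and X: "D \<inter> ball c (2 * r) \<subseteq> X" "c \<in> D \<Longrightarrow> c \<in> X"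
      and s: "dist c s \<le> r"
  shows "norm (\<Sum>\<^sub>\<infinity>\<rho>\<in>D - X. of_int (n \<rho>) * kern c m \<rho> s) \<le>
         2 * r ^ m * (\<Sum>\<^sub>\<infinity>\<rho>\<in>D - X. real_of_int \<bar>n \<rho>\<bar> / dist c \<rho> ^ Suc m)"
proof -
  have sm: "(\<lambda>\<rho>. 2 * r ^ m * (real_of_int \<bar>n \<rho>\<bar> / dist c \<rho> ^ Suc m)) summable_on D - X"
    by (rule summable_on_subset_banach[OF kern_abs_summable_far[OF w, of r]]) (use X in auto)
  have le: "norm (of_int (n \<rho>) * kern c m \<rho> s) \<le>
      2 * r ^ m * (real_of_int \<bar>n \<rho>\<bar> / dist c \<rho> ^ Suc m)" if "\<rho> \<in> D - X" for \<rho>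
    by (rule kern_far_le) (use that X s in auto)
  have sm': "(\<lambda>\<rho>. norm (of_int (n \<rho>) * kern c m \<rho> s)) summable_on D - X"
    by (rule Infinite_Sum.abs_summable_on_comparison_test'[OF sm le])
  have "norm (\<Sum>\<^sub>\<infinity>\<rho>\<in>D - X. of_int (n \<rho>) * kern c m \<rho> s) \<le>
      (\<Sum>\<^sub>\<infinity>\<rho>\<in>D - X. norm (of_int (n \<rho>) * kern c m \<rho> s))"
    by (rule norm_infsum_bound[OF sm'])
  also have "\<dots> \<le> (\<Sum>\<^sub>\<infinity>\<rho>\<in>D - X. 2 * r ^ m * (real_of_int \<bar>n \<rho>\<bar> / dist c \<rho> ^ Suc m))"
    by (rule infsum_mono[OF sm' sm le])
  also have "\<dots> = 2 * r ^ m * (\<Sum>\<^sub>\<infinity>\<rho>\<in>D - X. real_of_int \<bar>n \<rho>\<bar> / dist c \<rho> ^ Suc m)"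
    by (rule infsum_cmult_right') 
  finally show ?thesis .
qed

text \<open>
The series converges uniformly on the disc, since its terms are bounded by \<open>kern_far_le\<close>.
\<close>

lemma kern_tail_holomorphic:
  assumes w: "weight_summable c (Suc m)" and X: "D \<inter> ball c (2 * r) \<subseteq> X" "c \<in> D \<Longrightarrow> c \<in> X"
  shows "(\<lambda>s. \<Sum>\<^sub>\<infinity>\<rho>\<in>D - X. of_int (n \<rho>) * kern c m \<rho> s) holomorphic_on ball c r"
proof (cases "r > 0")
  case False
  hence "ball c r = {}" by simp
  thus ?thesis by (simp only: holomorphic_on_empty)
next
  case True
  have sm: "(\<lambda>\<rho>. 2 * r ^ m * (real_of_int \<bar>n \<rho>\<bar> / dist c \<rho> ^ Suc m)) summable_on D - X"
    by (rule summable_on_subset_banach[OF kern_abs_summable_far[OF w, of r]]) (use X in auto)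
  have ul: "uniform_limit (cball c r) (\<lambda>X s. \<Sum>\<rho>\<in>X. of_int (n \<rho>) * kern c m \<rho> s)
     (\<lambda>s. \<Sum>\<^sub>\<infinity>\<rho>\<in>D - X. of_int (n \<rho>) * kern c m \<rho> s) (finite_subsets_at_top (D - X))"
    by (rule Weierstrass_m_test_general[OF kern_far_le sm]) (use X in auto)
  have hol: "(\<lambda>s. \<Sum>\<rho>\<in>Y. of_int (n \<rho>) * kern c m \<rho> s) holomorphic_on cball c r" if "Y \<subseteq> D - X"
      for Y
  proof (intro holomorphic_intros)
    fix \<rho> assume "\<rho> \<in> Y"
    hence \<rho>: "\<rho> \<noteq> c" "dist c \<rho> \<ge> 2 * r" using that X by auto
    hence "\<rho> \<notin> cball c r" using True by auto
    thus "kern c m \<rho> holomorphic_on cball c r"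
      using \<rho> by (auto simp: kern_def[abs_def] intro!: holomorphic_intros)
  qed
  show ?thesis
  proof (rule holomorphic_uniform_limit[OF _ ul])
    show "\<forall>\<^sub>F Y in finite_subsets_at_top (D - X). continuous_on (cball c r)
        (\<lambda>s. \<Sum>\<rho>\<in>Y. of_int (n \<rho>) * kern c m \<rho> s) \<and>
       (\<lambda>s. \<Sum>\<rho>\<in>Y. of_int (n \<rho>) * kern c m \<rho> s) holomorphic_on ball c r"
    proof (rule eventually_finite_subsets_at_top_weakI)
      fix Y assume "finite Y" "Y \<subseteq> D - X"
      thus "continuous_on (cball c r) (\<lambda>s. \<Sum>\<rho>\<in>Y. of_int (n \<rho>) * kern c m \<rho> s) \<and>
       (\<lambda>s. \<Sum>\<rho>\<in>Y. of_int (n \<rho>) * kern c m \<rho> s) holomorphic_on ball c r"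
        using holomorphic_on_imp_continuous_on[OF hol]
            holomorphic_on_subset[OF hol ball_subset_cball] by blast
    qed
  qed auto
qed

text \<open>
For every \<open>R\<close> the difference \<open>f\<close> of the logarithmic derivative and the Mittag-Leffler series
splits into three parts: the logarithmic derivative with the principal parts in the disc of
radius \<open>R\<close> removed, the Taylor polynomials of these principal parts, and the tail of the series.
All three are holomorphic near the centre, so \<open>f\<close> extends to an entire function. With \<open>R = 4 r\<close>
all three are bounded by a multiple of \<open>r^(K + m)\<close> at distance \<open>r\<close> from the centre, the second
because it involves only \<open>O(R^K)\<close> points, counted with multiplicity. The Liouville theorem for
polynomial growth concludes.
\<close>

lemma logderiv_eq_poly_at_centre:
  assumes c: "c \<notin> D" and C: "C \<ge> 0" and w: "weight_summable c (Suc m)"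
    and cnt: "\<And>R. R \<ge> 1 \<Longrightarrow> (\<Sum>\<rho>\<in>D \<inter> ball c R. real_of_int \<bar>n \<rho>\<bar>) \<le> C * R ^ K"
    and bd: "\<And>R z. R \<ge> 1 \<Longrightarrow> z \<notin> D \<Longrightarrow> dist c z < R / 2 \<Longrightarrow>
       norm (deriv F z / F z - (\<Sum>\<rho>\<in>D \<inter> ball c R. of_int (n \<rho>) / (z - \<rho>))) \<le> C * R ^ K"
  obtains q where "\<And>s. s \<notin> D \<Longrightarrow> deriv F s / F s = poly q s + kern_sum F c m s"
proof -
  define f where "f s = deriv F s / F s - kern_sum F c m s" for s
  define p where "p \<rho> s = (1 / (\<rho> - c)) * (\<Sum>i<m. ((s - c) / (\<rho> - c)) ^ i)" for \<rho> s
  have kp: "kern c m \<rho> s = 1 / (s - \<rho>) + p \<rho> s" if "\<rho> \<in> D" "s \<notin> D" for \<rho> s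
    unfolding p_def by (rule kern_eq) (use that c in auto)
  have split: "f s = (deriv F s / F s - (\<Sum>\<rho>\<in>D \<inter> ball c R. of_int (n \<rho>) / (s - \<rho>)))
      - (\<Sum>\<rho>\<in>D \<inter> ball c R. of_int (n \<rho>) * p \<rho> s)
      - (\<Sum>\<^sub>\<infinity>\<rho>\<in>D - D \<inter> ball c R. of_int (n \<rho>) * kern c m \<rho> s)" if s: "s \<notin> D" for s R
  proof -
    have "kern_sum F c m s = (\<Sum>\<rho>\<in>D \<inter> ball c R. of_int (n \<rho>) * kern c m \<rho> s) +
        (\<Sum>\<^sub>\<infinity>\<rho>\<in>D - D \<inter> ball c R. of_int (n \<rho>) * kern c m \<rho> s)"
      by (rule kern_sum_split[OF w]) (auto intro: bounded_fin)
    also have "(\<Sum>\<rho>\<in>D \<inter> ball c R. of_int (n \<rho>) * kern c m \<rho> s) =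
       (\<Sum>\<rho>\<in>D \<inter> ball c R. of_int (n \<rho>) / (s - \<rho>)) + (\<Sum>\<rho>\<in>D \<inter> ball c R. of_int (n \<rho>) * p \<rho> s)"
      unfolding sum.distrib[symmetric] by (intro sum.cong refl) (simp add: kp s distrib_left)
    finally show ?thesis by (simp add: f_def)
  qed
  have "\<exists>E. E holomorphic_on ball c r \<and> (\<forall>s\<in>ball c r. s \<notin> D \<longrightarrow> E s = f s)" if r: "r \<ge> 1" for r
  proof -
    define R where "R = 2 * r"
    define X where "X = D \<inter> ball c R"
    have finX: "finite X" unfolding X_def by (intro bounded_fin) auto
    obtain H where H:
      "\<And>s. s \<in> X \<or> s \<notin> D \<Longrightarrow> H analytic_on {s} \<and> H s \<noteq> 0"
      "\<And>s. F analytic_on {s} \<Longrightarrow> H analytic_on {s}"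
      "\<And>s. s \<notin> D \<Longrightarrow> F s = H s * (\<Prod>\<rho>\<in>X. (s - \<rho>) powi n \<rho>)"
      "\<And>s. F analytic_on {s} \<Longrightarrow> s \<notin> X \<Longrightarrow> F s = H s * (\<Prod>\<rho>\<in>X. (s - \<rho>) powi n \<rho>)"
      using factor_divisor[OF mero ex finX] by blast
    have HB: "H analytic_on {s} \<and> H s \<noteq> 0" if "s \<in> ball c R" for s using H(1)[of s] that
        by (auto simp: X_def)
    have Hh: "H holomorphic_on ball c r"
      by (rule analytic_imp_holomorphic, subst analytic_on_analytic_at)
          (use HB r in \<open>auto simp: R_def\<close>)
    define E where "E s = deriv H s / H s - (\<Sum>\<rho>\<in>X. of_int (n \<rho>) * p \<rho> s)
      - (\<Sum>\<^sub>\<infinity>\<rho>\<in>D - X. of_int (n \<rho>) * kern c m \<rho> s)" for s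
    have "E holomorphic_on ball c r"
      unfolding E_def
    proof (intro holomorphic_on_diff holomorphic_on_divide holomorphic_deriv Hh open_ball)
      show "H z \<noteq> 0" if "z \<in> ball c r" for z using HB[of z] that r by (auto simp: R_def)
      show "(\<lambda>s. \<Sum>\<rho>\<in>X. of_int (n \<rho>) * p \<rho> s) holomorphic_on ball c r"
        unfolding p_def by (intro holomorphic_intros) (use c in \<open>auto simp: X_def\<close>)
      show "(\<lambda>s. \<Sum>\<^sub>\<infinity>\<rho>\<in>D - X. of_int (n \<rho>) * kern c m \<rho> s) holomorphic_on ball c r"
        by (rule kern_tail_holomorphic[OF w]) (use c in \<open>auto simp: X_def R_def\<close>)
    qed
    moreover have "E s = f s" if "s \<notin> D" for s
    proof -
      have "deriv F s / F s - (\<Sum>\<rho>\<in>X. of_int (n \<rho>) / (s - \<rho>)) = deriv H s / H s"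
        using logderiv_factor[OF mero ex that H(3)] H(1)[of s] that by simp
      thus ?thesis using split[OF that, of R] by (simp add: E_def X_def)
    qed
    ultimately show ?thesis by blast
  qed
  from entire_glue[OF this] obtain g where g: "g holomorphic_on UNIV" "\<And>s. s \<notin> D \<Longrightarrow> g s = f s"
      by blast
  \<comment> \<open>The Taylor polynomials involve powers of \<open>1 / (\<rho> - c)\<close>, so a lower bound \<open>\<delta>\<close>
      for the distance of the divisor to \<open>c\<close> enters.\<close>
  have "open (- D)" "c \<in> - D" using divisor_closed[OF mero] c by auto
  then obtain \<delta>0 where \<delta>0: "\<delta>0 > 0" "ball c \<delta>0 \<subseteq> - D"
    using open_contains_ball by blast
  define \<delta> where "\<delta> = min \<delta>0 1"
  have \<delta>: "\<delta> > 0" "\<delta> \<le> 1" using \<delta>0 by (auto simp: \<delta>_def)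
  have \<delta>D: "dist c \<rho> \<ge> \<delta>" if "\<rho> \<in> D" for \<rho>
  proof (rule ccontr)
    assume "\<not> ?thesis"
    hence "\<rho> \<in> ball c \<delta>0" by (simp add: \<delta>_def)
    thus False using \<delta>0 that by blast
  qed
  define S where "S = (\<Sum>\<^sub>\<infinity>\<rho>\<in>D. real_of_int \<bar>n \<rho>\<bar> / dist c \<rho> ^ Suc m)"
  have Dc: "D - {c} = D" using c by auto
  have sS: "(\<lambda>\<rho>. real_of_int \<bar>n \<rho>\<bar> / dist c \<rho> ^ Suc m) summable_on D"
    using w unfolding weight_summable_def Dc .
  have S: "S \<ge> 0" unfolding S_def by (rule infsum_nonneg) auto
  define B where "B = C * 4 ^ K + C * 4 ^ K * (real m / \<delta> ^ Suc m) + 2 * S"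
  have B: "B \<ge> 0" unfolding B_def using C S \<delta> by (intro add_nonneg_nonneg mult_nonneg_nonneg) auto
  have fb: "norm (f s) \<le> B * r ^ (K + m)" if s: "s \<notin> D" and r: "dist c s \<le> r" "r \<ge> 1" for s r
  proof -
    define R where "R = 4 * r"
    have R: "R \<ge> 1" using r by (simp add: R_def)
    have finX: "finite (D \<inter> ball c R)" by (intro bounded_fin) auto
    have rm: "r ^ m \<ge> 1" "r ^ K \<ge> 1" using r by auto
    have 1: "norm (deriv F s / F s - (\<Sum>\<rho>\<in>D \<inter> ball c R. of_int (n \<rho>) / (s - \<rho>))) \<le>
        C * 4 ^ K * r ^ (K + m)"
    proof -
      have "norm (deriv F s / F s - (\<Sum>\<rho>\<in>D \<inter> ball c R. of_int (n \<rho>) / (s - \<rho>))) \<le> C * R ^ K"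
        by (rule bd) (use R r s in \<open>auto simp: R_def\<close>)
      also have "\<dots> = C * 4 ^ K * r ^ K * 1" by (simp add: R_def power_mult_distrib)
      also have "\<dots> \<le> C * 4 ^ K * r ^ K * r ^ m" using C r rm by (intro mult_left_mono) auto
      finally show ?thesis by (simp add: power_add mult_ac)
    qed
    have pb: "norm (p \<rho> s) \<le> real m / \<delta> ^ Suc m * r ^ m" if "\<rho> \<in> D" for \<rho>
    proof -
      have d: "norm (\<rho> - c) \<ge> \<delta>" using \<delta>D[OF that] by (simp add: dist_norm norm_minus_commute)
      have q: "norm ((s - c) / (\<rho> - c)) \<le> r / \<delta>"
        unfolding norm_divide using d \<delta> r by (intro frac_le)
            (auto simp: dist_norm norm_minus_commute)
      have "r / \<delta> \<ge> 1" using r \<delta> by (simp add: field_simps)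
      have "norm (\<Sum>i<m. ((s - c) / (\<rho> - c)) ^ i) \<le> (\<Sum>i<m. (r / \<delta>) ^ m)"
      proof (rule sum_norm_le)
        fix i assume "i \<in> {..<m}"
        have "norm (((s - c) / (\<rho> - c)) ^ i) \<le> (r / \<delta>) ^ i"
          unfolding norm_power by (intro power_mono q) auto
        also have "\<dots> \<le> (r / \<delta>) ^ m" using \<open>i \<in> _\<close> \<open>r / \<delta> \<ge> 1\<close> by (intro power_increasing) auto
        finally show "norm (((s - c) / (\<rho> - c)) ^ i) \<le> (r / \<delta>) ^ m" .
      qed
      moreover have "norm (1 / (\<rho> - c)) \<le> 1 / \<delta>" unfolding norm_divide using d \<delta>
          by (intro frac_le) auto
      ultimately have "norm (p \<rho> s) \<le> (1 / \<delta>) * (\<Sum>i<m. (r / \<delta>) ^ m)"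
        unfolding p_def norm_mult using \<delta> by (intro mult_mono) auto
      thus ?thesis by (simp add: power_divide)
    qed
    have 2: "norm (\<Sum>\<rho>\<in>D \<inter> ball c R. of_int (n \<rho>) * p \<rho> s) \<le>
        C * 4 ^ K * (real m / \<delta> ^ Suc m) * r ^ (K + m)"
    proof -
      have "norm (\<Sum>\<rho>\<in>D \<inter> ball c R. of_int (n \<rho>) * p \<rho> s) \<le>
            (\<Sum>\<rho>\<in>D \<inter> ball c R. real_of_int \<bar>n \<rho>\<bar> * (real m / \<delta> ^ Suc m * r ^ m))"
      proof (rule sum_norm_le)
        fix \<rho> assume \<rho>: "\<rho> \<in> D \<inter> ball c R"
        have "norm (of_int (n \<rho>) * p \<rho> s) = real_of_int \<bar>n \<rho>\<bar> * norm (p \<rho> s)"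
            by (simp add: norm_mult)
        also have "\<dots> \<le> real_of_int \<bar>n \<rho>\<bar> * (real m / \<delta> ^ Suc m * r ^ m)"
          by (intro mult_left_mono pb) (use \<rho> in auto)
        finally show "norm (of_int (n \<rho>) * p \<rho> s) \<le>
            real_of_int \<bar>n \<rho>\<bar> * (real m / \<delta> ^ Suc m * r ^ m)" .
      qed
      also have "\<dots> = (\<Sum>\<rho>\<in>D \<inter> ball c R. real_of_int \<bar>n \<rho>\<bar>) * (real m / \<delta> ^ Suc m * r ^ m)"
        by (simp only: sum_distrib_right)
      also have "\<dots> \<le> C * R ^ K * (real m / \<delta> ^ Suc m * r ^ m)"
        using \<delta> r by (intro mult_right_mono cnt R) auto
      finally show ?thesis by (simp add: R_def power_mult_distrib power_add mult_ac)
    qed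
    have 3: "norm (\<Sum>\<^sub>\<infinity>\<rho>\<in>D - D \<inter> ball c R. of_int (n \<rho>) * kern c m \<rho> s) \<le> 2 * S * r ^ (K + m)"
    proof -
      have "norm (\<Sum>\<^sub>\<infinity>\<rho>\<in>D - D \<inter> ball c R. of_int (n \<rho>) * kern c m \<rho> s) \<le>
         2 * r ^ m * (\<Sum>\<^sub>\<infinity>\<rho>\<in>D - D \<inter> ball c R. real_of_int \<bar>n \<rho>\<bar> / dist c \<rho> ^ Suc m)"
        by (rule kern_tail_norm_le[OF w]) (use c r in \<open>auto simp: R_def\<close>)
      also have "(\<Sum>\<^sub>\<infinity>\<rho>\<in>D - D \<inter> ball c R. real_of_int \<bar>n \<rho>\<bar> / dist c \<rho> ^ Suc m) \<le> S"
        unfolding S_def by (rule infsum_mono_neutral[OF summable_on_subset_banach[OF sS] sS]) auto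
      also have "2 * r ^ m * S = 2 * S * (1 * r ^ m)" by simp
      also have "\<dots> \<le> 2 * S * (r ^ K * r ^ m)"
        using S r rm by (intro mult_left_mono mult_right_mono) auto
      finally show ?thesis using r by (simp add: power_add mult_left_mono)
    qed
    have "norm (f s) \<le> C * 4 ^ K * r ^ (K + m) + C * 4 ^ K * (real m / \<delta> ^ Suc m) * r ^ (K + m) +
        2 * S * r ^ (K + m)"
      unfolding split[OF s, of R]
      by (intro order_trans[OF norm_triangle_ineq4] add_mono 1 2 3)
    thus ?thesis by (simp add: B_def distrib_right)
  qed
  define A where "A = norm c + 1"
  have gb: "norm (g z) \<le> B * 4 ^ (K + m) * norm z ^ (K + m)" if z: "A \<le> norm z" for z
  proof -
    have nz: "norm z \<ge> 1" using z norm_ge_zero[of c] unfolding A_def by linarith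
    have dz: "dist c z \<le> 2 * norm z" using z norm_triangle_ineq4[of c z]
        by (simp add: dist_norm A_def)
    have "norm (g z) \<le> B * (4 * norm z) ^ (K + m)"
    proof (rule norm_le_off_divisor[OF mero, where U = "ball z 1" and f = g])
      show "isCont g z" using holomorphic_on_imp_continuous_on[OF g(1)]
          by (simp add: continuous_on_eq_continuous_at)
      show "open (ball z 1)" "z \<in> ball z 1" by auto
      fix w assume w: "w \<in> ball z 1" "w \<notin> D"
      have d: "dist c w \<le> 4 * norm z" using dist_triangle[of c w z] w dz nz by simp
      show "norm (g w) \<le> B * (4 * norm z) ^ (K + m)"
        unfolding g(2)[OF w(2)] by (rule fb[OF w(2) d]) (use nz in simp)
    qed
    thus ?thesis by (simp add: power_mult_distrib mult.assoc)
  qed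
  define q where "q = (\<Sum>k\<le>K+m. monom ((deriv ^^ k) g 0 / fact k) k)"
  have "g s = poly q s" for s
    using Liouville_polynomial[OF g(1) gb, where \<xi> = s] by (simp add: q_def poly_sum poly_monom)
  hence "deriv F s / F s = poly q s + kern_sum F c m s" if "s \<notin> D" for s
    using g(2)[OF that] by (simp add: f_def)
  thus ?thesis using that by blast
qed

lemma conv_exponent_exists:
  assumes fo: "meromorphic_finite_order F"
  shows "\<exists>d. weight_summable 0 d"
proof -
  obtain c C K where c: "C \<ge> 0" "c \<notin> D"
    "\<And>R. R \<ge> 1 \<Longrightarrow> (\<Sum>\<rho>\<in>D \<inter> ball c R. real_of_int \<bar>n \<rho>\<bar>) \<le> C * R ^ K"
    "\<And>R z. R \<ge> 1 \<Longrightarrow> z \<notin> D \<Longrightarrow> dist c z < R / 2 \<Longrightarrow>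
       norm (deriv F z / F z - (\<Sum>\<rho>\<in>D \<inter> ball c R. of_int (n \<rho>) / (z - \<rho>))) \<le> C * R ^ K"
    by (rule finite_order_logderiv_bound[OF mero ex fo], rule that)
  have "(\<lambda>\<rho>. real_of_int \<bar>n \<rho>\<bar> / (1 + dist c \<rho>) ^ (K + 2)) summable_on D"
    by (rule polynomial_count_summable[OF bounded_fin _ c(3)]) auto
  hence s: "(\<lambda>\<rho>. real_of_int \<bar>n \<rho>\<bar> / (1 + dist c \<rho>) ^ (K + 2)) summable_on D - ball c 1"
    by (rule summable_on_subset_banach) auto
  have "(\<lambda>\<rho>. real_of_int \<bar>n \<rho>\<bar> / dist c \<rho> ^ (K + 2)) summable_on D - ball c 1"
  proof (rule summable_on_comparison_test[OF summable_on_cmult_right[OF s, of "2 ^ (K + 2)"]])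
    fix \<rho> assume "\<rho> \<in> D - ball c 1"
    hence d: "dist c \<rho> \<ge> 1" by simp
    have "(1 + dist c \<rho>) ^ (K + 2) \<le> (2 * dist c \<rho>) ^ (K + 2)" using d by (intro power_mono) auto
    moreover have "0 < dist c \<rho> ^ (K + 2)" "0 < (1 + dist c \<rho>) ^ (K + 2)"
      by (rule zero_less_power, use d in linarith)+
    moreover have "1 / x \<le> 2 ^ (K + 2) / y" if "y \<le> 2 ^ (K + 2) * x" "0 < x" "0 < y"
        for x y :: real
      using that by (simp add: divide_simps mult.commute)
    ultimately have "1 / dist c \<rho> ^ (K + 2) \<le> 2 ^ (K + 2) / (1 + dist c \<rho>) ^ (K + 2)"
      unfolding power_mult_distrib by blast
    from mult_left_mono[OF this, of "real_of_int \<bar>n \<rho>\<bar>"]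
    show "real_of_int \<bar>n \<rho>\<bar> / dist c \<rho> ^ (K + 2) \<le>
        2 ^ (K + 2) * (real_of_int \<bar>n \<rho>\<bar> / (1 + dist c \<rho>) ^ (K + 2))"
      by (simp add: mult_ac)
  qed auto
  hence "(\<lambda>\<rho>. real_of_int \<bar>n \<rho>\<bar> / dist c \<rho> ^ (K + 2)) summable_on (D - ball c 1) \<union> (D \<inter> ball c 1)"
    by (rule summable_on_union[OF _ summable_on_finite]) (auto intro: bounded_fin)
  hence "weight_summable c (K + 2)"
    unfolding weight_summable_def by (rule summable_on_subset_banach) auto
  thus ?thesis using weight_summable_recentre by blast
qed

lemma logderiv_eq_poly:
  assumes fo: "meromorphic_finite_order F" and w: "weight_summable c (Suc m)"
  obtains q where "\<And>s. s \<notin> D \<Longrightarrow> deriv F s / F s = poly q s + kern_sum F c m s"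
proof -
  obtain c0 C K where c: "C \<ge> 0" "c0 \<notin> D"
    "\<And>R. R \<ge> 1 \<Longrightarrow> (\<Sum>\<rho>\<in>D \<inter> ball c0 R. real_of_int \<bar>n \<rho>\<bar>) \<le> C * R ^ K"
    "\<And>R z. R \<ge> 1 \<Longrightarrow> z \<notin> D \<Longrightarrow> dist c0 z < R / 2 \<Longrightarrow>
       norm (deriv F z / F z - (\<Sum>\<rho>\<in>D \<inter> ball c0 R. of_int (n \<rho>) / (z - \<rho>))) \<le> C * R ^ K"
    by (rule finite_order_logderiv_bound[OF mero ex fo], rule that)
  obtain q where q: "\<And>s. s \<notin> D \<Longrightarrow> deriv F s / F s = poly q s + kern_sum F c0 m s"
    using logderiv_eq_poly_at_centre[OF c(2,1) weight_summable_recentre[OF w] c(3,4)] by blast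
  obtain P where P: "deg_below m P" "\<And>s. s \<notin> D \<Longrightarrow> kern_sum F c0 m s - kern_sum F c m s = poly P s"
    by (rule kern_sum_recentre[OF w], rule that)
  have "deriv F s / F s = poly (q + P) s + kern_sum F c m s" if "s \<notin> D" for s
    unfolding q[OF that] poly_add P(2)[OF that, symmetric] by simp
  thus ?thesis using that by blast
qed

end

section \<open>Hadamard polynomials and the discrepancy polynomial\<close>

lemma poly_antiderivative:
  obtains Q :: "complex poly" where "pderiv Q = q" "poly Q 0 = a"
proof -
  define Q where "Q = [:a:] + (\<Sum>i\<le>degree q. monom (coeff q i / of_nat (Suc i)) (Suc i))"
  have pderiv_sum: "pderiv (\<Sum>i\<in>A. f i) = (\<Sum>i\<in>A. pderiv (f i))" for f :: "nat \<Rightarrow> complex poly" and A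
    by (induction A rule: infinite_finite_induct) (auto simp: pderiv_add)
  have "pderiv Q = (\<Sum>i\<le>degree q. monom (coeff q i) i)"
    unfolding Q_def pderiv_add pderiv_sum pderiv_monom
    by (simp add: pderiv_pCons del: of_nat_Suc)
  also have "\<dots> = q" by (rule poly_as_sum_of_monoms)
  finally have "pderiv Q = q" .
  moreover have "poly Q 0 = a" by (simp add: Q_def poly_sum poly_monom)
  ultimately show ?thesis using that by blast
qed

lemma tendsto_of_exp_error:
  fixes P :: "'a \<Rightarrow> complex"
  assumes "eventually (\<lambda>X. \<exists>L. P X = A * exp L \<and> norm L \<le> \<epsilon> X) G" "(\<epsilon> \<longlongrightarrow> 0) G"
  shows "(P \<longlongrightarrow> A) G"
proof -
  define LL where "LL X = (SOME L. P X = A * exp L \<and> norm L \<le> \<epsilon> X)" for X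
  have ev: "eventually (\<lambda>X. P X = A * exp (LL X) \<and> norm (LL X) \<le> \<epsilon> X) G"
    using assms(1) by eventually_elim (unfold LL_def, rule someI_ex)
  have "(LL \<longlongrightarrow> 0) G"
    by (rule Lim_null_comparison[OF _ assms(2)]) (use ev in \<open>auto elim: eventually_mono\<close>)
  hence "((\<lambda>X. A * exp (LL X)) \<longlongrightarrow> A * exp 0) G"
    by (intro tendsto_intros)
  hence "((\<lambda>X. A * exp (LL X)) \<longlongrightarrow> A) G" by simp
  moreover have "eventually (\<lambda>X. A * exp (LL X) = P X) G" using ev by eventually_elim simp
  ultimately show ?thesis by (rule Lim_transform_eventually)
qed

context divisor begin

lemma poly_eq_off_divisor:
  assumes "\<And>s. s \<notin> D \<Longrightarrow> poly P s = poly Q s"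
  shows "P = Q"
proof -
  have "norm (poly (P - Q) s) \<le> 0" for s
    by (rule norm_le_off_divisor[OF mero, where U = UNIV and f = "poly (P - Q)"])
        (use assms in auto)
  hence "poly (P - Q) s = 0" for s by (metis norm_le_zero_iff)
  hence "P - Q = 0" using poly_all_0_iff_0 by blast
  thus ?thesis by simp
qed

text \<open>
Compare \<open>F\<close> with the partial Hadamard product over a finite set \<open>X\<close> that exhausts the divisor in
the disc of radius \<open>2 r\<close>. Their ratio \<open>rr\<close> extends to a zero-free holomorphic function on this
disc with value \<open>1\<close> at the origin, and its logarithmic derivative is the tail of the
Mittag-Leffler series outside \<open>X\<close>, which is small. Integrating it from the origin shows that the
ratio is the exponential of a small number. This proves convergence of the product and
identifies its limit in one step.
\<close>

lemma partial_product_ratio: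
  assumes w: "weight_summable 0 (Suc m)" and q: "\<And>s. s \<notin> D \<Longrightarrow> deriv F s / F s =
      poly q s + kern_sum F 0 m s"
    and Q: "pderiv Q = q"
    and H0: "H0 analytic_on {0}" "H0 0 = exp (poly Q 0)" "\<And>s. s \<notin> D \<Longrightarrow> F s = H0 s * s powi n 0"
    and X: "finite X" "X \<subseteq> D - {0}" "D \<inter> ball 0 (2 * r) \<subseteq> insert 0 X" and r: "r > 0"
    and s: "s \<notin> D" "norm s < r"
  shows "\<exists>L. s powi n 0 * exp (poly Q s) * (\<Prod>\<rho>\<in>X. weierstrass_factor m (s / \<rho>) powi n \<rho>) =
      F s * exp L \<and>
     norm L \<le> 2 * r ^ m * (\<Sum>\<^sub>\<infinity>\<rho>\<in>D - {0} - X. real_of_int \<bar>n \<rho>\<bar> / dist 0 \<rho> ^ Suc m) * r"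
proof -
  \<comment> \<open>the zero-free quotient of \<open>s - \<rho>\<close> by the Weierstrass factor\<close>
  define u where "u \<rho> s = - \<rho> * exp (- (\<Sum>k=1..m. (s / \<rho>) ^ k / of_nat k))" for \<rho> s :: complex
  have ne0: "\<rho> \<noteq> 0" if "\<rho> \<in> X" for \<rho> using that X by auto
  have u0: "u \<rho> s \<noteq> 0" if "\<rho> \<in> X" for \<rho> s using ne0[OF that] by (simp add: u_def)
  have uE: "s - \<rho> = u \<rho> s * weierstrass_factor m (s / \<rho>)" if "\<rho> \<in> X" for \<rho> s
  proof -
    have "u \<rho> s * weierstrass_factor m (s / \<rho>) =
        - \<rho> * (1 - s / \<rho>) * (exp (- (\<Sum>k=1..m. (s / \<rho>) ^ k / of_nat k)) * exp
        (\<Sum>k=1..m. (s / \<rho>) ^ k / of_nat k))"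
      by (simp add: u_def weierstrass_factor_def)
    also have "\<dots> = s - \<rho>" using ne0[OF that] by (simp add: exp_minus field_simps)
    finally show ?thesis by simp
  qed
  have ud: "(u \<rho> has_field_derivative u \<rho> s * (- (1 / \<rho>) * (\<Sum>i<m. (s / \<rho>) ^ i))) (at s)"
      if "\<rho> \<in> X" for \<rho> s
  proof -
    have "((\<lambda>s. (s / \<rho>) ^ k / of_nat k) has_field_derivative (1 / \<rho>) * (s / \<rho>) ^ (k - 1)) (at s)"
        if "k \<in> {1..m}" for k
    proof -
      have d: "((\<lambda>s. s / \<rho>) has_field_derivative 1 / \<rho>) (at s)"
        by (rule DERIV_cdivide[OF DERIV_ident])
      show ?thesis
        using DERIV_cdivide[OF DERIV_power[OF d, of k], of "of_nat k"] that by simp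
    qed
    hence "((\<lambda>s. \<Sum>k=1..m. (s / \<rho>) ^ k / of_nat k) has_field_derivative
        (\<Sum>k=1..m. (1 / \<rho>) * (s / \<rho>) ^ (k - 1))) (at s)"
      by (rule DERIV_sum)
    also have "(\<Sum>k=1..m. (1 / \<rho>) * (s / \<rho>) ^ (k - 1)) = (1 / \<rho>) * (\<Sum>i<m. (s / \<rho>) ^ i)"
      unfolding sum_distrib_left
      by (rule sum.reindex_bij_witness[of _ "\<lambda>i. i + 1" "\<lambda>k. k - 1"]) auto
    finally have "((\<lambda>s. \<Sum>k=1..m. (s / \<rho>) ^ k / of_nat k) has_field_derivative (1 / \<rho>) *
        (\<Sum>i<m. (s / \<rho>) ^ i)) (at s)" .
    from DERIV_cmult[OF DERIV_chain2[OF DERIV_exp DERIV_minus[OF this]], of "- \<rho>"]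
    show ?thesis unfolding u_def[abs_def] by (simp add: mult_ac)
  qed
  obtain H where H:
      "\<And>s. s \<in> insert 0 X \<or> s \<notin> D \<Longrightarrow> H analytic_on {s} \<and> H s \<noteq> 0"
      "\<And>s. F analytic_on {s} \<Longrightarrow> H analytic_on {s}"
      "\<And>s. s \<notin> D \<Longrightarrow> F s = H s * (\<Prod>\<rho>\<in>insert 0 X. (s - \<rho>) powi n \<rho>)"
      "\<And>s. F analytic_on {s} \<Longrightarrow> s \<notin> insert 0 X \<Longrightarrow> F s = H s * (\<Prod>\<rho>\<in>insert 0 X. (s - \<rho>) powi n \<rho>)"
    using factor_divisor[OF mero ex, of "insert 0 X"] X(1) by blast
  have FH: "F s = H s * s powi n 0 * (\<Prod>\<rho>\<in>X. (s - \<rho>) powi n \<rho>)" if "s \<notin> D" for s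
    using H(3)[OF that] X by (subst (asm) prod.insert) auto
  define rr where "rr s = H s * (\<Prod>\<rho>\<in>X. u \<rho> s powi n \<rho>) * exp (- poly Q s)" for s
  have FP: "F z = rr z * (z powi n 0 * exp (poly Q z) *
      (\<Prod>\<rho>\<in>X. weierstrass_factor m (z / \<rho>) powi n \<rho>))" if "z \<notin> D" for z
  proof -
    have "(\<Prod>\<rho>\<in>X. (z - \<rho>) powi n \<rho>) = (\<Prod>\<rho>\<in>X. u \<rho> z powi n \<rho>) *
        (\<Prod>\<rho>\<in>X. weierstrass_factor m (z / \<rho>) powi n \<rho>)"
      unfolding prod.distrib[symmetric] by (intro prod.cong refl)
          (simp add: uE[symmetric] flip: power_int_mult_distrib)
    moreover have "exp (- poly Q z) * exp (poly Q z) = 1" by (simp flip: exp_add)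
    ultimately show ?thesis unfolding FH[OF that] rr_def by (simp add: mult_ac)
  qed
  have HB: "H analytic_on {z} \<and> H z \<noteq> 0" if "z \<in> ball 0 (2 * r)" for z
  proof (rule H(1))
    show "z \<in> insert 0 X \<or> z \<notin> D" using that X(3) by blast
  qed
  have sub: "ball 0 r \<subseteq> ball (0::complex) (2 * r)" using r by auto
  have Hh: "H holomorphic_on ball 0 r"
    by (rule analytic_imp_holomorphic, subst analytic_on_analytic_at) (use HB sub in auto)
  have rrnz: "rr z \<noteq> 0" if "z \<in> ball 0 r" for z
    using HB[of z] that sub u0 X(1) by (auto simp: rr_def)
  have uh: "u \<rho> holomorphic_on A" if "\<rho> \<in> X" for \<rho> A
    unfolding u_def using ne0[OF that] by (intro holomorphic_intros) auto
  have rrh: "rr holomorphic_on ball 0 r"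
    unfolding rr_def by (intro holomorphic_intros Hh uh) (use u0 in auto)
  \<comment> \<open>\<open>H0\<close> and \<open>H\<close> times the factors over \<open>X\<close> both extend \<open>F / s^(n_0)\<close> to the origin.\<close>
  have rr0: "rr 0 = 1"
  proof -
    define PX where "PX s = (\<Prod>\<rho>\<in>X. (s - \<rho>) powi n \<rho>)" for s
    define U where "U = - X"
    have U: "open U" "0 \<in> U" using X finite_imp_closed[OF X(1)] by (auto simp: U_def)
    have "norm (H0 0 - H 0 * PX 0) \<le> 0"
    proof (rule norm_le_off_divisor[OF mero, where f = "\<lambda>s. H0 s - H s * PX s", OF _ U])
      have "(\<lambda>s. H0 s - H s * PX s) analytic_on {0}"
        unfolding PX_def by (intro analytic_intros H0(1) analytic_on_prod)
            (use H(1)[of 0] ne0 in auto)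
      thus "isCont (\<lambda>s. H0 s - H s * PX s) 0" by (rule analytic_at_imp_isCont)
      fix z assume z: "z \<in> U" "z \<notin> D"
      have "z powi n 0 \<noteq> 0" using off_divisor_nonzero[OF mero ex z(2)] H0(3)[OF z(2)] by auto
      thus "norm (H0 z - H z * PX z) \<le> 0"
      proof -
        have e: "H0 z * z powi n 0 = (H z * PX z) * z powi n 0"
          using H0(3)[OF z(2)] FH[OF z(2)] unfolding PX_def by (simp only: mult_ac)
        from iffD1[OF mult_right_cancel[OF \<open>z powi n 0 \<noteq> 0\<close>] e]
        show ?thesis by simp
      qed
    qed
    hence "H0 0 = H 0 * PX 0" by simp
    moreover have "u \<rho> 0 = - \<rho>" for \<rho>
    proof -
      have "(\<Sum>k=1..m. (0 / \<rho>) ^ k / of_nat k) = 0" by (intro sum.neutral) auto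
      thus ?thesis by (simp add: u_def)
    qed
    ultimately have "rr 0 = exp (poly Q 0) * exp (- poly Q 0)"
      using H0(2) by (simp add: rr_def PX_def)
    thus ?thesis by (simp flip: exp_add)
  qed
  define \<epsilon> where "\<epsilon> = 2 * r ^ m * (\<Sum>\<^sub>\<infinity>\<rho>\<in>D - {0} - X. real_of_int \<bar>n \<rho>\<bar> / dist 0 \<rho> ^ Suc m)"
  have DX: "D - {0} - X = D - insert 0 X" by auto
  have ld_off: "norm (deriv rr z / rr z) \<le> \<epsilon>" if z: "z \<in> ball 0 r" "z \<notin> D" for z
  proof -
    have Ha: "H analytic_on {z}" "H z \<noteq> 0" using HB[of z] z sub by auto
    have Hd: "(H has_field_derivative H z * (deriv H z / H z)) (at z)"
      using analytic_derivI[OF Ha(1)] Ha(2) by simp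
    have Pd: "((\<lambda>s. \<Prod>\<rho>\<in>X. u \<rho> s powi n \<rho>) has_field_derivative
        (\<Prod>\<rho>\<in>X. u \<rho> z powi n \<rho>) * (\<Sum>\<rho>\<in>X. of_int (n \<rho>) * (- (1 / \<rho>) * (\<Sum>i<m. (z / \<rho>) ^ i)))) (at z)"
      by (intro logderiv_prod logderiv_powi ud u0)
    have Ed: "((\<lambda>s. exp (- poly Q s)) has_field_derivative exp (- poly Q z) * (- poly q z))
        (at z)"
      using DERIV_chain2[OF DERIV_exp DERIV_minus[OF poly_DERIV[of Q z]]] unfolding Q by simp
    have "(rr has_field_derivative rr z * (deriv H z / H z +
        (\<Sum>\<rho>\<in>X. of_int (n \<rho>) * (- (1 / \<rho>) * (\<Sum>i<m. (z / \<rho>) ^ i))) + (- poly q z))) (at z)"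
      unfolding rr_def[abs_def] by (intro logderiv_mult Hd Pd Ed)
    hence 1: "deriv rr z / rr z = deriv H z / H z +
        (\<Sum>\<rho>\<in>X. of_int (n \<rho>) * (- (1 / \<rho>) * (\<Sum>i<m. (z / \<rho>) ^ i))) + (- poly q z)"
      using rrnz[OF z(1)] by (simp add: DERIV_imp_deriv)
    have 2: "poly q z + kern_sum F 0 m z = deriv H z / H z +
        (\<Sum>\<rho>\<in>insert 0 X. of_int (n \<rho>) / (z - \<rho>))"
      unfolding q[OF z(2), symmetric] by (rule logderiv_factor[OF mero ex z(2) H(3) Ha(1)])
    have 3: "(\<Sum>\<rho>\<in>insert 0 X. of_int (n \<rho>) / (z - \<rho>)) =
        of_int (n 0) * kern 0 m 0 z + (\<Sum>\<rho>\<in>X. of_int (n \<rho>) / (z - \<rho>))"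
      using X by (subst sum.insert) (auto simp: kern_def)
    have 4: "(\<Sum>\<rho>\<in>X. of_int (n \<rho>) * kern 0 m \<rho> z) =
        (\<Sum>\<rho>\<in>X. of_int (n \<rho>) / (z - \<rho>)) - (\<Sum>\<rho>\<in>X. of_int (n \<rho>) * (- (1 / \<rho>) * (\<Sum>i<m. (z / \<rho>) ^ i)))"
      unfolding sum_subtractf[symmetric]
    proof (intro sum.cong refl)
      fix \<rho> assume "\<rho> \<in> X"
      hence "\<rho> \<noteq> 0" "z \<noteq> \<rho>" using ne0 X z by auto
      from kern_eq[OF this] show "of_int (n \<rho>) * kern 0 m \<rho> z =
         of_int (n \<rho>) / (z - \<rho>) - of_int (n \<rho>) * (- (1 / \<rho>) * (\<Sum>i<m. (z / \<rho>) ^ i))"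
        by (simp add: algebra_simps)
    qed
    have 5: "kern_sum F 0 m z = of_int (n 0) * kern 0 m 0 z + (\<Sum>\<rho>\<in>X. of_int (n \<rho>) * kern 0 m \<rho> z)
        +
        (\<Sum>\<^sub>\<infinity>\<rho>\<in>D - insert 0 X. of_int (n \<rho>) * kern 0 m \<rho> z)"
    proof (cases "0 \<in> D")
      case True
      have "kern_sum F 0 m z = (\<Sum>\<rho>\<in>insert 0 X. of_int (n \<rho>) * kern 0 m \<rho> z) +
        (\<Sum>\<^sub>\<infinity>\<rho>\<in>D - insert 0 X. of_int (n \<rho>) * kern 0 m \<rho> z)"
        by (rule kern_sum_split[OF w]) (use X True in auto)
      thus ?thesis using X by (subst (asm) sum.insert) auto
    next
      case False
      hence "D - insert 0 X = D - X" by auto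
      moreover have "kern_sum F 0 m z = (\<Sum>\<rho>\<in>X. of_int (n \<rho>) * kern 0 m \<rho> z) +
        (\<Sum>\<^sub>\<infinity>\<rho>\<in>D - X. of_int (n \<rho>) * kern 0 m \<rho> z)"
        by (rule kern_sum_split[OF w]) (use X in auto)
      ultimately show ?thesis using off_divisor_zorder[OF mero ex False] by simp
    qed
    have "deriv rr z / rr z = (\<Sum>\<^sub>\<infinity>\<rho>\<in>D - insert 0 X. of_int (n \<rho>) * kern 0 m \<rho> z)"
      using 2 unfolding 1 3 5 4 by (simp add: algebra_simps)
    also have "norm \<dots> \<le> \<epsilon>"
      unfolding \<epsilon>_def DX by (rule kern_tail_norm_le[OF w]) (use X z in auto)
    finally show ?thesis .
  qed
  have ld: "norm (deriv rr z / rr z) \<le> \<epsilon>" if z: "z \<in> ball 0 r" for z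
  proof (rule norm_le_off_divisor[OF mero, where f =
      "\<lambda>z. deriv rr z / rr z", OF _ open_ball z ld_off])
    have "(\<lambda>z. deriv rr z / rr z) holomorphic_on ball 0 r"
      by (intro holomorphic_intros rrh rrnz) auto
    thus "isCont (\<lambda>z. deriv rr z / rr z) z"
      using z holomorphic_on_imp_continuous_on continuous_on_eq_continuous_at open_ball by blast
  qed
  obtain L where L: "L holomorphic_on ball 0 r" "\<And>z. z \<in> ball 0 r \<Longrightarrow> rr z = rr 0 * exp (L z)"
      "L 0 = 0"
    "\<And>z. z \<in> ball 0 r \<Longrightarrow> (L has_field_derivative deriv rr z / rr z) (at z)"
    using holomorphic_log_on_ball[OF rrh rrnz r] by blast
  have sb: "s \<in> ball 0 r" using s by simp
  have "norm (L s - L 0) \<le> \<epsilon> * norm (s - 0)"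
    by (rule field_differentiable_bound[OF convex_ball[of 0 r]
        has_field_derivative_at_within[OF L(4)] ld sb]) (use r in auto)
  moreover have "\<epsilon> \<ge> 0" unfolding \<epsilon>_def using r by (intro mult_nonneg_nonneg infsum_nonneg) auto
  hence "\<epsilon> * norm (s - 0) \<le> \<epsilon> * r" using s by (intro mult_left_mono) auto
  ultimately have "norm (- L s) \<le> \<epsilon> * r" using L(3) by simp
  moreover have "s powi n 0 * exp (poly Q s) * (\<Prod>\<rho>\<in>X. weierstrass_factor m (s / \<rho>) powi n \<rho>) =
      F s * exp (- L s)"
    unfolding FP[OF s(1)] L(2)[OF sb] rr0 by (simp add: exp_minus)
  ultimately show ?thesis unfolding \<epsilon>_def by blast
qed

text \<open>
The free additive constant of \<open>Q\<close> is fixed by the value at the origin of \<open>F\<close> divided by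
\<open>s^(n_0)\<close>.
\<close>

lemma hadamard_poly_exists:
  assumes ce: "conv_exponent F = Suc m" and w: "weight_summable 0 (Suc m)"
    and q: "\<And>s. s \<notin> D \<Longrightarrow> deriv F s / F s = poly q s + kern_sum F 0 m s"
  obtains Q where "pderiv Q = q" "is_hadamard_poly F Q"
proof -
  obtain H0 where H0:
      "\<And>s. s \<in> {0} \<or> s \<notin> D \<Longrightarrow> H0 analytic_on {s} \<and> H0 s \<noteq> 0"
      "\<And>s. F analytic_on {s} \<Longrightarrow> H0 analytic_on {s}"
      "\<And>s. s \<notin> D \<Longrightarrow> F s = H0 s * (\<Prod>\<rho>\<in>{0}. (s - \<rho>) powi n \<rho>)"
      "\<And>s. F analytic_on {s} \<Longrightarrow> s \<notin> {0} \<Longrightarrow> F s = H0 s * (\<Prod>\<rho>\<in>{0}. (s - \<rho>) powi n \<rho>)"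
    using factor_divisor[OF mero ex, of "{0}"] by blast
  obtain Q where Q: "pderiv Q = q" "poly Q 0 = Ln (H0 0)" by (rule poly_antiderivative)
  have "is_hadamard_poly F Q"
    unfolding is_hadamard_poly_def
  proof (intro allI impI)
    fix s assume s: "s \<notin> D"
    define r where "r = norm s + 1"
    have r: "r > 0" "norm s < r" unfolding r_def using norm_ge_zero[of s] by linarith+
    define X0 where "X0 = D \<inter> ball 0 (2 * r) - {0}"
    define f where "f \<rho> = real_of_int \<bar>n \<rho>\<bar> / dist 0 \<rho> ^ Suc m" for \<rho>
    define \<epsilon> where "\<epsilon> X = 2 * r ^ m * infsum f (D - {0} - X) * r" for X
    have fs: "f summable_on D - {0}" using w unfolding weight_summable_def f_def .
    show "((\<lambda>X. s powi n 0 * exp (poly Q s) *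
        (\<Prod>\<rho>\<in>X. weierstrass_factor (conv_exponent F - 1) (s / \<rho>) powi n \<rho>)) \<longlongrightarrow> F s)
       (finite_subsets_at_top (D - {0}))"
    proof (rule tendsto_of_exp_error)
      have fX0: "finite X0" "X0 \<subseteq> D - {0}" unfolding X0_def
          by (auto intro: finite_subset[OF _ bounded_fin[of "ball 0 (2 * r)"]])
      have "eventually (\<lambda>X. finite X \<and> X0 \<subseteq> X \<and> X \<subseteq> D - {0}) (finite_subsets_at_top (D - {0}))"
        using fX0 by (auto simp: eventually_finite_subsets_at_top)
      thus "eventually (\<lambda>X. \<exists>L. s powi n 0 * exp (poly Q s) *
          (\<Prod>\<rho>\<in>X. weierstrass_factor (conv_exponent F - 1) (s / \<rho>) powi n \<rho>) = F s * exp L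
          \<and> norm L \<le> \<epsilon> X) (finite_subsets_at_top (D - {0}))"
      proof eventually_elim
        case (elim X)
        show ?case unfolding ce diff_Suc_1 \<epsilon>_def f_def
          by (rule partial_product_ratio[OF w q Q(1), where ?H0.0 = H0])
             (use H0(1)[of 0] H0(3) Q(2) elim s r in \<open>auto simp: X0_def\<close>)
      qed
      have "((\<lambda>X. infsum f (D - {0}) - sum f X) \<longlongrightarrow> infsum f (D - {0}) - infsum f (D - {0}))
          (finite_subsets_at_top (D - {0}))"
        using has_sum_infsum[OF fs] unfolding has_sum_def by (intro tendsto_intros)
      moreover have "eventually (\<lambda>X. infsum f (D - {0}) - sum f X =
          infsum f (D - {0} - X)) (finite_subsets_at_top (D - {0}))"
      proof (rule eventually_finite_subsets_at_top_weakI)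
        fix X assume X: "finite X" "X \<subseteq> D - {0}"
        have "infsum f (D - {0} - X) = infsum f (D - {0}) - infsum f X"
          by (rule infsum_Diff[OF fs summable_on_finite[OF X(1)] X(2)])
        thus "infsum f (D - {0}) - sum f X = infsum f (D - {0} - X)" using X by simp
      qed
      ultimately have "((\<lambda>X. infsum f (D - {0} - X)) \<longlongrightarrow> 0) (finite_subsets_at_top (D - {0}))"
        using Lim_transform_eventually by fastforce
      hence "((\<lambda>X. 2 * r ^ m * infsum f (D - {0} - X) * r) \<longlongrightarrow> 2 * r ^ m * 0 * r)
          (finite_subsets_at_top (D - {0}))"
        by (intro tendsto_intros)
      thus "(\<epsilon> \<longlongrightarrow> 0) (finite_subsets_at_top (D - {0}))" unfolding \<epsilon>_def by simp
    qed
  qed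
  thus ?thesis using that Q(1) by blast
qed

text \<open>
Two Hadamard polynomials differ by a polynomial \<open>R\<close> with \<open>exp R = 1\<close>, so \<open>R\<close> has derivative
zero.
\<close>

lemma hadamard_poly_unique:
  assumes "is_hadamard_poly F Q" "is_hadamard_poly F Q'"
  shows "pderiv Q = pderiv Q'"
proof -
  define R where "R = Q - Q'"
  have off: "exp (poly R s) = 1" if s: "s \<notin> D" for s
  proof -
    let ?P = "\<lambda>Q X. s powi n 0 * exp (poly Q s) *
        (\<Prod>\<rho>\<in>X. weierstrass_factor (conv_exponent F - 1) (s / \<rho>) powi n \<rho>)"
    have 1: "(?P Q \<longlongrightarrow> F s) (finite_subsets_at_top (D - {0}))"
        and 2: "(?P Q' \<longlongrightarrow> F s) (finite_subsets_at_top (D - {0}))"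
      using assms s unfolding is_hadamard_poly_def by blast+
    have "?P Q = (\<lambda>X. exp (poly R s) * ?P Q' X)"
      by (simp add: R_def exp_diff mult_ac)
    hence "(?P Q \<longlongrightarrow> exp (poly R s) * F s) (finite_subsets_at_top (D - {0}))"
      using tendsto_mult_left[OF 2, of "exp (poly R s)"] by simp
    from tendsto_unique[OF _ 1 this] have "F s = exp (poly R s) * F s" by simp
    thus ?thesis using off_divisor_nonzero[OF mero ex s] by simp
  qed
  have "norm (exp (poly R s) - 1) \<le> 0" for s
    by (rule norm_le_off_divisor[OF mero, where U = UNIV and f = "\<lambda>s. exp (poly R s) - 1"])
       (use off in auto)
  hence one: "(\<lambda>s. exp (poly R s)) = (\<lambda>s. 1)" by auto
  have "poly (pderiv R) s = 0" for s
  proof -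
    have "((\<lambda>s. exp (poly R s)) has_field_derivative exp (poly R s) * poly (pderiv R) s) (at s)"
      by (rule DERIV_chain2[OF DERIV_exp poly_DERIV])
    moreover have "((\<lambda>s. exp (poly R s)) has_field_derivative 0) (at s)" unfolding one by simp
    ultimately have "exp (poly R s) * poly (pderiv R) s = 0" by (rule DERIV_unique)
    thus ?thesis by simp
  qed
  hence "pderiv R = 0" using poly_all_0_iff_0 by blast
  thus ?thesis by (simp add: R_def pderiv_diff)
qed

lemma G_fun_eq_kern_sum:
  assumes ce: "conv_exponent F = Suc m" and w: "weight_summable 0 (Suc m)"
  shows "G_fun F s = kern_sum F (of_real (sigma1 F)) m s"
proof -
  define c where "c = complex_of_real (sigma1 F)"
  note w' = weight_summable_recentre[OF w, of c]
  have *: "(\<Sum>\<^sub>\<infinity>\<rho>\<in>D - {c}. of_int (n \<rho>) * ((s - c) ^ (conv_exponent F - 1) / (\<rho> - c) ^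
      (conv_exponent F - 1)) * (1 / (s - \<rho>))) =
        (\<Sum>\<^sub>\<infinity>\<rho>\<in>D - {c}. of_int (n \<rho>) * kern c m \<rho> s)"
    by (rule infsum_cong) (auto simp: ce kern_def power_divide)
  have "G_fun F s = of_int (mult_sigma1 F) / (s - c) +
      (\<Sum>\<^sub>\<infinity>\<rho>\<in>D - {c}. of_int (n \<rho>) * kern c m \<rho> s)"
    unfolding G_fun_def Let_def c_def[symmetric] * ..
  also have "\<dots> = kern_sum F c m s"
  proof (cases "c \<in> D")
    case True
    have "kern_sum F c m s = (\<Sum>\<rho>\<in>{c}. of_int (n \<rho>) * kern c m \<rho> s) +
        (\<Sum>\<^sub>\<infinity>\<rho>\<in>D - {c}. of_int (n \<rho>) * kern c m \<rho> s)"
      by (rule kern_sum_split[OF w']) (use True in auto)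
    thus ?thesis using True by (simp add: mult_sigma1_def c_def kern_def)
  next
    case False
    thus ?thesis by (simp add: mult_sigma1_def c_def[symmetric] kern_sum_def)
  qed
  finally show ?thesis unfolding c_def .
qed

text \<open>
\<open>G - f'/f\<close> is the difference of two Mittag-Leffler series, of degree at most \<open>d - 2\<close>, minus the
derivative of the Hadamard polynomial. Both have degree below the genus.
\<close>

lemma discrepancy_poly_spec:
  assumes fo: "meromorphic_finite_order F" and ce: "conv_exponent F = Suc m"
      and w: "weight_summable 0 (Suc m)"
  shows "deg_below (genus F) (discrepancy_poly F)"
    and "\<And>s. s \<notin> D \<Longrightarrow> poly (discrepancy_poly F) s = G_fun F s - deriv F s / F s"
proof -
  obtain q where q: "\<And>s. s \<notin> D \<Longrightarrow> deriv F s / F s = poly q s + kern_sum F 0 m s"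
    using logderiv_eq_poly[OF fo w] by blast
  obtain Q where Q: "pderiv Q = q" "is_hadamard_poly F Q"
    by (rule hadamard_poly_exists[OF ce w q], assumption, rule that)
  have "is_hadamard_poly F (hadamard_poly F)"
    unfolding hadamard_poly_def by (rule someI[of _ Q]) fact
  hence pq: "pderiv (hadamard_poly F) = q" using hadamard_poly_unique Q by blast
  have lq: "deg_below (degree (hadamard_poly F)) q"
    unfolding pq[symmetric] by (simp add: deg_below_def coeff_pderiv coeff_eq_0)
  obtain P where P: "deg_below m P" "\<And>s. s \<notin> D \<Longrightarrow>
      kern_sum F (of_real (sigma1 F)) m s - kern_sum F 0 m s = poly P s"
    by (rule kern_sum_recentre[OF w], rule that)
  have spec: "poly (P - q) s = G_fun F s - deriv F s / F s" if "s \<notin> D" for s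
    unfolding G_fun_eq_kern_sum[OF ce w] q[OF that] poly_diff P(2)[OF that, symmetric] by simp
  have eq: "discrepancy_poly F = P - q"
    unfolding discrepancy_poly_def
  proof (rule the_equality)
    show "P' = P - q" if "\<forall>s. s \<notin> D \<longrightarrow> poly P' s = G_fun F s - deriv F s / F s" for P'
      by (rule poly_eq_off_divisor) (use that spec in auto)
  qed (use spec in blast)
  show "deg_below (genus F) (discrepancy_poly F)"
    unfolding eq genus_def by (intro deg_below_diff deg_below_mono[OF P(1)] deg_below_mono[OF lq])
        (auto simp: ce)
  show "poly (discrepancy_poly F) s = G_fun F s - deriv F s / F s" if "s \<notin> D" for s
    unfolding eq by (rule spec[OF that])
qed

end

section \<open>Laplace integrals\<close>

text \<open>
This is the total mass of the Erlang distribution.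
\<close>

lemma exp_power_integral:
  fixes u :: real
  assumes "u > 0"
  shows "has_bochner_integral lborel (\<lambda>t. t ^ k / fact k * exp (- u * t) * indicator {0..} t)
      (1 / u ^ Suc k)"
proof -
  interpret prob_space "density lborel (erlang_density k u)"
    by (rule prob_space_erlang_density[OF assms])
  have "(\<integral>\<^sup>+ x. ennreal (erlang_density k u x) \<partial>lborel) = 1"
    using emeasure_space_1 by (simp add: emeasure_density)
  hence "has_bochner_integral lborel (erlang_density k u) 1"
    using assms by (intro has_bochner_integral_nn_integral) auto
  hence "has_bochner_integral lborel (\<lambda>t. 1 / u ^ Suc k * erlang_density k u t)
      (1 / u ^ Suc k * 1)"
    by (intro has_bochner_integral_mult_right)
  moreover have "(\<lambda>t. 1 / u ^ Suc k * erlang_density k u t) =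
      (\<lambda>t. t ^ k / fact k * exp (- u * t) * indicator {0..} t)"
    using assms by (intro ext) (auto simp: erlang_density_def indicator_def)
  ultimately show ?thesis by simp
qed

lemma exp_integral_complex:
  fixes z :: complex
  assumes "Re z > 0"
  shows "has_bochner_integral lborel (\<lambda>t. exp (- z * of_real t) * indicator {0..} t) (1 / z)"
proof -
  have z: "z \<noteq> 0" using assms by auto
  have int: "integrable lborel (\<lambda>t. exp (- z * of_real t) * indicator {0..} t)"
  proof (rule Bochner_Integration.integrable_bound)
    show "integrable lborel (\<lambda>t. t ^ 0 / fact 0 * exp (- Re z * t) * indicator {0..} t)"
      using exp_power_integral[OF assms, of 0] by (simp only: has_bochner_integral_iff)
    show "(\<lambda>t. exp (- z * of_real t) * indicator {0..} t) \<in> borel_measurable lborel"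
      by measurable
    show "AE t in lborel. norm (exp (- z * of_real t) * indicator {0..} t :: complex) \<le>
        norm (t ^ 0 / fact 0 * exp (- Re z * t) * indicator {0..} t)"
      by (intro AE_I2) (auto simp: indicator_def)
  qed
  have "(\<integral>t. exp (- z * of_real t) * indicator {0..} t \<partial>lborel) =
      (\<integral>t. indicator {0<..} t *\<^sub>R exp (- z * of_real t) \<partial>lborel)"
  proof (rule integral_cong_AE)
    have "AE t in lborel. t \<noteq> (0::real)" by (rule AE_lborel_singleton)
    thus "AE t in lborel. exp (- z * of_real t) * indicator {0..} t =
        indicator {0<..} t *\<^sub>R exp (- z * of_real t)"
      by eventually_elim (auto simp: indicator_def)
  qed auto
  also have "\<dots> = (LBINT t=ereal 0..\<infinity>. exp (- z * of_real t))"
    unfolding zero_ereal_def[symmetric] interval_lebesgue_integral_0_infty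
        set_lebesgue_integral_def ..
  also have "\<dots> = 0 - (- 1 / z)"
  proof (rule interval_integral_FTC_integrable[where F = "\<lambda>t. - exp (- z * of_real t) / z"])
    show "ereal 0 < \<infinity>" by simp
    show "((\<lambda>t. - exp (- z * of_real t) / z) has_vector_derivative exp (- z * of_real t)) (at t)"
        for t
    proof -
      have "((\<lambda>w. - exp (- z * w) / z) has_field_derivative exp (- z * of_real t))
          (at (of_real t))"
        using z by (auto intro!: derivative_eq_intros)
      thus ?thesis by (rule has_vector_derivative_real_field)
    qed
    show "isCont (\<lambda>t. exp (- z * of_real t)) t" for t :: real by (intro continuous_intros)
    have "integrable lborel (\<lambda>t. indicator {0<..} t *\<^sub>R
        (exp (- z * of_real t) * indicator {0..} t))"
      by (rule integrable_mult_indicator[OF _ int]) auto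
    moreover have "(\<lambda>t. indicator {0<..} t *\<^sub>R (exp (- z * of_real t) * indicator {0..} t)) =
        (\<lambda>t. indicator {0<..} t *\<^sub>R exp (- z * of_real t))"
      by (auto simp: indicator_def fun_eq_iff)
    ultimately show "set_integrable lborel (einterval (ereal 0) \<infinity>) (\<lambda>t. exp (- z * of_real t))"
      by (simp add: set_integrable_def)
    have "((\<lambda>t. - exp (- z * of_real t) / z) \<longlongrightarrow> - exp (- z * of_real 0) / z) (at_right 0)"
      using z by (intro tendsto_intros)
    thus "(((\<lambda>t. - exp (- z * of_real t) / z) \<circ> real_of_ereal) \<longlongrightarrow> - 1 / z) (at_right (ereal 0))"
      by (simp add: ereal_tendsto_simps1)
    have "((\<lambda>t. exp (- Re z * t)) \<longlongrightarrow> 0) at_top" using assms by real_asymp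
    hence "((\<lambda>t. exp (- z * of_real t)) \<longlongrightarrow> 0) at_top"
      by (subst tendsto_norm_zero_iff[symmetric]) simp
    hence "((\<lambda>t. - exp (- z * of_real t) / z) \<longlongrightarrow> - 0 / z) at_top"
      using z by (intro tendsto_intros)
    thus "(((\<lambda>t. - exp (- z * of_real t) / z) \<circ> real_of_ereal) \<longlongrightarrow> 0) (at_left \<infinity>)"
      by (simp add: ereal_tendsto_simps1)
  qed
  finally show ?thesis using int by (simp add: has_bochner_integral_iff)
qed

text \<open>
Termwise integration for unordered sums with a majorant of the form \<open>m x * g t\<close>. The error after
a finite set of terms is at most the tail of \<open>m\<close> times the integral of \<open>g\<close>.
\<close>

lemma has_sum_integral_dominated:
  fixes f :: "'a \<Rightarrow> 'b \<Rightarrow> complex"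
  assumes M: "m summable_on A" and g: "integrable N g"
    and bd: "\<And>x t. x \<in> A \<Longrightarrow> norm (f x t) \<le> m x * g t"
    and meas: "\<And>x. x \<in> A \<Longrightarrow> f x \<in> borel_measurable N" "(\<lambda>t. \<Sum>\<^sub>\<infinity>x\<in>A. f x t) \<in> borel_measurable N"
    and gnn: "\<And>t. g t \<ge> 0" and mnn: "\<And>x. x \<in> A \<Longrightarrow> m x \<ge> 0"
  shows "((\<lambda>x. \<integral>t. f x t \<partial>N) has_sum (\<integral>t. (\<Sum>\<^sub>\<infinity>x\<in>A. f x t) \<partial>N)) A"
    and "integrable N (\<lambda>t. \<Sum>\<^sub>\<infinity>x\<in>A. f x t)"
proof -
  have mg: "(\<lambda>x. m x * g t) summable_on A" for t by (intro summable_on_cmult_left M)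
  have nf: "(\<lambda>x. norm (f x t)) summable_on A" for t
    by (rule Infinite_Sum.abs_summable_on_comparison_test'[OF mg bd])
  have fs: "(\<lambda>x. f x t) summable_on A" for t by (rule abs_summable_summable[OF nf])
  have fi: "integrable N (f x)" if "x \<in> A" for x
    by (rule Bochner_Integration.integrable_bound[OF integrable_mult_right[OF g, of "m x"]
        meas(1)[OF that]])
       (use bd[OF that] gnn mnn[OF that] in \<open>auto simp: abs_mult\<close>)
  have tail: "norm (\<Sum>\<^sub>\<infinity>x\<in>A - X. f x t) \<le> (\<Sum>\<^sub>\<infinity>x\<in>A - X. m x) * g t" for X t
  proof -
    have "norm (\<Sum>\<^sub>\<infinity>x\<in>A - X. f x t) \<le> (\<Sum>\<^sub>\<infinity>x\<in>A - X. norm (f x t))"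
      by (rule norm_infsum_bound) (rule summable_on_subset_banach[OF nf], auto)
    also have "\<dots> \<le> (\<Sum>\<^sub>\<infinity>x\<in>A - X. m x * g t)"
      by (rule infsum_mono) (auto intro: summable_on_subset_banach[OF nf]
          summable_on_subset_banach[OF mg] bd)
    also have "\<dots> = (\<Sum>\<^sub>\<infinity>x\<in>A - X. m x) * g t" by (rule infsum_cmult_left')
    finally show ?thesis .
  qed
  show I: "integrable N (\<lambda>t. \<Sum>\<^sub>\<infinity>x\<in>A. f x t)"
    by (rule Bochner_Integration.integrable_bound[OF integrable_mult_right[OF g, of "infsum m A"]
        meas(2)])
       (use tail[where X = "{}"] gnn infsum_nonneg[of A m] mnn in \<open>auto simp: abs_mult\<close>)
  have "((\<lambda>X. (\<Sum>x\<in>X. \<integral>t. f x t \<partial>N) - (\<integral>t. (\<Sum>\<^sub>\<infinity>x\<in>A. f x t) \<partial>N)) \<longlongrightarrow> 0) (finite_subsets_at_top A)"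
  proof (rule Lim_null_comparison)
    show "eventually (\<lambda>X. norm ((\<Sum>x\<in>X. \<integral>t. f x t \<partial>N) - (\<integral>t. (\<Sum>\<^sub>\<infinity>x\<in>A. f x t) \<partial>N)) \<le>
             (infsum m A - sum m X) * (\<integral>t. g t \<partial>N)) (finite_subsets_at_top A)"
    proof (rule eventually_finite_subsets_at_top_weakI)
      fix X assume X: "finite X" "X \<subseteq> A"
      have eq: "(\<Sum>\<^sub>\<infinity>x\<in>A. f x t) - (\<Sum>x\<in>X. f x t) = (\<Sum>\<^sub>\<infinity>x\<in>A - X. f x t)" for t
        using infsum_Diff[OF fs[of t] summable_on_finite[OF X(1)] X(2)] X by simp
      have m: "infsum m A - sum m X = (\<Sum>\<^sub>\<infinity>x\<in>A - X. m x)"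
        using infsum_Diff[OF M summable_on_finite[OF X(1)] X(2)] X by simp
      have "(\<Sum>x\<in>X. \<integral>t. f x t \<partial>N) = (\<integral>t. (\<Sum>x\<in>X. f x t) \<partial>N)"
        by (rule Bochner_Integration.integral_sum[symmetric]) (use fi X in auto)
      hence "norm ((\<Sum>x\<in>X. \<integral>t. f x t \<partial>N) - (\<integral>t. (\<Sum>\<^sub>\<infinity>x\<in>A. f x t) \<partial>N)) =
            norm ((\<integral>t. (\<Sum>\<^sub>\<infinity>x\<in>A. f x t) \<partial>N) - (\<integral>t. (\<Sum>x\<in>X. f x t) \<partial>N))"
        by (simp add: norm_minus_commute)
      also have "\<dots> = norm (\<integral>t. (\<Sum>\<^sub>\<infinity>x\<in>A - X. f x t) \<partial>N)"
        by (subst Bochner_Integration.integral_diff[symmetric])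
            (use I fi X eq in \<open>auto intro!: Bochner_Integration.integrable_sum\<close>)
      also have "\<dots> \<le> (\<integral>t. (\<Sum>\<^sub>\<infinity>x\<in>A - X. m x) * g t \<partial>N)"
      proof -
        have i: "integrable N (\<lambda>t. \<Sum>\<^sub>\<infinity>x\<in>A - X. f x t)"
          unfolding eq[symmetric] using X
          by (intro Bochner_Integration.integrable_diff Bochner_Integration.integrable_sum I fi)
              auto
        have "norm (\<integral>t. (\<Sum>\<^sub>\<infinity>x\<in>A - X. f x t) \<partial>N) \<le> (\<integral>t. norm (\<Sum>\<^sub>\<infinity>x\<in>A - X. f x t) \<partial>N)"
          by (rule integral_norm_bound)
        also have "\<dots> \<le> (\<integral>t. (\<Sum>\<^sub>\<infinity>x\<in>A - X. m x) * g t \<partial>N)"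
          by (intro integral_mono integrable_norm i integrable_mult_right g tail)
        finally show ?thesis .
      qed
      also have "\<dots> = (infsum m A - sum m X) * (\<integral>t. g t \<partial>N)" by (simp add: m)
      finally show "norm ((\<Sum>x\<in>X. \<integral>t. f x t \<partial>N) - (\<integral>t. (\<Sum>\<^sub>\<infinity>x\<in>A. f x t) \<partial>N)) \<le>
             (infsum m A - sum m X) * (\<integral>t. g t \<partial>N)" .
    qed
    have "((\<lambda>X. (infsum m A - sum m X) * (\<integral>t. g t \<partial>N)) \<longlongrightarrow> (infsum m A - infsum m A) * (\<integral>t. g t \<partial>N))
        (finite_subsets_at_top A)"
      using has_sum_infsum[OF M] unfolding has_sum_def by (intro tendsto_intros)
    thus "((\<lambda>X. (infsum m A - sum m X) * (\<integral>t. g t \<partial>N)) \<longlongrightarrow> 0) (finite_subsets_at_top A)" by simp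
  qed
  thus "((\<lambda>x. \<integral>t. f x t \<partial>N) has_sum (\<integral>t. (\<Sum>\<^sub>\<infinity>x\<in>A. f x t) \<partial>N)) A"
    unfolding has_sum_def by (simp add: Lim_null[symmetric] LIM_zero_iff)
qed

lemma distr_deriv_funpow: "(distr_deriv ^^ k) T \<phi> = (- 1) ^ k * T ((vderiv ^^ k) \<phi>)"
proof (induction k arbitrary: \<phi>)
  case (Suc k)
  have "(distr_deriv ^^ Suc k) T \<phi> = - (distr_deriv ^^ k) T (vderiv \<phi>)"
    by (simp add: distr_deriv_def)
  also have "\<dots> = - ((- 1) ^ k * T ((vderiv ^^ Suc k) \<phi>))"
    unfolding Suc.IH vderiv_vderiv_funpow ..
  finally show ?case by simp
qed simp

section \<open>The Newton-Cramer distribution on exponentials\<close>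

text \<open>
The hypotheses under which \<open>K_d\<close> is bounded by a polynomial: the divisor lies in the closed
half-plane to the left of \<open>\<sigma>1\<close>, and \<open>d = m + 1\<close> is an exponent of convergence.
\<close>

locale left_divisor = divisor +
  fixes m :: nat
  assumes ce: "conv_exponent F = Suc m" and w: "weight_summable 0 (Suc m)"
    and re: "\<And>\<rho>. \<rho> \<in> divisor_support F \<Longrightarrow> Re \<rho> \<le> sigma1 F"
begin

abbreviation "\<sigma>1 \<equiv> sigma1 F"
abbreviation "c \<equiv> complex_of_real (sigma1 F)"
abbreviation "d \<equiv> Suc m"

definition weight :: "complex \<Rightarrow> real" where
  "weight \<rho> = real_of_int \<bar>n \<rho>\<bar> / dist c \<rho> ^ d"

text \<open>
The term of \<open>\<rho>\<close> in \<open>K_d(t) - K_d(0)\<close>.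
\<close>

definition kterm :: "complex \<Rightarrow> real \<Rightarrow> complex" where
  "kterm \<rho> t = of_int (n \<rho>) / (\<rho> - c) ^ d * (exp ((\<rho> - c) * of_real t) - 1)"

definition kdiff :: "real \<Rightarrow> complex" where
  "kdiff t = (K_fun F t - K_fun F 0) * indicator {0..} t"

lemma weight_sum: "weight summable_on D - {c}"
  using weight_summable_recentre[OF w, of c] unfolding weight_summable_def weight_def .

lemma weight_nonneg: "weight \<rho> \<ge> 0" by (simp add: weight_def)

lemma norm_coeff: "norm (of_int (n \<rho>) / (\<rho> - c) ^ d) = weight \<rho>"
  by (simp add: weight_def norm_divide norm_power dist_norm norm_minus_commute norm_mult)

lemma norm_exp_le: "\<rho> \<in> D \<Longrightarrow> t \<ge> 0 \<Longrightarrow> norm (exp ((\<rho> - c) * of_real t)) \<le> 1"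
  using re[of \<rho>] by (simp add: mult_nonpos_nonneg)

lemma kterm_le: "\<rho> \<in> D - {c} \<Longrightarrow> t \<ge> 0 \<Longrightarrow> norm (kterm \<rho> t) \<le> 2 * weight \<rho>"
proof -
  assume a: "\<rho> \<in> D - {c}" "t \<ge> 0"
  have "norm (exp ((\<rho> - c) * of_real t) - 1) \<le>
      norm (exp ((\<rho> - c) * of_real t)) + norm (1::complex)"
    by (rule norm_triangle_ineq4)
  also have "\<dots> \<le> 2" using norm_exp_le[of \<rho> t] a by simp
  finally have "weight \<rho> * norm (exp ((\<rho> - c) * of_real t) - 1) \<le> weight \<rho> * 2"
    by (intro mult_left_mono weight_nonneg)
  thus ?thesis unfolding kterm_def norm_mult norm_coeff by (simp add: mult.commute)
qed

lemma kterm_sum_continuous: "continuous_on {0..} (\<lambda>t. \<Sum>\<^sub>\<infinity>\<rho>\<in>D - {c}. kterm \<rho> t)"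
proof (rule uniform_limit_theorem)
  show "uniform_limit {0..} (\<lambda>X t. \<Sum>\<rho>\<in>X. kterm \<rho> t) (\<lambda>t. \<Sum>\<^sub>\<infinity>\<rho>\<in>D - {c}. kterm \<rho> t)
      (finite_subsets_at_top (D - {c}))"
    by (rule Weierstrass_m_test_general[OF kterm_le summable_on_cmult_right[OF weight_sum]]) auto
  show "\<forall>\<^sub>F X in finite_subsets_at_top (D - {c}). continuous_on {0..} (\<lambda>t. \<Sum>\<rho>\<in>X. kterm \<rho> t)"
    unfolding kterm_def by (intro always_eventually allI continuous_intros)
qed auto

lemma kdiff_eq:
  "kdiff t = (of_int (mult_sigma1 F) * of_real t ^ d / fact d + (\<Sum>\<^sub>\<infinity>\<rho>\<in>D - {c}. kterm \<rho> t)) *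
      indicator {0..} t"
proof (cases "t \<ge> 0")
  case True
  let ?v = "\<lambda>\<rho> t. of_int (n \<rho>) / (\<rho> - c) ^ d * exp ((\<rho> - c) * of_real t)"
  have sv: "(\<lambda>\<rho>. ?v \<rho> t) summable_on D - {c}" if "t \<ge> 0" for t
  proof (rule abs_summable_summable, rule Infinite_Sum.abs_summable_on_comparison_test'[OF
      weight_sum])
    fix \<rho> assume "\<rho> \<in> D - {c}"
    hence "weight \<rho> * norm (exp ((\<rho> - c) * of_real t)) \<le> weight \<rho> * 1"
      by (intro mult_left_mono norm_exp_le weight_nonneg that) auto
    thus "norm (?v \<rho> t) \<le> weight \<rho>" unfolding norm_mult norm_coeff by simp
  qed
  have K: "K_fun F s = of_int (mult_sigma1 F) * of_real s ^ d / fact d + (\<Sum>\<^sub>\<infinity>\<rho>\<in>D - {c}. ?v \<rho> s)"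
      if "s \<ge> 0" for s
    using that by (simp add: K_fun_def Let_def ce)
  have "((\<lambda>\<rho>. ?v \<rho> t - ?v \<rho> 0) has_sum ((\<Sum>\<^sub>\<infinity>\<rho>\<in>D - {c}. ?v \<rho> t) - (\<Sum>\<^sub>\<infinity>\<rho>\<in>D - {c}. ?v \<rho> 0)))
      (D - {c})"
    by (intro has_sum_minus has_sum_infsum sv True) auto
  hence "(\<Sum>\<^sub>\<infinity>\<rho>\<in>D - {c}. ?v \<rho> t - ?v \<rho> 0) = (\<Sum>\<^sub>\<infinity>\<rho>\<in>D - {c}. ?v \<rho> t) - (\<Sum>\<^sub>\<infinity>\<rho>\<in>D - {c}. ?v \<rho> 0)"
    by (rule infsumI)
  moreover have "(\<lambda>\<rho>. ?v \<rho> t - ?v \<rho> 0) = (\<lambda>\<rho>. kterm \<rho> t)"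
    by (simp add: kterm_def fun_eq_iff right_diff_distrib)
  ultimately have S: "(\<Sum>\<^sub>\<infinity>\<rho>\<in>D - {c}. ?v \<rho> t) - (\<Sum>\<^sub>\<infinity>\<rho>\<in>D - {c}. ?v \<rho> 0) = (\<Sum>\<^sub>\<infinity>\<rho>\<in>D - {c}. kterm \<rho> t)"
    by simp
  show ?thesis using True K[OF True] K[of 0] S by (simp add: kdiff_def)
qed (simp add: kdiff_def)

lemma kdiff_measurable [measurable]: "kdiff \<in> borel_measurable borel"
proof -
  have "(\<lambda>t. indicator {0..} t *\<^sub>R (of_int (mult_sigma1 F) * of_real t ^ d / fact d +
      (\<Sum>\<^sub>\<infinity>\<rho>\<in>D - {c}. kterm \<rho> t))) \<in> borel_measurable borel"
    by (intro borel_measurable_continuous_on_indicator continuous_intros kterm_sum_continuous)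
        (auto simp del: fact_Suc)
  also have "(\<lambda>t. indicator {0..} t *\<^sub>R (of_int (mult_sigma1 F) * of_real t ^ d / fact d +
      (\<Sum>\<^sub>\<infinity>\<rho>\<in>D - {c}. kterm \<rho> t))) = kdiff"
    by (auto simp: kdiff_eq fun_eq_iff indicator_def)
  finally show ?thesis .
qed

definition envelope :: "real \<Rightarrow> real" where
  "envelope t = (\<bar>real_of_int (mult_sigma1 F)\<bar> * t ^ d / fact d + 2 * infsum weight (D - {c})) *
      indicator {0..} t"

lemma envelope_nonneg: "envelope t \<ge> 0"
  by (auto simp: envelope_def indicator_def intro!: add_nonneg_nonneg infsum_nonneg weight_nonneg)

lemma kdiff_le: "norm (kdiff t) \<le> envelope t"
proof (cases "t \<ge> 0")
  case True
  have s2: "(\<lambda>\<rho>. 2 * weight \<rho>) summable_on D - {c}"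
      by (rule summable_on_cmult_right[OF weight_sum])
  have sk: "(\<lambda>\<rho>. norm (kterm \<rho> t)) summable_on D - {c}"
    by (rule Infinite_Sum.abs_summable_on_comparison_test'[OF s2 kterm_le]) (use True in auto)
  have "norm (\<Sum>\<^sub>\<infinity>\<rho>\<in>D - {c}. kterm \<rho> t) \<le> (\<Sum>\<^sub>\<infinity>\<rho>\<in>D - {c}. norm (kterm \<rho> t))"
    by (rule norm_infsum_bound[OF sk])
  also have "\<dots> \<le> (\<Sum>\<^sub>\<infinity>\<rho>\<in>D - {c}. 2 * weight \<rho>)"
    by (rule infsum_mono[OF sk s2]) (use True kterm_le in auto)
  also have "\<dots> = 2 * infsum weight (D - {c})" by (rule infsum_cmult_right')
  finally have 1: "norm (\<Sum>\<^sub>\<infinity>\<rho>\<in>D - {c}. kterm \<rho> t) \<le> 2 * infsum weight (D - {c})" .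
  have 2: "norm (of_int (mult_sigma1 F) * of_real t ^ d / fact d :: complex) =
      \<bar>real_of_int (mult_sigma1 F)\<bar> * t ^ d / fact d"
    using True by (simp add: norm_mult norm_divide norm_power del: fact_Suc power_Suc)
  have "norm (kdiff t) = norm (of_int (mult_sigma1 F) * of_real t ^ d / fact d +
      (\<Sum>\<^sub>\<infinity>\<rho>\<in>D - {c}. kterm \<rho> t))"
    using True by (simp add: kdiff_eq del: fact_Suc power_Suc)
  also have "\<dots> \<le> \<bar>real_of_int (mult_sigma1 F)\<bar> * t ^ d / fact d + 2 * infsum weight (D - {c})"
    unfolding 2[symmetric] by (rule order_trans[OF norm_triangle_ineq add_mono[OF order_refl 1]])
  finally show ?thesis using True by (simp add: envelope_def del: fact_Suc power_Suc)
qed (simp add: kdiff_def envelope_nonneg)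

lemma envelope_exp_integrable: "integrable lborel (\<lambda>t. envelope t * exp (- t))"
proof -
  have i: "integrable lborel (\<lambda>t::real. t ^ k / fact k * exp (- 1 * t) * indicator {0..} t)" for k
    using exp_power_integral[OF zero_less_one, of k] by (simp only: has_bochner_integral_iff)
  have "integrable lborel (\<lambda>t. \<bar>real_of_int (mult_sigma1 F)\<bar> *
      (t ^ d / fact d * exp (- 1 * t) * indicator {0..} t)
      + 2 * infsum weight (D - {c}) * (t ^ 0 / fact 0 * exp (- 1 * t) * indicator {0..} t))"
    by (intro Bochner_Integration.integrable_add integrable_mult_right i)
  also have "(\<lambda>t. \<bar>real_of_int (mult_sigma1 F)\<bar> *
      (t ^ d / fact d * exp (- 1 * t) * indicator {0..} t)
      + 2 * infsum weight (D - {c}) * (t ^ 0 / fact 0 * exp (- 1 * t) * indicator {0..} t)) =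
          (\<lambda>t. envelope t * exp (- t))"
    by (simp add: envelope_def fun_eq_iff indicator_def distrib_right)
  finally show ?thesis .
qed

lemma kdiff_integral:
  assumes h: "h \<in> borel_measurable borel" and B: "\<And>t. t \<ge> 0 \<Longrightarrow> norm (h t) \<le> B * exp (- t)"
  shows "integrable lborel (\<lambda>t. kdiff t * h t)"
    and "norm (\<integral>t. kdiff t * h t \<partial>lborel) \<le> B * (\<integral>t. envelope t * exp (- t) \<partial>lborel)"
proof -
  have le: "norm (kdiff t * h t) \<le> B * (envelope t * exp (- t))" for t
  proof (cases "t \<ge> 0")
    case True
    have "norm (kdiff t * h t) \<le> envelope t * (B * exp (- t))"
      unfolding norm_mult by (intro mult_mono kdiff_le B True envelope_nonneg) auto
    thus ?thesis by (simp add: mult_ac)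
  qed (simp add: kdiff_def envelope_def)
  have iB: "integrable lborel (\<lambda>t. B * (envelope t * exp (- t)))"
    by (rule integrable_mult_right[OF envelope_exp_integrable])
  show i: "integrable lborel (\<lambda>t. kdiff t * h t)"
  proof (rule Bochner_Integration.integrable_bound[OF iB])
    show "(\<lambda>t. kdiff t * h t) \<in> borel_measurable lborel" using h by measurable
    show "AE t in lborel. norm (kdiff t * h t) \<le> norm (B * (envelope t * exp (- t)))"
      by (intro AE_I2) (rule order_trans[OF le], simp)
  qed
  have "norm (\<integral>t. kdiff t * h t \<partial>lborel) \<le> (\<integral>t. norm (kdiff t * h t) \<partial>lborel)"
    by (rule integral_norm_bound)
  also have "\<dots> \<le> (\<integral>t. B * (envelope t * exp (- t)) \<partial>lborel)"
    by (intro integral_mono integrable_norm i iB le)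
  finally show "norm (\<integral>t. kdiff t * h t \<partial>lborel) \<le> B * (\<integral>t. envelope t * exp (- t) \<partial>lborel)"
      by simp
qed

text \<open>
Distributional differentiation and the factor \<open>e^(\<sigma>1 t)\<close>, moved to the test function.
\<close>

definition twist :: "(real \<Rightarrow> complex) \<Rightarrow> real \<Rightarrow> complex" where
  "twist f = (vderiv ^^ d) (\<lambda>t. of_real (exp (\<sigma>1 * t)) * f t)"

lemma newton_cramer_eq: "newton_cramer F f = (- 1) ^ d * (\<integral>t. kdiff t * twist f t \<partial>lborel)"
  unfolding newton_cramer_def distr_mult_def ce distr_deriv_funpow distr_of_fun_def kdiff_def
      twist_def ..

text \<open>
One unit of the decay rate, \<open>s \<ge> \<sigma>1 + 1\<close>, is reserved for the integrability of \<open>K_d\<close> against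
\<open>e^(-t)\<close>.
\<close>

lemma twist_le:
  assumes "smooth f" "s \<ge> \<sigma>1 + 1" "t \<ge> 0"
    and "\<And>j. j \<le> d \<Longrightarrow> norm ((vderiv ^^ j) f t) \<le> B * exp (- s * t)"
  shows "norm (twist f t) \<le> (1 + \<bar>\<sigma>1\<bar>) ^ d * B * exp (- t)"
proof -
  have "B * exp (- s * t) \<ge> 0" using order_trans[OF norm_ge_zero assms(4)[of 0]] by simp
  hence B: "B \<ge> 0" by (simp add: zero_le_mult_iff)
  have "norm (twist f t) \<le> (1 + \<bar>\<sigma>1\<bar>) ^ d * (B * exp (- s * t)) * exp (\<sigma>1 * t)"
    unfolding twist_def by (rule exp_mult_bound[OF assms(1,3,4)])
  also have "\<dots> = (1 + \<bar>\<sigma>1\<bar>) ^ d * B * exp ((\<sigma>1 - s) * t)"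
    by (simp add: left_diff_distrib exp_diff exp_minus field_simps)
  also have "\<dots> \<le> (1 + \<bar>\<sigma>1\<bar>) ^ d * B * exp (- t)"
    using assms(2,3) B mult_right_mono[of "\<sigma>1 - s" "-1" t] by (intro mult_left_mono) auto
  finally show ?thesis .
qed

lemma twist_measurable:
  assumes "smooth f"
  shows "twist f \<in> borel_measurable borel"
  unfolding twist_def
  by (intro borel_measurable_continuous_onI smooth_continuous smooth_exp_mult assms)

lemma newton_cramer_bound:
  assumes "rapid s f" "s \<ge> \<sigma>1 + 1"
    and "\<And>j t. j \<le> d \<Longrightarrow> t \<ge> 0 \<Longrightarrow> norm ((vderiv ^^ j) f t) \<le> B * exp (- s * t)"
  shows "norm (newton_cramer F f) \<le> (1 + \<bar>\<sigma>1\<bar>) ^ d * (\<integral>t. envelope t * exp (- t) \<partial>lborel) * B"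
proof -
  have sm: "smooth f" using assms(1) by (simp add: rapid_def)
  have "norm (\<integral>t. kdiff t * twist f t \<partial>lborel) \<le>
      ((1 + \<bar>\<sigma>1\<bar>) ^ d * B) * (\<integral>t. envelope t * exp (- t) \<partial>lborel)"
    by (rule kdiff_integral(2)[OF twist_measurable[OF sm] twist_le[OF sm assms(2) _ assms(3)]])
  thus ?thesis unfolding newton_cramer_eq norm_mult by (simp add: norm_power mult_ac)
qed

lemma newton_cramer_integrable:
  assumes "rapid s f" "s \<ge> \<sigma>1 + 1"
  shows "integrable lborel (\<lambda>t. kdiff t * twist f t)"
proof -
  have sm: "smooth f" using assms(1) by (simp add: rapid_def)
  obtain Kb where K: "\<And>j t. t \<ge> 0 \<Longrightarrow> norm ((vderiv ^^ j) f t) \<le> Kb j * exp (- s * t)"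
    using assms(1) unfolding rapid_def by metis
  define B where "B = (\<Sum>j\<le>d. \<bar>Kb j\<bar>)"
  have "norm ((vderiv ^^ j) f t) \<le> B * exp (- s * t)" if "j \<le> d" "t \<ge> 0" for j t
  proof -
    have "Kb j \<le> \<bar>Kb j\<bar>" by simp
    also have "\<dots> \<le> B" unfolding B_def by (rule member_le_sum) (use that in auto)
    finally show ?thesis using order_trans[OF K[OF that(2), of j]] by (simp add: mult_right_mono)
  qed
  from kdiff_integral(1)[OF twist_measurable[OF sm] twist_le[OF sm assms(2) _ this]] show ?thesis
      by blast
qed

lemma newton_cramer_lincomb:
  assumes f: "rapid s f" and g: "rapid s g" and s: "s \<ge> \<sigma>1 + 1"
  shows "newton_cramer F (\<lambda>t. a * f t + b * g t) = a * newton_cramer F f + b * newton_cramer F g"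
proof -
  have sm: "smooth f" "smooth g" using f g by (auto simp: rapid_def)
  have "(\<lambda>t. of_real (exp (\<sigma>1 * t)) * (a * f t + b * g t)) =
        (\<lambda>t. a * (of_real (exp (\<sigma>1 * t)) * f t) + b * (of_real (exp (\<sigma>1 * t)) * g t))"
    by (simp add: fun_eq_iff algebra_simps)
  hence "twist (\<lambda>t. a * f t + b * g t) = (\<lambda>t. a * twist f t + b * twist g t)"
    unfolding twist_def by (simp only: vderiv_lincomb[OF smooth_exp_mult[OF sm(1)]
        smooth_exp_mult[OF sm(2)]])
  hence "(\<integral>t. kdiff t * twist (\<lambda>t. a * f t + b * g t) t \<partial>lborel) =
         (\<integral>t. a * (kdiff t * twist f t) + b * (kdiff t * twist g t) \<partial>lborel)"
    by (simp add: algebra_simps)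
  also have "\<dots> = a * (\<integral>t. kdiff t * twist f t \<partial>lborel) + b * (\<integral>t. kdiff t * twist g t \<partial>lborel)"
    using newton_cramer_integrable[OF f s] newton_cramer_integrable[OF g s]
    by (subst Bochner_Integration.integral_add) auto
  finally show ?thesis unfolding newton_cramer_eq by (simp add: algebra_simps)
qed

text \<open>
On \<open>e^(-s t)\<close> the twist is \<open>(-u)^d e^(-u t)\<close> with \<open>u = s - \<sigma>1\<close>. The term of \<open>\<rho>\<close> integrates to
\<open>1 / (s - \<rho>) - 1 / u = (\<rho> - \<sigma>1) / (u (s - \<rho>))\<close> times its coefficient, and after multiplication
by \<open>u^d\<close> this is the term of \<open>\<rho>\<close> in \<open>G\<close>.
\<close>

lemma newton_cramer_exp:
  assumes s: "s > \<sigma>1"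
  shows "newton_cramer F (\<lambda>t. exp (- of_real s * of_real t)) = G_fun F (of_real s)"
proof -
  define u where "u = s - \<sigma>1"
  have u: "u > 0" using s by (simp add: u_def)
  let ?E = "\<lambda>t. exp (- of_real u * complex_of_real t)"
  have "(\<lambda>t. of_real (exp (\<sigma>1 * t)) * exp (- complex_of_real s * of_real t)) = ?E"
    by (simp add: fun_eq_iff u_def algebra_simps flip: exp_of_real exp_add)
  hence tw: "twist (\<lambda>t. exp (- of_real s * of_real t)) = (\<lambda>t. (- of_real u) ^ d * ?E t)"
    unfolding twist_def by (simp only: vderiv_exp)
  define e where "e t = ?E t * indicator {0..} t" for t
  have e: "e t = of_real (exp (- u * t) * indicator {0..} t)" for t
    by (auto simp: e_def indicator_def exp_of_real[symmetric])
  have em [measurable]: "e \<in> borel_measurable borel" unfolding e_def by measurable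
  have ei: "has_bochner_integral lborel (\<lambda>t. exp (- u * t) * indicator {0..} t) (1 / u)"
    using exp_power_integral[OF u, of 0] by simp
  have ei': "has_bochner_integral lborel e (1 / of_real u)"
    using exp_integral_complex[of "of_real u"] u by (simp add: e_def[abs_def])
  have kt: "has_bochner_integral lborel (\<lambda>t. kterm \<rho> t * e t)
      (of_int (n \<rho>) / (\<rho> - c) ^ d * (1 / (of_real s - \<rho>) - 1 / of_real u))" if "\<rho> \<in> D - {c}" for \<rho>
  proof -
    have "Re (of_real s - \<rho>) > 0" using re[of \<rho>] that s by simp
    from exp_integral_complex[OF this]
    have "has_bochner_integral lborel (\<lambda>t. exp (- (of_real s - \<rho>) * of_real t) * indicator {0..}
        t) (1 / (of_real s - \<rho>))" .
    moreover have "(\<lambda>t. exp (- (of_real s - \<rho>) * of_real t) * indicator {0..} t) =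
        (\<lambda>t. exp ((\<rho> - c) * of_real t) * e t)"
      by (auto simp: fun_eq_iff e_def u_def indicator_def algebra_simps simp flip: exp_add)
    ultimately have "has_bochner_integral lborel (\<lambda>t. exp ((\<rho> - c) * of_real t) * e t)
        (1 / (of_real s - \<rho>))" by simp
    hence "has_bochner_integral lborel (\<lambda>t. exp ((\<rho> - c) * of_real t) * e t - e t)
        (1 / (of_real s - \<rho>) - 1 / of_real u)"
      by (intro has_bochner_integral_diff ei')
    hence "has_bochner_integral lborel (\<lambda>t. of_int (n \<rho>) / (\<rho> - c) ^ d *
        (exp ((\<rho> - c) * of_real t) * e t - e t))
       (of_int (n \<rho>) / (\<rho> - c) ^ d * (1 / (of_real s - \<rho>) - 1 / of_real u))"
      by (intro has_bochner_integral_mult_right)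
    thus ?thesis by (simp add: kterm_def algebra_simps)
  qed
  have ks: "(\<Sum>\<^sub>\<infinity>\<rho>\<in>D - {c}. kterm \<rho> t * e t) = (\<Sum>\<^sub>\<infinity>\<rho>\<in>D - {c}. kterm \<rho> t) * e t" for t
    by (rule infsum_cmult_left')
  have meas: "(\<lambda>t. \<Sum>\<^sub>\<infinity>\<rho>\<in>D - {c}. kterm \<rho> t * e t) \<in> borel_measurable lborel"
  proof -
    have "(\<lambda>t. (indicator {0..} t *\<^sub>R (\<Sum>\<^sub>\<infinity>\<rho>\<in>D - {c}. kterm \<rho> t)) * e t) \<in> borel_measurable borel"
      by (intro borel_measurable_times borel_measurable_continuous_on_indicator
          kterm_sum_continuous em) auto
    also have "(\<lambda>t. (indicator {0..} t *\<^sub>R (\<Sum>\<^sub>\<infinity>\<rho>\<in>D - {c}. kterm \<rho> t)) * e t) =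
        (\<lambda>t. \<Sum>\<^sub>\<infinity>\<rho>\<in>D - {c}. kterm \<rho> t * e t)"
      unfolding ks by (auto simp: fun_eq_iff e_def indicator_def)
    finally show ?thesis by simp
  qed
  have le: "norm (kterm \<rho> t * e t) \<le> 2 * weight \<rho> * (exp (- u * t) * indicator {0..} t)"
      if "\<rho> \<in> D - {c}" for \<rho> t
  proof (cases "t \<ge> 0")
    case True
    have "norm (e t) = exp (- u * t) * indicator {0..} t" unfolding e
        by (simp only: norm_of_real) (simp add: indicator_def)
    thus ?thesis unfolding norm_mult using kterm_le[OF that True] by (simp add: mult_right_mono)
  qed (simp add: e_def)
  have km: "(\<lambda>t. kterm \<rho> t * e t) \<in> borel_measurable lborel" if "\<rho> \<in> D - {c}" for \<rho>
    unfolding kterm_def by measurable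
  have gi: "integrable lborel (\<lambda>t. exp (- u * t) * indicator {0..} t)" using ei
      by (simp only: has_bochner_integral_iff)
  have wn: "2 * weight \<rho> \<ge> 0" for \<rho> using weight_nonneg[of \<rho>] by simp
  note dom = has_sum_integral_dominated[OF summable_on_cmult_right[OF weight_sum, of 2] gi le km
      meas _ wn]
  have dom1: "((\<lambda>\<rho>. \<integral>t. kterm \<rho> t * e t \<partial>lborel) has_sum
      (\<integral>t. (\<Sum>\<^sub>\<infinity>\<rho>\<in>D - {c}. kterm \<rho> t * e t) \<partial>lborel)) (D - {c})"
    by (rule dom(1)) auto
  have dom2: "integrable lborel (\<lambda>t. \<Sum>\<^sub>\<infinity>\<rho>\<in>D - {c}. kterm \<rho> t * e t)"
    by (rule dom(2)) auto
  have "kdiff t * ?E t = of_int (mult_sigma1 F) * of_real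
      (t ^ d / fact d * exp (- u * t) * indicator {0..} t)
           + (\<Sum>\<^sub>\<infinity>\<rho>\<in>D - {c}. kterm \<rho> t * e t)" for t
    unfolding ks kdiff_eq by (auto simp: e_def indicator_def distrib_right exp_of_real[symmetric])
  hence "(\<integral>t. kdiff t * ?E t \<partial>lborel) =
     (\<integral>t. of_int (mult_sigma1 F) * of_real (t ^ d / fact d * exp (- u * t) * indicator {0..} t) +
         (\<Sum>\<^sub>\<infinity>\<rho>\<in>D - {c}. kterm \<rho> t * e t) \<partial>lborel)"
    by (simp only:)
  also have "\<dots> = of_int (mult_sigma1 F) * of_real (1 / u ^ Suc d) +
      (\<integral>t. (\<Sum>\<^sub>\<infinity>\<rho>\<in>D - {c}. kterm \<rho> t * e t) \<partial>lborel)"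
  proof (intro has_bochner_integral_integral_eq has_bochner_integral_add
      has_bochner_integral_mult_right has_bochner_integral_of_real)
    show "has_bochner_integral lborel (\<lambda>t. t ^ d / fact d * exp (- u * t) * indicator {0..} t)
        (1 / u ^ Suc d)"
      by (rule exp_power_integral[OF u])
    show "has_bochner_integral lborel (\<lambda>t. \<Sum>\<^sub>\<infinity>\<rho>\<in>D - {c}. kterm \<rho> t * e t)
        (\<integral>t. (\<Sum>\<^sub>\<infinity>\<rho>\<in>D - {c}. kterm \<rho> t * e t) \<partial>lborel)"
      using dom2 by (rule has_bochner_integral_integrable)
  qed
  also have "(\<integral>t. (\<Sum>\<^sub>\<infinity>\<rho>\<in>D - {c}. kterm \<rho> t * e t) \<partial>lborel) =
      (\<Sum>\<^sub>\<infinity>\<rho>\<in>D - {c}. of_int (n \<rho>) / (\<rho> - c) ^ d * (1 / (of_real s - \<rho>) - 1 / of_real u))"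
    unfolding infsumI[OF dom1, symmetric]
    by (rule infsum_cong) (rule has_bochner_integral_integral_eq[OF kt])
  finally have I: "(\<integral>t. kdiff t * ?E t \<partial>lborel) =
      of_int (mult_sigma1 F) * of_real (1 / u ^ Suc d) +
      (\<Sum>\<^sub>\<infinity>\<rho>\<in>D - {c}. of_int (n \<rho>) / (\<rho> - c) ^ d * (1 / (of_real s - \<rho>) - 1 / of_real u))" .
  have "newton_cramer F (\<lambda>t. exp (- of_real s * of_real t)) =
      (- 1) ^ d * ((- of_real u) ^ d * (\<integral>t. kdiff t * ?E t \<partial>lborel))"
  proof -
    have "(\<integral>t. kdiff t * ((- of_real u) ^ d * ?E t) \<partial>lborel) =
        (\<integral>t. (- of_real u) ^ d * (kdiff t * ?E t) \<partial>lborel)"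
      by (simp only: mult.left_commute)
    also have "\<dots> = (- of_real u) ^ d * (\<integral>t. kdiff t * ?E t \<partial>lborel)"
      by (rule integral_mult_right_zero)
    finally show ?thesis unfolding newton_cramer_eq tw by simp
  qed
  also have "\<dots> = of_real u ^ d * (\<integral>t. kdiff t * ?E t \<partial>lborel)"
    by (simp only: mult.assoc[symmetric] power_mult_distrib[symmetric]) simp
  also have "\<dots> = of_int (mult_sigma1 F) / of_real u +
      (\<Sum>\<^sub>\<infinity>\<rho>\<in>D - {c}. of_real u ^ d * (of_int (n \<rho>) / (\<rho> - c) ^ d *
      (1 / (of_real s - \<rho>) - 1 / of_real u)))"
    unfolding I distrib_left infsum_cmult_right' using u by simp
  also have "(\<Sum>\<^sub>\<infinity>\<rho>\<in>D - {c}. of_real u ^ d * (of_int (n \<rho>) / (\<rho> - c) ^ d *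
      (1 / (of_real s - \<rho>) - 1 / of_real u))) =
     (\<Sum>\<^sub>\<infinity>\<rho>\<in>D - {c}. of_int (n \<rho>) * ((of_real s - c) ^ m / (\<rho> - c) ^ m) * (1 / (of_real s - \<rho>)))"
  proof (rule infsum_cong)
    fix \<rho> assume \<rho>: "\<rho> \<in> D - {c}"
    define U where "U = complex_of_real u"
    define R where "R = \<rho> - c"
    have sU: "of_real s - \<rho> = U - R" "of_real s - c = U" by (auto simp: U_def R_def u_def)
    have ne: "U \<noteq> 0" "R \<noteq> 0" "U - R \<noteq> 0"
      using u \<rho> re[of \<rho>] s unfolding sU(1)[symmetric] by (auto simp: U_def R_def complex_eq_iff)
    have "1 / (U - R) - 1 / U = R / (U * (U - R))" using ne by (simp add: field_simps)
    thus "of_real u ^ d * (of_int (n \<rho>) / (\<rho> - c) ^ d * (1 / (of_real s - \<rho>) - 1 / of_real u)) =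
          of_int (n \<rho>) * ((of_real s - c) ^ m / (\<rho> - c) ^ m) * (1 / (of_real s - \<rho>))"
      unfolding sU unfolding U_def[symmetric] R_def[symmetric] using ne by simp
  qed
  also have "of_int (mult_sigma1 F) / of_real u + \<dots> = G_fun F (of_real s)"
    unfolding G_fun_def Let_def ce diff_Suc_1 by (simp add: u_def)
  finally show ?thesis .
qed

end

section \<open>Dirichlet series and the comparison of both sides\<close>

lemma finite_of_summable_ge_1:
  fixes f :: "'a \<Rightarrow> real"
  assumes "f summable_on A" "\<And>x. x \<in> A \<Longrightarrow> f x \<ge> 1"
  shows "finite A"
proof (rule ccontr)
  assume "infinite A"
  then obtain B where B: "B \<subseteq> A" "finite B" "card B = nat \<lceil>infsum f A\<rceil> + 1"
    using infinite_arbitrarily_large by blast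
  have "real (card B) = (\<Sum>x\<in>B. 1)" by simp
  also have "\<dots> \<le> sum f B" using B assms(2) by (intro sum_mono) auto
  also have "\<dots> \<le> infsum f A"
  proof (rule finite_sum_le_infsum[OF assms(1) B(2,1)])
    show "0 \<le> f x" if "x \<in> A - B" for x using assms(2)[of x] that by simp
  qed
  finally show False unfolding B(3) using real_nat_ceiling_ge[of "infsum f A"] by linarith
qed

lemma poly_zero_of_tendsto_zero:
  fixes p :: "complex poly"
  assumes "((\<lambda>t. poly p (of_real t)) \<longlongrightarrow> 0) at_top"
  shows "p = 0"
proof (cases "degree p = 0")
  case True
  then obtain c where c: "p = [:c:]" by (metis degree_eq_zeroE)
  have "((\<lambda>t::real. c) \<longlongrightarrow> 0) at_top" using assms by (simp add: c)
  hence "c = 0" by (simp add: tendsto_const_iff)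
  thus ?thesis by (simp add: c)
next
  case False
  have "filterlim (\<lambda>t. poly p (of_real t)) at_infinity at_top"
    by (rule filterlim_compose[OF filterlim_poly_at_infinity filterlim_of_real_at_infinity])
        (use False in auto)
  from not_tendsto_and_filterlim_at_infinity[OF _ assms this] show ?thesis by simp
qed

text \<open>
Split the exponential evenly among one linear factor and the remaining ones.
\<close>

lemma prod_linear_exp_tendsto_zero:
  assumes "finite X" "\<epsilon> > 0"
  shows "((\<lambda>t. (\<Prod>\<rho>\<in>X. (complex_of_real t - \<rho>)) * of_real (exp (- \<epsilon> * t))) \<longlongrightarrow> 0) at_top"
  using assms
proof (induction X arbitrary: \<epsilon> rule: finite_induct)
  case empty
  have "((\<lambda>t. exp (- \<epsilon> * t)) \<longlongrightarrow> 0) at_top" using empty by real_asymp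
  hence "((\<lambda>t. complex_of_real (exp (- \<epsilon> * t))) \<longlongrightarrow> of_real 0) at_top" by (rule tendsto_of_real)
  thus ?case by simp
next
  case (insert \<rho> X)
  have "((\<lambda>t. t * exp (- (\<epsilon> / 2) * t)) \<longlongrightarrow> 0) at_top" "((\<lambda>t. exp (- (\<epsilon> / 2) * t)) \<longlongrightarrow> 0) at_top"
    using insert.prems by real_asymp+
  hence "((\<lambda>t. of_real (t * exp (- (\<epsilon> / 2) * t)) - \<rho> * of_real (exp (- (\<epsilon> / 2) * t))) \<longlongrightarrow> of_real 0
      - \<rho> * of_real 0) at_top"
    by (intro tendsto_intros)
  hence 1: "((\<lambda>t. (of_real t - \<rho>) * of_real (exp (- (\<epsilon> / 2) * t))) \<longlongrightarrow> 0) at_top"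
    by (simp add: left_diff_distrib)
  have "((\<lambda>t. ((of_real t - \<rho>) * of_real (exp (- (\<epsilon> / 2) * t))) *
         ((\<Prod>\<rho>\<in>X. (complex_of_real t - \<rho>)) * of_real (exp (- (\<epsilon> / 2) * t)))) \<longlongrightarrow> 0 * 0) at_top"
    using insert.prems by (intro tendsto_mult 1 insert.IH) auto
  moreover have "((of_real t - \<rho>) * of_real (exp (- (\<epsilon> / 2) * t))) *
      ((\<Prod>\<rho>\<in>X. (complex_of_real t - \<rho>)) * of_real (exp (- (\<epsilon> / 2) * t))) =
       (\<Prod>\<rho>\<in>insert \<rho> X. (complex_of_real t - \<rho>)) * of_real (exp (- \<epsilon> * t))" for t
  proof -
    have "exp (- \<epsilon> * t) = exp (- (\<epsilon> / 2) * t) * exp (- (\<epsilon> / 2) * t)" by (simp flip: exp_add)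
    thus ?thesis using insert.hyps by (simp only: prod.insert[OF insert.hyps] of_real_mult
        mult_ac)
  qed
  ultimately show ?case by simp
qed

locale dirichlet_series =
  fixes I :: "nat set" and a :: "nat \<Rightarrow> complex" and l :: "nat \<Rightarrow> real"
    and F :: "complex \<Rightarrow> complex" and \<sigma> :: real
  assumes index: "(\<exists>N. I = {1..N}) \<or> (I = {1..} \<and> filterlim l at_top sequentially)"
    and pos: "\<And>n. n \<in> I \<Longrightarrow> 0 < l n"
    and mono: "strict_mono_on I l"
    and abs_conv: "(\<lambda>n. norm (a n) * exp (- l n * \<sigma>)) summable_on I"
    and series: "\<And>s. Re s > \<sigma> \<Longrightarrow> F s = 1 + (\<Sum>\<^sub>\<infinity>n\<in>I. a n * exp (- of_real (l n) * s))"
    and mero: "F nicely_meromorphic_on UNIV"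
    and finite_order: "meromorphic_finite_order F"
    and nonconstant: "\<not> F constant_on UNIV"
begin

lemma not_constant_half_plane: "\<not> F constant_on {s. Re s > r}"
proof
  assume c: "F constant_on {s. Re s > r}"
  have "of_real (r + 1) \<in> {s. Re s > r}" by simp
  hence "{s. Re s > r} \<noteq> {}" by blast
  hence "F constant_on UNIV"
    by (intro constant_on_extend_nicely_meromorphic_on[OF mero c open_halfspace_Re_gt]) auto
  thus False using nonconstant by simp
qed

lemma I_nonempty: "I \<noteq> {}"
proof
  assume "I = {}"
  hence "F constant_on {s. Re s > \<sigma>}" using series by (auto simp: constant_on_def)
  thus False using not_constant_half_plane by simp
qed

lemma one_in_I: "1 \<in> I" and I_ge_1: "k \<in> I \<Longrightarrow> k \<ge> 1"
  using index I_nonempty by auto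

lemma l1_pos: "l 1 > 0" using pos[OF one_in_I] .

lemma l_ge: "k \<in> I \<Longrightarrow> l 1 \<le> l k"
  using strict_mono_onD[OF mono one_in_I, of k] I_ge_1[of k] by (cases "k = 1") auto

definition dterm :: "complex \<Rightarrow> nat \<Rightarrow> complex" where
  "dterm s k = a k * exp (- of_real (l k) * s)"

definition wt :: "nat \<Rightarrow> real" where "wt k = norm (a k) * exp (- l k * \<sigma>)"

lemma wt_nonneg: "wt k \<ge> 0" by (simp add: wt_def)

lemma wt_summable: "wt summable_on I" using abs_conv unfolding wt_def .

lemma norm_dterm: "norm (dterm s k) = wt k * exp (- l k * (Re s - \<sigma>))"
  by (simp add: dterm_def wt_def norm_mult algebra_simps flip: exp_add)

lemma norm_dterm_le:
  assumes "k \<in> I" "Re s \<ge> \<sigma>"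
  shows "norm (dterm s k) \<le> wt k * exp (- l 1 * (Re s - \<sigma>))"
  unfolding norm_dterm using l_ge[OF assms(1)] assms(2)
  by (intro mult_left_mono) (auto simp: wt_nonneg mult_right_mono)

text \<open>
One unit of the real part absorbs the factor \<open>\<lambda>_k\<close>, since \<open>x e^(-x) \<le> 1\<close>.
\<close>

lemma norm_l_dterm_le:
  assumes "k \<in> I" "Re s \<ge> \<sigma> + 1"
  shows "norm (of_real (l k) * dterm s k) \<le> wt k * exp (- l 1 * (Re s - \<sigma> - 1))"
proof -
  have lk: "l k > 0" using pos assms by simp
  have "l k \<le> exp (l k)"
    using exp_ge_add_one_self[of "l k"] by linarith
  hence "l k * exp (- l k) \<le> 1"
    by (simp add: exp_minus field_simps)
  moreover have "exp (- l k * (Re s - \<sigma>)) = exp (- l k) * exp (- l k * (Re s - \<sigma> - 1))"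
    by (simp add: algebra_simps flip: exp_add)
  ultimately have "l k * exp (- l k * (Re s - \<sigma>)) \<le> 1 * exp (- l k * (Re s - \<sigma> - 1))"
    by (simp only: mult.assoc[symmetric]) (intro mult_right_mono, auto)
  also have "\<dots> \<le> exp (- l 1 * (Re s - \<sigma> - 1))"
    using l_ge[OF assms(1)] assms(2) by (simp add: mult_right_mono)
  finally have "wt k * (l k * exp (- l k * (Re s - \<sigma>))) \<le> wt k * exp (- l 1 * (Re s - \<sigma> - 1))"
    by (intro mult_left_mono wt_nonneg)
  thus ?thesis using lk by (simp add: norm_mult norm_dterm mult_ac)
qed

lemma dterm_summable:
  assumes "Re s \<ge> \<sigma>"
  shows "(\<lambda>k. norm (dterm s k)) summable_on I"
    "(\<Sum>\<^sub>\<infinity>k\<in>I. norm (dterm s k)) \<le> infsum wt I * exp (- l 1 * (Re s - \<sigma>))"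
proof -
  have s: "(\<lambda>k. wt k * exp (- l 1 * (Re s - \<sigma>))) summable_on I"
    by (rule summable_on_cmult_left[OF wt_summable])
  show 1: "(\<lambda>k. norm (dterm s k)) summable_on I"
    by (rule Infinite_Sum.abs_summable_on_comparison_test'[OF s norm_dterm_le[OF _ assms]])
  have "(\<Sum>\<^sub>\<infinity>k\<in>I. norm (dterm s k)) \<le> (\<Sum>\<^sub>\<infinity>k\<in>I. wt k * exp (- l 1 * (Re s - \<sigma>)))"
    by (rule infsum_mono[OF 1 s norm_dterm_le[OF _ assms]])
  thus "(\<Sum>\<^sub>\<infinity>k\<in>I. norm (dterm s k)) \<le> infsum wt I * exp (- l 1 * (Re s - \<sigma>))"
    by (simp only: infsum_cmult_left')
qed

lemma l_dterm_summable:
  assumes "Re s \<ge> \<sigma> + 1"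
  shows "(\<lambda>k. norm (of_real (l k) * dterm s k)) summable_on I"
    "(\<Sum>\<^sub>\<infinity>k\<in>I. norm (of_real (l k) * dterm s k)) \<le> infsum wt I * exp (- l 1 * (Re s - \<sigma> - 1))"
proof -
  have s: "(\<lambda>k. wt k * exp (- l 1 * (Re s - \<sigma> - 1))) summable_on I"
    by (rule summable_on_cmult_left[OF wt_summable])
  show 1: "(\<lambda>k. norm (of_real (l k) * dterm s k)) summable_on I"
    by (rule Infinite_Sum.abs_summable_on_comparison_test'[OF s norm_l_dterm_le[OF _ assms]])
  have "(\<Sum>\<^sub>\<infinity>k\<in>I. norm (of_real (l k) * dterm s k)) \<le>
      (\<Sum>\<^sub>\<infinity>k\<in>I. wt k * exp (- l 1 * (Re s - \<sigma> - 1)))"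
    by (rule infsum_mono[OF 1 s norm_l_dterm_le[OF _ assms]])
  thus "(\<Sum>\<^sub>\<infinity>k\<in>I. norm (of_real (l k) * dterm s k)) \<le> infsum wt I * exp (- l 1 * (Re s - \<sigma> - 1))"
    by (simp only: infsum_cmult_left')
qed

lemma F_deriv:
  assumes s: "Re s > \<sigma>"
  shows "(F has_field_derivative deriv F s) (at s)"
    and "((\<lambda>k. - of_real (l k) * dterm s k) has_sum deriv F s) I"
proof -
  define r where "r = (Re s - \<sigma>) / 2"
  have r: "r > 0" using s by (simp add: r_def)
  have Re: "Re w > \<sigma>" if "w \<in> cball s r" for w
  proof -
    have "Re (s - w) \<le> norm (s - w)" by (rule complex_Re_le_cmod)
    thus ?thesis using that r by (simp add: dist_norm r_def field_simps)
  qed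
  have "uniform_limit (cball s r) (\<lambda>X w. \<Sum>k\<in>X. dterm w k) (\<lambda>w. \<Sum>\<^sub>\<infinity>k\<in>I. dterm w k)
      (finite_subsets_at_top I)"
  proof (rule Weierstrass_m_test_general[OF _ wt_summable])
    fix k w assume k: "k \<in> I" and w: "w \<in> cball s r"
    have "norm (dterm w k) \<le> wt k * exp (- l 1 * (Re w - \<sigma>))"
      by (rule norm_dterm_le[OF k]) (use Re[OF w] in simp)
    also have "\<dots> \<le> wt k * 1"
      using Re[OF w] l1_pos by (intro mult_left_mono wt_nonneg) auto
    finally show "norm (dterm w k) \<le> wt k" by simp
  qed
  hence "uniform_limit (cball s r) (\<lambda>X w. 1 + (\<Sum>k\<in>X. dterm w k)) (\<lambda>w. 1 + (\<Sum>\<^sub>\<infinity>k\<in>I. dterm w k))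
      (finite_subsets_at_top I)"
    by (intro uniform_limit_intros)
  hence ul: "uniform_limit (cball s r) (\<lambda>X w. 1 + (\<Sum>k\<in>X. dterm w k)) F (finite_subsets_at_top I)"
    by (rule uniform_limit_cong'[THEN iffD1, rotated -1])
        (use Re series in \<open>auto simp: dterm_def\<close>)
  have dd: "((\<lambda>w. dterm w k) has_field_derivative - of_real (l k) * dterm w k) (at w)" for k w
    unfolding dterm_def by (auto intro!: derivative_eq_intros)
  have dX: "((\<lambda>w. 1 + (\<Sum>k\<in>X. dterm w k)) has_field_derivative (\<Sum>k\<in>X. - of_real (l k) * dterm w k))
      (at w)" for X w
  proof -
    have "((\<lambda>w. \<Sum>k\<in>X. dterm w k) has_field_derivative (\<Sum>k\<in>X. - of_real (l k) * dterm w k)) (at w)"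
      by (rule DERIV_sum) (rule dd)
    from DERIV_add[OF DERIV_const this, of 1] show ?thesis by simp
  qed
  obtain g' where g: "\<And>w. w \<in> ball s r \<Longrightarrow> (F has_field_derivative (g' w)) (at w) \<and>
      ((\<lambda>X. \<Sum>k\<in>X. - of_real (l k) * dterm w k) \<longlongrightarrow> g' w) (finite_subsets_at_top I)"
  proof (rule has_complex_derivative_uniform_limit[OF _ ul _ r])
    show "\<forall>\<^sub>F X in finite_subsets_at_top I. continuous_on (cball s r) (\<lambda>w. 1 + (\<Sum>k\<in>X. dterm w k))
        \<and>
       (\<forall>w\<in>ball s r. ((\<lambda>w. 1 + (\<Sum>k\<in>X. dterm w k)) has_field_derivative
           (\<Sum>k\<in>X. - of_real (l k) * dterm w k)) (at w))"
      using dX by (auto simp: dterm_def intro!: always_eventually continuous_intros)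
  qed (use that in auto)
  from g[of s] r have g: "(F has_field_derivative (g' s)) (at s)"
    "((\<lambda>X. \<Sum>k\<in>X. - of_real (l k) * dterm s k) \<longlongrightarrow> g' s) (finite_subsets_at_top I)" by auto
  have "deriv F s = g' s" using g(1) by (rule DERIV_imp_deriv)
  with g show "(F has_field_derivative deriv F s) (at s)"
      "((\<lambda>k. - of_real (l k) * dterm s k) has_sum deriv F s) I"
    by (simp_all add: has_sum_def)
qed

text \<open>
Chosen such that the series without its constant term has modulus at most \<open>1/2\<close> from here on.
\<close>

definition far_abscissa :: real where "far_abscissa = \<sigma> + 1 + ln (2 * infsum wt I + 1) / l 1"

lemma far_abscissa: "far_abscissa \<ge> \<sigma> + 1" "Re s \<ge> far_abscissa \<Longrightarrow>
    infsum wt I * exp (- l 1 * (Re s - \<sigma>)) \<le> 1 / 2"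
proof -
  define W where "W = infsum wt I"
  have W: "W \<ge> 0" unfolding W_def by (intro infsum_nonneg wt_nonneg)
  show "far_abscissa \<ge> \<sigma> + 1" using W l1_pos by (simp add: far_abscissa_def W_def[symmetric])
  assume s: "Re s \<ge> far_abscissa"
  have "ln (2 * W + 1) / l 1 \<le> Re s - \<sigma>" using s by (simp add: far_abscissa_def W_def)
  hence "ln (2 * W + 1) \<le> l 1 * (Re s - \<sigma>)" using l1_pos by (simp add: field_simps)
  hence "exp (- l 1 * (Re s - \<sigma>)) \<le> exp (- ln (2 * W + 1))" by simp
  also have "\<dots> = 1 / (2 * W + 1)" using W by (simp add: exp_minus inverse_eq_divide)
  finally have "W * exp (- l 1 * (Re s - \<sigma>)) \<le> W * (1 / (2 * W + 1))" using W
      by (rule mult_left_mono)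
  also have "\<dots> \<le> 1 / 2" using W by (simp add: field_simps)
  finally show "infsum wt I * exp (- l 1 * (Re s - \<sigma>)) \<le> 1 / 2" by (simp add: W_def)
qed

lemma F_series: "Re s > \<sigma> \<Longrightarrow> F s = 1 + (\<Sum>\<^sub>\<infinity>k\<in>I. dterm s k)"
  using series by (simp add: dterm_def)

lemma far_right:
  assumes s: "Re s \<ge> far_abscissa"
  shows "norm (F s) \<ge> 1 / 2" and "s \<notin> divisor_support F"
proof -
  have s\<sigma>: "Re s > \<sigma>" using s far_abscissa(1) by simp
  have "norm (\<Sum>\<^sub>\<infinity>k\<in>I. dterm s k) \<le> (\<Sum>\<^sub>\<infinity>k\<in>I. norm (dterm s k))"
    by (rule norm_infsum_bound) (use dterm_summable(1)[of s] s\<sigma> in simp)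
  also have "\<dots> \<le> 1 / 2" using dterm_summable(2)[of s] far_abscissa(2)[OF s] s\<sigma> by simp
  finally show half: "norm (F s) \<ge> 1 / 2"
    unfolding F_series[OF s\<sigma>] using norm_triangle_ineq2[of 1 "- (\<Sum>\<^sub>\<infinity>k\<in>I. dterm s k)"] by simp
  have hol: "F holomorphic_on {s. Re s > \<sigma>}"
    using F_deriv(1) open_halfspace_Re_gt[of \<sigma>] by (auto simp: holomorphic_on_open)
  have "F analytic_on {s}"
    using hol s\<sigma> open_halfspace_Re_gt[of \<sigma>] by (auto simp: analytic_at)
  moreover have "\<not> is_pole F s"
    by (rule not_is_pole_holomorphic[OF open_halfspace_Re_gt _ hol]) (use s\<sigma> in auto)
  ultimately show "s \<notin> divisor_support F"
    using zero_isolated_zero_analytic[of F s] half by (auto simp: divisor_support_def)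
qed

lemma logderiv_coeffs:
  assumes "s \<ge> far_abscissa"
  shows "((\<lambda>k. of_real (mindex_freq l k) * log_coeff a k * exp
      (- of_real s * of_real (mindex_freq l k)))
            has_sum deriv F (of_real s) / F (of_real s)) (mindices I)"
proof -
  have s: "Re (complex_of_real s) \<ge> \<sigma> + 1" "Re (complex_of_real s) > \<sigma>"
      using assms far_abscissa(1) by auto
  have "((\<lambda>k. of_real (mindex_freq l k) * log_coeff a k * exp
      (- of_real s * of_real (mindex_freq l k)))
     has_sum - (\<Sum>\<^sub>\<infinity>k\<in>I. of_real (l k) * dterm (of_real s) k) /
         (1 + (\<Sum>\<^sub>\<infinity>k\<in>I. dterm (of_real s) k))) (mindices I)"
    unfolding dterm_def
  proof (rule log_coeff_sum, unfold dterm_def[symmetric])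
    show "(\<lambda>k. norm (dterm (of_real s) k)) summable_on I" by (rule dterm_summable) (use s in simp)
    show "(\<lambda>k. norm (of_real (l k) * dterm (of_real s) k)) summable_on I"
        by (rule l_dterm_summable[OF s(1)])
    have "(\<Sum>\<^sub>\<infinity>k\<in>I. norm (dterm (of_real s) k)) \<le> 1 / 2"
      using dterm_summable(2)[of "of_real s"] far_abscissa(2)[of "of_real s"] assms s by simp
    thus "(\<Sum>\<^sub>\<infinity>k\<in>I. norm (dterm (of_real s) k)) < 1" by simp
  qed
  also have "1 + (\<Sum>\<^sub>\<infinity>k\<in>I. dterm (of_real s) k) = F (of_real s)" using F_series[OF s(2)] by simp
  also have "- (\<Sum>\<^sub>\<infinity>k\<in>I. of_real (l k) * dterm (of_real s) k) = deriv F (of_real s)"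
    using infsumI[OF F_deriv(2)[OF s(2)]] by (simp add: infsum_uminus)
  finally show ?thesis .
qed

lemma logderiv_decay:
  assumes "s \<ge> far_abscissa"
  shows "norm (deriv F (of_real s) / F (of_real s)) \<le> 2 * infsum wt I * exp (- l 1 * (s - \<sigma> - 1))"
proof -
  have s: "Re (complex_of_real s) \<ge> \<sigma> + 1" "Re (complex_of_real s) > \<sigma>"
      using assms far_abscissa(1) by auto
  have "norm (deriv F (of_real s)) = norm (\<Sum>\<^sub>\<infinity>k\<in>I. - of_real (l k) * dterm (of_real s) k)"
    using infsumI[OF F_deriv(2)[OF s(2)]] by simp
  also have "\<dots> \<le> (\<Sum>\<^sub>\<infinity>k\<in>I. norm (- of_real (l k) * dterm (of_real s) k))"
    by (rule norm_infsum_bound) (use l_dterm_summable(1)[OF s(1)] in simp)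
  also have "\<dots> \<le> infsum wt I * exp (- l 1 * (s - \<sigma> - 1))"
    using l_dterm_summable(2)[OF s(1)] by simp
  finally have "norm (deriv F (of_real s)) / norm (F (of_real s)) \<le>
      infsum wt I * exp (- l 1 * (s - \<sigma> - 1)) / (1 / 2)"
    using far_right(1)[of "of_real s"] assms
    by (intro frac_le) (auto intro!: mult_nonneg_nonneg infsum_nonneg wt_nonneg)
  thus ?thesis by (simp add: norm_divide)
qed

sublocale divisor F
proof
  show "F nicely_meromorphic_on UNIV" by (rule mero)
  show "\<exists>z. F z \<noteq> 0" using far_right(1)[of "of_real far_abscissa"]
      by (intro exI[of _ "of_real far_abscissa"]) auto
qed

text \<open>
For a finite divisor, \<open>f'/f\<close> times the product of the \<open>s - \<rho>\<close> is a polynomial; it tends to \<open>0\<close>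
along the positive real axis because \<open>f'/f\<close> decays exponentially there. So it is zero and \<open>f\<close> is
constant.
\<close>

lemma infinite_divisor: "infinite D"
proof
  assume fin: "finite D"
  have w: "weight_summable 0 (Suc 0)"
    unfolding weight_summable_def by (rule summable_on_finite) (use fin in auto)
  obtain q where q: "\<And>s. s \<notin> D \<Longrightarrow> deriv F s / F s = poly q s + kern_sum F 0 0 s"
    using logderiv_eq_poly[OF finite_order w] by blast
  have ks: "kern_sum F 0 0 s = (\<Sum>\<rho>\<in>D. of_int (n \<rho>) / (s - \<rho>))" for s
    unfolding kern_sum_def using fin by (auto simp: kern_def intro!: sum.cong)
  define p where "p = q * (\<Prod>\<rho>\<in>D. [:- \<rho>, 1:]) +
      (\<Sum>\<rho>\<in>D. smult (of_int (n \<rho>)) (\<Prod>\<tau>\<in>D - {\<rho>}. [:- \<tau>, 1:]))"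
  have p: "poly p s = (\<Prod>\<rho>\<in>D. (s - \<rho>)) * (deriv F s / F s)" if s: "s \<notin> D" for s
  proof -
    have "(\<Prod>\<rho>\<in>D. (s - \<rho>)) * (of_int (n \<rho>) / (s - \<rho>)) = of_int (n \<rho>) * (\<Prod>\<tau>\<in>D - {\<rho>}. (s - \<tau>))"
        if "\<rho> \<in> D" for \<rho>
      using s that fin by (subst prod.remove[of _ \<rho>]) auto
    hence "(\<Prod>\<rho>\<in>D. (s - \<rho>)) * (\<Sum>\<rho>\<in>D. of_int (n \<rho>) / (s - \<rho>)) =
        (\<Sum>\<rho>\<in>D. of_int (n \<rho>) * (\<Prod>\<tau>\<in>D - {\<rho>}. (s - \<tau>)))"
      unfolding sum_distrib_left by (intro sum.cong) auto
    thus ?thesis unfolding q[OF s] ks by (simp add: p_def poly_sum poly_prod distrib_left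
        mult.commute)
  qed
  have "((\<lambda>t. poly p (of_real t)) \<longlongrightarrow> 0) at_top"
  proof (rule Lim_null_comparison)
    define C where "C = 2 * infsum wt I * exp (l 1 * (\<sigma> + 1))"
    show "\<forall>\<^sub>F t in at_top. norm (poly p (of_real t)) \<le>
        C * norm ((\<Prod>\<rho>\<in>D. (complex_of_real t - \<rho>)) * of_real (exp (- l 1 * t)))"
      using eventually_ge_at_top[of far_abscissa]
    proof eventually_elim
      case (elim t)
      have "norm (poly p (of_real t)) = norm (\<Prod>\<rho>\<in>D. (complex_of_real t - \<rho>)) * norm
          (deriv F (of_real t) / F (of_real t))"
        using p[OF far_right(2)[of "of_real t"]] elim by (simp add: norm_mult norm_divide)
      also have "\<dots> \<le> norm (\<Prod>\<rho>\<in>D. (complex_of_real t - \<rho>)) *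
          (2 * infsum wt I * exp (- l 1 * (t - \<sigma> - 1)))"
        by (intro mult_left_mono logderiv_decay elim) auto
      also have "exp (- l 1 * (t - \<sigma> - 1)) = exp (l 1 * (\<sigma> + 1)) * exp (- l 1 * t)"
        by (simp add: algebra_simps flip: exp_add)
      finally show ?case by (simp add: C_def norm_mult mult_ac)
    qed
    have "((\<lambda>t. C * norm ((\<Prod>\<rho>\<in>D. (complex_of_real t - \<rho>)) * of_real (exp (- l 1 * t)))) \<longlongrightarrow> C * norm
        (0::complex)) at_top"
      by (intro tendsto_intros prod_linear_exp_tendsto_zero fin l1_pos)
    thus "((\<lambda>t. C * norm ((\<Prod>\<rho>\<in>D. (complex_of_real t - \<rho>)) * of_real (exp (- l 1 * t)))) \<longlongrightarrow> 0)
        at_top" by simp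
  qed
  hence "p = 0" by (rule poly_zero_of_tendsto_zero)
  have d0: "deriv F s = 0" if "s \<notin> D" for s
    using p[OF that] that fin off_divisor_nonzero[OF mero ex that] \<open>p = 0\<close> by auto
  have "F constant_on {s. Re s > far_abscissa}"
  proof -
    have "\<exists>c. \<forall>x\<in>{s. Re s > far_abscissa}. F x = c"
    proof (rule has_field_derivative_zero_constant)
      show "convex {s. Re s > far_abscissa}" by (rule convex_halfspace_Re_gt)
      show "(F has_field_derivative 0) (at x within {s. Re s > far_abscissa})"
          if "x \<in> {s. Re s > far_abscissa}" for x
        using F_deriv(1)[of x] d0[OF far_right(2)[of x]] that far_abscissa(1)
            by (auto intro: has_field_derivative_at_within)
    qed
    thus ?thesis by (auto simp: constant_on_def)
  qed
  thus False using not_constant_half_plane by simp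
qed

lemma weight_summable_conv_exponent: "weight_summable 0 (conv_exponent F)"
proof -
  obtain d where d: "weight_summable 0 d" using conv_exponent_exists[OF finite_order] by blast
  have ws: "weight_summable 0 d \<longleftrightarrow> (\<lambda>\<rho>. real_of_int \<bar>zorder F \<rho>\<bar> / norm \<rho> ^ d) summable_on
      (D - {0})" for d
    by (simp add: weight_summable_def)
  show ?thesis unfolding ws conv_exponent_def by (rule LeastI[of _ d]) (use d ws in simp)
qed

text \<open>
Orders are integers, so exponent \<open>0\<close> would make the divisor finite.
\<close>

lemma conv_exponent_pos: "conv_exponent F \<noteq> 0"
proof
  assume "conv_exponent F = 0"
  hence "(\<lambda>\<rho>. real_of_int \<bar>n \<rho>\<bar>) summable_on D - {0}"
    using weight_summable_conv_exponent by (simp add: weight_summable_def)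
  hence "finite (D - {0})"
  proof (rule finite_of_summable_ge_1)
    fix \<rho> assume "\<rho> \<in> D - {0}"
    hence "n \<rho> \<noteq> 0" using on_divisor_zorder[OF mero ex] by blast
    hence "\<bar>n \<rho>\<bar> \<ge> 1" by linarith
    thus "real_of_int \<bar>n \<rho>\<bar> \<ge> 1" by (simp only: of_int_1_le_iff)
  qed
  thus False using infinite_divisor by simp
qed

lemma Re_le_sigma1: "\<rho> \<in> D \<Longrightarrow> Re \<rho> \<le> sigma1 F"
  unfolding sigma1_def
proof (rule cSUP_upper)
  have "Re \<rho> \<le> far_abscissa" if "\<rho> \<in> D" for \<rho>
    using far_right(2)[of \<rho>] that by (meson le_cases)
  thus "bdd_above (Re ` D)" by (intro bdd_aboveI2)
qed

lemma mindex_freq_nonneg: "k \<in> mindices I \<Longrightarrow> mindex_freq l k \<ge> 0"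
  unfolding mindex_freq_def mindices_def using pos
      by (intro sum_nonneg mult_nonneg_nonneg) (auto intro: less_imp_le)

definition arith_side :: distr where
  "arith_side \<phi> = (\<Sum>k<genus F. coeff (discrepancy_poly F) k * (distr_deriv ^^ k) (dirac 0) \<phi>)
             + (\<Sum>\<^sub>\<infinity>k\<in>mindices I. of_real (mindex_freq l k) * log_coeff a k * dirac
                 (mindex_freq l k) \<phi>)"

abbreviation "\<beta> k \<equiv> of_real (mindex_freq l k) * log_coeff a k"

text \<open>
The majorant is the absolutely convergent expansion of \<open>f'/f\<close> at \<open>s\<close>; it dominates because all
frequencies are non-negative.
\<close>

lemma arith_terms:
  assumes s: "s \<ge> far_abscissa" and f: "\<And>t. t \<ge> 0 \<Longrightarrow> norm (f t) \<le> B * exp (- s * t)"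
  shows "(\<lambda>k. \<beta> k * dirac (mindex_freq l k) f) summable_on mindices I"
    and "norm (\<Sum>\<^sub>\<infinity>k\<in>mindices I. \<beta> k * dirac (mindex_freq l k) f) \<le>
           B * (\<Sum>\<^sub>\<infinity>k\<in>mindices I. norm (\<beta> k * exp (- of_real s * of_real (mindex_freq l k))))"
proof -
  let ?g = "\<lambda>k. norm (\<beta> k * exp (- of_real s * of_real (mindex_freq l k)))"
  have "?g summable_on mindices I"
    by (rule summable_on_iff_abs_summable_on_complex[THEN iffD1, OF
        has_sum_imp_summable[OF logderiv_coeffs[OF s]]])
  hence g: "(\<lambda>k. B * ?g k) summable_on mindices I" by (rule summable_on_cmult_right)
  have le: "norm (\<beta> k * dirac (mindex_freq l k) f) \<le> B * ?g k" if "k \<in> mindices I" for k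
  proof -
    have "norm (\<beta> k) * norm (f (mindex_freq l k)) \<le>
        norm (\<beta> k) * (B * exp (- s * mindex_freq l k))"
      by (intro mult_left_mono f mindex_freq_nonneg that) auto
    thus ?thesis by (simp add: dirac_def norm_mult mult_ac)
  qed
  have n: "(\<lambda>k. norm (\<beta> k * dirac (mindex_freq l k) f)) summable_on mindices I"
    by (rule Infinite_Sum.abs_summable_on_comparison_test'[OF g le])
  thus "(\<lambda>k. \<beta> k * dirac (mindex_freq l k) f) summable_on mindices I"
      by (rule abs_summable_summable)
  have "norm (\<Sum>\<^sub>\<infinity>k\<in>mindices I. \<beta> k * dirac (mindex_freq l k) f) \<le>
      (\<Sum>\<^sub>\<infinity>k\<in>mindices I. norm (\<beta> k * dirac (mindex_freq l k) f))"
    by (rule norm_infsum_bound[OF n])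
  also have "\<dots> \<le> (\<Sum>\<^sub>\<infinity>k\<in>mindices I. B * ?g k)" by (rule infsum_mono[OF n g le])
  also have "\<dots> = B * (\<Sum>\<^sub>\<infinity>k\<in>mindices I. ?g k)" by (rule infsum_cmult_right')
  finally show "norm (\<Sum>\<^sub>\<infinity>k\<in>mindices I. \<beta> k * dirac (mindex_freq l k) f) \<le>
      B * (\<Sum>\<^sub>\<infinity>k\<in>mindices I. ?g k)" .
qed

lemma rapid_arith_summable:
  assumes s: "s \<ge> far_abscissa" and f: "rapid s f"
  shows "(\<lambda>k. \<beta> k * dirac (mindex_freq l k) f) summable_on mindices I"
proof -
  obtain B where "\<And>t. t \<ge> 0 \<Longrightarrow> norm ((vderiv ^^ 0) f t) \<le> B * exp (- s * t)"
    using f unfolding rapid_def by blast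
  thus ?thesis by (intro arith_terms(1)[OF s, of f B]) simp
qed

lemma dirac_deriv: "(distr_deriv ^^ k) (dirac 0) f = (- 1) ^ k * (vderiv ^^ k) f 0"
  by (simp add: distr_deriv_funpow dirac_def)

lemma arith_side_lincomb:
  assumes s: "s \<ge> far_abscissa" and f: "rapid s f" and g: "rapid s g"
  shows "arith_side (\<lambda>t. x * f t + y * g t) = x * arith_side f + y * arith_side g"
proof -
  have sm: "smooth f" "smooth g" using f g by (auto simp: rapid_def)
  have "((\<lambda>k. x * (\<beta> k * dirac (mindex_freq l k) f) + y * (\<beta> k * dirac (mindex_freq l k) g))
      has_sum
      x * (\<Sum>\<^sub>\<infinity>k\<in>mindices I. \<beta> k * dirac (mindex_freq l k) f) + y *
          (\<Sum>\<^sub>\<infinity>k\<in>mindices I. \<beta> k * dirac (mindex_freq l k) g)) (mindices I)"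
    by (intro has_sum_add has_sum_cmult_right has_sum_infsum rapid_arith_summable[OF s] f g)
  moreover have "x * (\<beta> k * dirac (mindex_freq l k) f) + y * (\<beta> k * dirac (mindex_freq l k) g) =
      \<beta> k * dirac (mindex_freq l k) (\<lambda>t. x * f t + y * g t)" for k
    by (simp add: dirac_def algebra_simps)
  ultimately have 1: "(\<Sum>\<^sub>\<infinity>k\<in>mindices I. \<beta> k * dirac (mindex_freq l k) (\<lambda>t. x * f t + y * g t)) =
      x * (\<Sum>\<^sub>\<infinity>k\<in>mindices I. \<beta> k * dirac (mindex_freq l k) f) + y *
          (\<Sum>\<^sub>\<infinity>k\<in>mindices I. \<beta> k * dirac (mindex_freq l k) g)"
    by (simp only: infsumI)
  have 2: "(\<Sum>k<genus F. coeff (discrepancy_poly F) k * (distr_deriv ^^ k) (dirac 0)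
      (\<lambda>t. x * f t + y * g t)) =
     x * (\<Sum>k<genus F. coeff (discrepancy_poly F) k * (distr_deriv ^^ k) (dirac 0) f) +
     y * (\<Sum>k<genus F. coeff (discrepancy_poly F) k * (distr_deriv ^^ k) (dirac 0) g)"
    unfolding dirac_deriv vderiv_lincomb[OF sm] sum_distrib_left sum.distrib[symmetric]
    by (intro sum.cong refl) (simp add: algebra_simps)
  show ?thesis unfolding arith_side_def 1 2 by (simp add: algebra_simps)
qed

lemma arith_side_bound:
  assumes s: "s \<ge> far_abscissa"
    and f: "\<And>j t. j \<le> genus F \<Longrightarrow> t \<ge> 0 \<Longrightarrow> norm ((vderiv ^^ j) f t) \<le> B * exp (- s * t)"
  shows "norm (arith_side f) \<le> ((\<Sum>k<genus F. norm (coeff (discrepancy_poly F) k)) +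
      (\<Sum>\<^sub>\<infinity>k\<in>mindices I. norm (\<beta> k * exp (- of_real s * of_real (mindex_freq l k))))) * B"
proof -
  have "norm (\<Sum>k<genus F. coeff (discrepancy_poly F) k * (distr_deriv ^^ k) (dirac 0) f) \<le>
      (\<Sum>k<genus F. norm (coeff (discrepancy_poly F) k) * B)"
  proof (rule sum_norm_le)
    fix k assume "k \<in> {..<genus F}"
    hence "norm ((vderiv ^^ k) f 0) \<le> B" using f[of k 0] by simp
    thus "norm (coeff (discrepancy_poly F) k * (distr_deriv ^^ k) (dirac 0) f) \<le>
        norm (coeff (discrepancy_poly F) k) * B"
      by (simp add: dirac_deriv norm_mult norm_power mult_left_mono)
  qed
  moreover have "norm (\<Sum>\<^sub>\<infinity>k\<in>mindices I. \<beta> k * dirac (mindex_freq l k) f) \<le>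
           B * (\<Sum>\<^sub>\<infinity>k\<in>mindices I. norm (\<beta> k * exp (- of_real s * of_real (mindex_freq l k))))"
    by (rule arith_terms(2)[OF s]) (use f[of 0] in simp)
  ultimately show ?thesis unfolding arith_side_def sum_distrib_right[symmetric]
    by (intro order_trans[OF norm_triangle_ineq]) (simp add: algebra_simps)
qed

lemma arith_side_exp:
  assumes s: "s \<ge> far_abscissa"
  shows "arith_side (\<lambda>t. exp (- of_real s * of_real t)) = G_fun F (of_real s)"
proof -
  obtain m where m: "conv_exponent F = Suc m" using conv_exponent_pos not0_implies_Suc by blast
  have w: "weight_summable 0 (Suc m)" using weight_summable_conv_exponent unfolding m .
  have nD: "complex_of_real s \<notin> D" using far_right(2)[of "of_real s"] s by simp
  have "(\<Sum>k<genus F. coeff (discrepancy_poly F) k * (distr_deriv ^^ k) (dirac 0)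
      (\<lambda>t. exp (- of_real s * of_real t))) =
        (\<Sum>k<genus F. coeff (discrepancy_poly F) k * of_real s ^ k)"
    unfolding dirac_deriv vderiv_exp by (simp flip: power_mult_distrib)
  also have "\<dots> = poly (discrepancy_poly F) (of_real s)"
    by (rule poly_deg_below[OF discrepancy_poly_spec(1)[OF finite_order m w], symmetric])
  also have "\<dots> = G_fun F (of_real s) - deriv F (of_real s) / F (of_real s)"
    by (rule discrepancy_poly_spec(2)[OF finite_order m w nD])
  finally have 1: "(\<Sum>k<genus F. coeff (discrepancy_poly F) k * (distr_deriv ^^ k) (dirac 0)
      (\<lambda>t. exp (- of_real s * of_real t))) =
      G_fun F (of_real s) - deriv F (of_real s) / F (of_real s)" .
  have 2: "(\<Sum>\<^sub>\<infinity>k\<in>mindices I. \<beta> k * dirac (mindex_freq l k) (\<lambda>t. exp (- of_real s * of_real t))) =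
      deriv F (of_real s) / F (of_real s)"
    unfolding dirac_def by (rule infsumI[OF logderiv_coeffs[OF s]])
  show ?thesis unfolding arith_side_def 1 2 by simp
qed

lemma newton_cramer_eq_arith_side:
  assumes \<phi>: "test_function \<phi>"
  shows "(\<lambda>k. \<beta> k * dirac (mindex_freq l k) \<phi>) summable_on mindices I"
    and "newton_cramer F \<phi> = arith_side \<phi>"
proof -
  obtain m where m: "conv_exponent F = Suc m" using conv_exponent_pos not0_implies_Suc by blast
  interpret left_divisor F m
    by unfold_locales (use m weight_summable_conv_exponent Re_le_sigma1 in auto)
  \<comment> \<open>to the right of \<open>1\<close> for the density, of \<open>\<sigma>1 + 1\<close> for the left side and of \<open>far_abscissa\<close>
      for the right\<close>
  define s where "s = max (max 1 (sigma1 F + 1)) far_abscissa"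
  have s: "s \<ge> 1" "s \<ge> sigma1 F + 1" "s \<ge> far_abscissa" by (auto simp: s_def)
  show "(\<lambda>k. \<beta> k * dirac (mindex_freq l k) \<phi>) summable_on mindices I"
    by (rule rapid_arith_summable[OF s(3) rapid_test_function[OF \<phi>]])
  define C where "C = (1 + \<bar>sigma1 F\<bar>) ^ Suc m * (\<integral>t. envelope t * exp (- t) \<partial>lborel) +
     ((\<Sum>k<genus F. norm (coeff (discrepancy_poly F) k)) +
      (\<Sum>\<^sub>\<infinity>k\<in>mindices I. norm (\<beta> k * exp (- of_real s * of_real (mindex_freq l k)))))"
  have "newton_cramer F \<phi> - arith_side \<phi> = 0"
  proof (rule functional_determined_by_exp[where A = "\<lambda>f. newton_cramer F f - arith_side f"
      and s = s
           and M = "max (Suc m) (genus F)" and C = C])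
    fix f g :: "real \<Rightarrow> complex" and x y
    assume fg: "rapid s f" "rapid s g"
    show "newton_cramer F (\<lambda>t. x * f t + y * g t) - arith_side (\<lambda>t. x * f t + y * g t) =
          x * (newton_cramer F f - arith_side f) + y * (newton_cramer F g - arith_side g)"
      unfolding newton_cramer_lincomb[OF fg s(2)] arith_side_lincomb[OF s(3) fg]
          by (simp add: algebra_simps)
  next
    fix f :: "real \<Rightarrow> complex" and e
    assume f: "rapid s f" and le: "\<And>j t. j \<le> max (Suc m) (genus F) \<Longrightarrow> t \<ge> 0 \<Longrightarrow>
        norm ((vderiv ^^ j) f t) \<le> e * exp (- s * t)"
    have 1: "norm (newton_cramer F f) \<le> (1 + \<bar>sigma1 F\<bar>) ^ Suc m *
        (\<integral>t. envelope t * exp (- t) \<partial>lborel) * e"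
      by (rule newton_cramer_bound[OF f s(2) le]) auto
    have 2: "norm (arith_side f) \<le> ((\<Sum>k<genus F. norm (coeff (discrepancy_poly F) k)) +
      (\<Sum>\<^sub>\<infinity>k\<in>mindices I. norm (\<beta> k * exp (- of_real s * of_real (mindex_freq l k))))) * e"
      by (rule arith_side_bound[OF s(3) le]) auto
    show "norm (newton_cramer F f - arith_side f) \<le> C * e"
      unfolding C_def distrib_right[of "(1 + \<bar>sigma1 F\<bar>) ^ Suc m *
          (\<integral>t. envelope t * exp (- t) \<partial>lborel)"]
      by (rule order_trans[OF norm_triangle_ineq4 add_mono[OF 1 2]])
  next
    fix k :: nat
    have "s + real k > sigma1 F" "s + real k \<ge> far_abscissa" using s by auto
    thus "newton_cramer F (\<lambda>t. exp (- of_real (s + real k) * of_real t)) - arith_side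
        (\<lambda>t. exp (- of_real (s + real k) * of_real t)) = 0"
      by (simp only: newton_cramer_exp arith_side_exp diff_self)
  qed (use s \<phi> in auto)
  thus "newton_cramer F \<phi> = arith_side \<phi>" by simp
qed

end

theorem theorem3p5:
  fixes I :: "nat set" and a :: "nat \<Rightarrow> complex" and l :: "nat \<Rightarrow> real"
    and F :: "complex \<Rightarrow> complex" and \<sigma> :: real
  assumes index: "(\<exists>N. I = {1..N}) \<or> (I = {1..} \<and> filterlim l at_top sequentially)"
    and pos: "\<And>n. n \<in> I \<Longrightarrow> 0 < l n"
    and mono: "strict_mono_on I l"
    and abs_conv: "(\<lambda>n. norm (a n) * exp (- l n * \<sigma>)) summable_on I"
    and series: "\<And>s. Re s > \<sigma> \<Longrightarrow>
                   F s = 1 + (\<Sum>\<^sub>\<infinity>n\<in>I. a n * exp (- of_real (l n) * s))"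
    and mero: "F nicely_meromorphic_on UNIV"
    and finite_order: "meromorphic_finite_order F"
    and nonconstant: "\<not> F constant_on UNIV"
  shows "\<forall>\<phi>. test_function \<phi> \<longrightarrow>
           (\<lambda>k. of_real (mindex_freq l k) * log_coeff a k * dirac (mindex_freq l k) \<phi>)
              summable_on mindices I \<and>
           newton_cramer F \<phi> =
             (\<Sum>k<genus F. coeff (discrepancy_poly F) k * (distr_deriv ^^ k) (dirac 0) \<phi>)
             + (\<Sum>\<^sub>\<infinity>k\<in>mindices I.
                  of_real (mindex_freq l k) * log_coeff a k * dirac (mindex_freq l k) \<phi>)"
proof -
  interpret dirichlet_series I a l F \<sigma>
    by unfold_locales (fact assms)+
  show ?thesis using newton_cramer_eq_arith_side unfolding arith_side_def by blast
qed

end
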